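(* Assume $V$ satisfies (V1)–(V2), $f$ satisfies (f1)–(f3) and $K$ satisfies (K1)–(K3). There exists a constant $\Lambda^*>0$, depending only on $n,s,K,V_\infty,\theta,p,c_0$ and $f$ (in particular independent of $R$), such that the following holds: if there are $R>0$ and $\Lambda>\Lambda^*$ with $V(x)\ge\Lambda$ for all $|x|\ge R$, then problem (P) has a nonnegative, nontrivial weak solution $u\in E$, i.e. $u\ge0$ a.e., $u\not\equiv0$, and $$[u,\varphi]+\int_{\mathbb R^n}V(x)u\varphi\,dx=\int_{\mathbb R^n}f(u)\varphi\,dx\quad\text{for all }\varphi\in E.$$
   Context: Let $n\ge1$, $s\in(0,1)$ with $n>2s$, and $2^*_s=\frac{2n}{n-2s}$; $B_\rho$ denotes the open ball of radius $\rho$ centred at $0$ in $\mathbb R^n$. $K:\mathbb R^n\to(0,\infty)$ is measurable and satisfies (K1) $K(x)=K(-x)$ for all $x$; (K2) there is $\lambda>0$ with $\lambda\le K(x)|x|^{n+2s}$ for a.e. $x$; (K3) $\min\{|x|^2,1\}K(x)\in L^1(\mathbb R^n)$. For measurable $u,v$ write $[u,v]=\int_{\mathbb R^n}\int_{\mathbb R^n}(u(x)-u(y))(v(x)-v(y))K(x-y)\,dx\,dy$. $X$ is the space of measurable $u\in L^2(\mathbb R^n)$ with $[u,u]<\infty$, normed by $\|u\|_X^2=\|u\|_{L^2}^2+[u,u]$. $V:\mathbb R^n\to\mathbb R$ is continuous with (V1) $\inf_{\mathbb R^n}V>0$ and (V2) $V(x)\le V_\infty$ for all $x\in B_1$, for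 some constant $V_\infty>0$. $E=\{u\in X:\int V u^2<\infty\}$ with norm $\|u\|^2=[u,u]+\int_{\mathbb R^n}V(x)u^2dx$. $f:\mathbb R\to\mathbb R$ is continuous with (f1) $|f(t)|\le c_0|t|^{p-1}$ for all $t$, for some $c_0>0$ and $p\in(2,2^*_s)$; (f2) there is $\theta>2$ with $\theta F(t)\le tf(t)$ for all $t>0$, where $F(t)=\int_0^tf(\tau)d\tau$; (f3) $f(t)>0$ for $t>0$ and $f(t)=0$ for $t<0$. Problem (P) is $-\mathcal L_Ku+V(x)u=f(u)$ in $\mathbb R^n$, where $-\mathcal L_Ku(x)=2\int_{\mathbb R^n}(u(x)-u(y))K(x-y)dy$, understood in the weak sense stated in the claim. *)

theory Defs
  imports "HOL-Analysis.Analysis"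
begin

text \<open>Integrand of the bilinear form [u,v]; the double integral over R^n x R^n is taken
  with respect to Lebesgue measure on the product space 'a \<times> 'a (= R^{2n}).\<close>
definition kform_integrand :: "('a::euclidean_space \<Rightarrow> real) \<Rightarrow> ('a \<Rightarrow> real) \<Rightarrow> ('a \<Rightarrow> real) \<Rightarrow> 'a \<times> 'a \<Rightarrow> real" where
  "kform_integrand K u v z = (u (fst z) - u (snd z)) * (v (fst z) - v (snd z)) * K (fst z - snd z)"

definition kform :: "('a::euclidean_space \<Rightarrow> real) \<Rightarrow> ('a \<Rightarrow> real) \<Rightarrow> ('a \<Rightarrow> real) \<Rightarrow> real" where
  "kform K u v = (\<integral> z. kform_integrand K u v z \<partial>lebesgue)"

definition inX :: "('a::euclidean_space \<Rightarrow> real) \<Rightarrow> ('a \<Rightarrow> real) \<Rightarrow> bool" where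
  "inX K u \<longleftrightarrow> u \<in> borel_measurable lebesgue \<and> integrable lebesgue (\<lambda>x. (u x)\<^sup>2) \<and>
     (\<integral>\<^sup>+ z. ennreal (kform_integrand K u u z) \<partial>lebesgue) < \<infinity>"

definition inE :: "('a::euclidean_space \<Rightarrow> real) \<Rightarrow> ('a \<Rightarrow> real) \<Rightarrow> ('a \<Rightarrow> real) \<Rightarrow> bool" where
  "inE K V u \<longleftrightarrow> inX K u \<and> (\<integral>\<^sup>+ x. ennreal (V x * (u x)\<^sup>2) \<partial>lebesgue) < \<infinity>"

definition prim :: "(real \<Rightarrow> real) \<Rightarrow> real \<Rightarrow> real" where
  "prim f t = integral {0..t} f"

end

theory Submission
  imports Defs "HOL-Library.Diagonal_Subsequence" "HOL-Library.Function_Algebras"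
begin

text \<open>
  The solution is a critical point of the energy \<open>J u = N(u)\<^sup>2 / 2 - \<integral> F(u)\<close> at the mountain pass level,
  where \<open>N\<close> is the norm of \<open>E\<close>. Testing the level with a fixed bump supported in the unit ball bounds
  it by a constant that does not see \<open>V\<close> outside that ball, and condition (f2) turns this into a
  bound \<open>M + 1\<close> for the norms of a Palais-Smale sequence that depends on \<open>V\<close> only through \<open>V\<^sub>\<infinity>\<close>.
  A subsequence converges almost everywhere, its limit is a critical point, and testing with the
  negative part shows that the limit is nonnegative. If the limit were zero, the sequence would vanish
  in \<open>L\<^sup>p(B\<^sub>R)\<close>. Outside \<open>B\<^sub>R\<close> the bound \<open>V \<ge> \<Lambda>\<close> and the weak Sobolev inequality make
  \<open>c\<^sub>0 \<integral> |u|\<^sup>p\<close> at most \<open>N(u)\<^sup>2 / 2\<close> as soon as \<open>\<Lambda>\<close> exceeds a threshold depending on \<open>M\<close> but not on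
  \<open>R\<close>; hence the norms, and with them the energies, would tend to zero, although the mountain pass
  level is positive.
\<close>

section \<open>A mountain pass principle in a seminormed space\<close>

text \<open>The threshold may depend on \<open>V\<close> only through \<open>Vinf\<close>, so the
  lower bound \<open>c\<close> of \<open>V\<close> has to stay out of it. That bound does enter the
  radius of the small ball around 0, the moduli of continuity of the derivative and the lower
  estimate of the level, but of these quantities only the positivity matters. The numbers that do
  matter are chosen in the order energy bound \<open>C0\<close>, norm bound \<open>M\<close>,
  truncation height \<open>l\<close>, threshold, and none of them sees \<open>c\<close> or
  \<open>R\<close>. A second obstacle is that \<open>f\<close> is merely continuous. The derivative
  of the energy is then continuous but not locally Lipschitz, and its gradient need not generate a
  flow; chains of finitely many points need no flow. The third is the lack of compactness on the
  whole space: \<open>V\<close> need not tend to infinity, so mass may escape. Only convergence on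
  balls is available, and the remaining mass has to be absorbed by the norm itself. For this a
  weak-type bound on level sets suffices, since all exponents in use are strictly
  subcritical.\<close>

text \<open>Neither completeness nor an inner product is needed: paths are replaced by \<open>\<eta>\<close>-chains
  from \<open>0\<close> to the region \<open>N u \<ge> M\<close>, and \<open>c\<close> is the least level at which such chains exist for every
  \<open>\<eta>\<close>. As the derivative is uniformly continuous on bounded sets, one step of fixed length \<open>\<delta>\<close> along
  almost steepest descent directions \<open>W\<close>, interpolated linearly between neighbouring vertices, would
  lower every chain below \<open>c\<close> if there were no almost critical points near that level. In the region
  \<open>N u \<ge> M\<close> the radial direction is used instead, so that the end of a chain never re-enters the
  ball.\<close>

lemma rtrancl_chain:
  fixes g :: "nat \<Rightarrow> 'v" and r :: "('v \<times> 'v) set"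
  assumes "\<And>k. k < m \<Longrightarrow> (g k, g (Suc k)) \<in> r" "k \<le> m"
  shows "(g 0, g k) \<in> r\<^sup>*"
  using assms(2) by (induction k) (use assms(1) in \<open>auto intro: rtrancl_into_rtrancl\<close>)

lemma mountain_pass:
  fixes S :: "'v::real_vector set" and N J :: "'v \<Rightarrow> real" and D :: "'v \<Rightarrow> 'v \<Rightarrow> real"
  assumes S: "subspace S"
    and N_nonneg: "\<And>x. x \<in> S \<Longrightarrow> 0 \<le> N x"
    and N_add: "\<And>x y. x \<in> S \<Longrightarrow> y \<in> S \<Longrightarrow> N (x + y) \<le> N x + N y"
    and N_scale: "\<And>r x. x \<in> S \<Longrightarrow> N (r *\<^sub>R x) = \<bar>r\<bar> * N x"
    and D_add: "\<And>u x y. u \<in> S \<Longrightarrow> x \<in> S \<Longrightarrow> y \<in> S \<Longrightarrow> D u (x + y) = D u x + D u y"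
    and D_scale: "\<And>u r x. u \<in> S \<Longrightarrow> x \<in> S \<Longrightarrow> D u (r *\<^sub>R x) = r * D u x"
    and D_bounded: "\<And>B. \<exists>C. \<forall>u\<in>S. N u \<le> B \<longrightarrow> (\<forall>h\<in>S. \<bar>D u h\<bar> \<le> C * N h)"
    and J_diff: "\<And>B \<epsilon>. \<epsilon> > 0 \<Longrightarrow> \<exists>\<delta>>0. \<forall>u\<in>S. \<forall>h\<in>S. N u \<le> B \<and> N h \<le> \<delta> \<longrightarrow>
          \<bar>J (u + h) - J u - D u h\<bar> \<le> \<epsilon> * N h"
    and D_unif: "\<And>B \<epsilon>. \<epsilon> > 0 \<Longrightarrow> \<exists>\<delta>>0. \<forall>u\<in>S. \<forall>h\<in>S. N u \<le> B \<and> N h \<le> \<delta> \<longrightarrow>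
          (\<forall>k\<in>S. \<bar>D (u + h) k - D u k\<bar> \<le> \<epsilon> * N k)"
    and J_0: "J 0 = 0"
    and \<rho>: "0 < \<sigma>" "\<sigma> < \<rho>" "\<rho> \<le> M" and \<alpha>: "\<alpha> > 0"
    and ridge: "\<And>u. u \<in> S \<Longrightarrow> \<sigma> \<le> N u \<Longrightarrow> N u \<le> \<rho> \<Longrightarrow> \<alpha> \<le> J u"
    and e: "e \<in> S" "N e > 0" "\<And>t. 0 \<le> t \<Longrightarrow> J (t *\<^sub>R e) \<le> L"
    and \<kappa>: "\<kappa> > 0" 
    and outward: "\<And>u. u \<in> S \<Longrightarrow> M \<le> N u \<Longrightarrow> J u \<le> L + 1 \<Longrightarrow> D u u \<le> - \<kappa> * N u"
  shows "\<exists>c\<ge>\<alpha>. \<forall>\<epsilon>>0. \<exists>u\<in>S. N u \<le> M + 1 \<and> \<bar>J u - c\<bar> \<le> \<epsilon> \<and> (\<forall>h\<in>S. \<bar>D u h\<bar> \<le> \<epsilon> * N h)"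
proof -
  note Sc = subspace_0[OF S] subspace_add[OF S] subspace_diff[OF S] subspace_scale[OF S]
  have N_0: "N 0 = 0" using N_scale[OF Sc(1), of 0] by simp
  \<comment> \<open>Only the vertices of a chain are confined to the sublevel set, not the segments
    between them; demanding chains of every mesh \<open>\<eta>\<close> compensates for this.\<close>
  define rel where "rel a \<eta> = {(x,y). x \<in> S \<and> y \<in> S \<and> J x \<le> a \<and> J y \<le> a \<and> N (y - x) \<le> \<eta>}" for a \<eta>
  define adm where "adm a \<longleftrightarrow> (\<forall>\<eta>>0. \<exists>u. (0,u) \<in> (rel a \<eta>)\<^sup>* \<and> M \<le> N u)" for a
  have adm_C0: "adm L"
    unfolding adm_def
  proof (intro allI impI)
    fix \<eta> :: real assume "\<eta> > 0"
    define g where "g k = (real k * (\<eta> / N e)) *\<^sub>R e" for k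
    obtain m :: nat where m: "M < real m * \<eta>"
      using reals_Archimedean3[OF \<open>\<eta> > 0\<close>] by blast
    have "(g k, g (Suc k)) \<in> rel L \<eta>" for k
    proof -
      have "g (Suc k) - g k = (\<eta> / N e) *\<^sub>R e"
        by (simp add: g_def add_divide_distrib algebra_simps)
      moreover have "N ((\<eta> / N e) *\<^sub>R e) = \<eta>" using e \<open>\<eta> > 0\<close> N_scale by simp
      ultimately show ?thesis
        unfolding rel_def using e Sc \<open>\<eta> > 0\<close> by (auto simp: g_def)
    qed
    then have "(g 0, g m) \<in> (rel L \<eta>)\<^sup>*" using rtrancl_chain by blast
    moreover have "N (g m) = real m * \<eta>" using e \<open>\<eta> > 0\<close> N_scale by (simp add: g_def)
    moreover have "g 0 = 0" by (simp add: g_def)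
    ultimately show "\<exists>u. (0, u) \<in> (rel L \<eta>)\<^sup>* \<and> M \<le> N u" using m by (intro exI[of _ "g m"]) auto
  qed
  have adm_ge: "\<alpha> \<le> a" if "adm a" for a
  proof (rule ccontr)
    assume "\<not> \<alpha> \<le> a"
    \<comment> \<open>With this mesh a chain cannot leap over the annulus between
      \<open>\<sigma>\<close> and \<open>\<rho>\<close>: the successor of a vertex with
      \<open>N < \<sigma>\<close> has \<open>N \<le> \<rho>\<close>, and in the annulus
      \<open>J\<close> is at least \<open>\<alpha> > a\<close>.\<close>
    define \<eta> where "\<eta> = \<rho> - \<sigma>"
    obtain u where u: "(0,u) \<in> (rel a \<eta>)\<^sup>*" "M \<le> N u"
      using \<open>adm a\<close> \<rho> unfolding adm_def \<eta>_def by (metis diff_gt_0_iff_gt)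
    from u(1) have "u \<in> S \<and> N u < \<sigma>"
    proof (induction rule: rtrancl_induct)
      case base then show ?case using N_0 \<rho> Sc by simp
    next
      case (step y z)
      then have yz: "y \<in> S" "z \<in> S" "J z \<le> a" "N (z - y) \<le> \<eta>" by (auto simp: rel_def)
      have "N z \<le> N y + N (z - y)" using N_add[of y "z - y"] yz Sc by simp
      then have "N z \<le> \<rho>" using yz step.IH unfolding \<eta>_def by linarith
      then show ?case using ridge[of z] yz \<open>\<not> \<alpha> \<le> a\<close> by fastforce
    qed
    then show False using u \<rho> by linarith
  qed
  define c where "c = Inf {a. adm a}"
  have bdd: "bdd_below {a. adm a}" by (rule bdd_belowI[of _ \<alpha>]) (use adm_ge in auto)
  have c_ge: "\<alpha> \<le> c" unfolding c_def using adm_C0 adm_ge by (intro cInf_greatest) auto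
  have c_le: "c \<le> a" if "adm a" for a unfolding c_def using that bdd by (intro cInf_lower) auto
  have c_near: "\<exists>a. adm a \<and> a < c + \<epsilon>" if "\<epsilon> > 0" for \<epsilon>
    using cInf_lessD[of "{a. adm a}" "c + \<epsilon>"] adm_C0 that unfolding c_def by auto
  have "\<exists>u\<in>S. N u \<le> M + 1 \<and> \<bar>J u - c\<bar> \<le> \<epsilon> \<and> (\<forall>h\<in>S. \<bar>D u h\<bar> \<le> \<epsilon> * N h)" if "\<epsilon> > 0" for \<epsilon>
  proof (rule ccontr)
    assume no_PS: "\<not> ?thesis"
    \<comment> \<open>Each bound has its own use: \<open>\<epsilon>\<close> contradicts the
      assumption, \<open>\<kappa>\<close> serves the radial direction, \<open>\<alpha>/2\<close>
      puts \<open>J 0 = 0\<close> below \<open>c - e1/2\<close> so that the start of a chain stays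
      put, and \<open>1\<close> lets \<open>J u \<le> c + e1\<close> imply the hypothesis
      \<open>J u \<le> L + 1\<close> of \<open>outward\<close>.\<close>
    define e1 where "e1 = min (min \<epsilon> \<kappa>) (min (\<alpha>/2) 1)"
    have e1: "e1 > 0" "e1 \<le> \<epsilon>" "e1 \<le> \<kappa>" "e1 \<le> \<alpha>/2" "e1 \<le> 1"
      using \<open>\<epsilon> > 0\<close> \<kappa> \<alpha> by (auto simp: e1_def)
    obtain C' where C': "\<forall>u\<in>S. N u \<le> M + 1 \<longrightarrow> (\<forall>h\<in>S. \<bar>D u h\<bar> \<le> C' * N h)"
      using D_bounded by blast
    define C where "C = max C' 0"
    have C: "C \<ge> 0" "\<And>u h. u \<in> S \<Longrightarrow> N u \<le> M + 1 \<Longrightarrow> h \<in> S \<Longrightarrow> \<bar>D u h\<bar> \<le> C * N h"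
    proof -
      show "C \<ge> 0" by (simp add: C_def)
      fix u h assume "u \<in> S" "N u \<le> M + 1" "h \<in> S"
      then have "\<bar>D u h\<bar> \<le> C' * N h" "C' * N h \<le> C * N h"
        using C' N_nonneg by (auto simp: C_def intro!: mult_right_mono)
      then show "\<bar>D u h\<bar> \<le> C * N h" by linarith
    qed
    have dir: "\<exists>w\<in>S. N w \<le> 1 \<and> e1 \<le> D u w" if u: "u \<in> S" "N u \<le> M + 1" "\<bar>J u - c\<bar> \<le> e1" for u
    proof -
      obtain h where h: "h \<in> S" "\<not> \<bar>D u h\<bar> \<le> \<epsilon> * N h"
        using no_PS u e1 by force
      \<comment> \<open>\<open>N\<close> is only a seminorm, but a bounded \<open>D u\<close>
        vanishes on vectors of length zero, so \<open>h\<close> can be normalised.\<close>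
      have "N h \<noteq> 0" using h C(2)[OF u(1,2) h(1)] by auto
      then have Nh: "N h > 0" using N_nonneg h by force
      define w where "w = (sgn (D u h) / N h) *\<^sub>R h"
      have "N w \<le> 1" using Nh h by (simp add: w_def N_scale abs_sgn_eq)
      moreover have "D u w = \<bar>D u h\<bar> / N h"
        using u h by (simp add: w_def D_scale) (metis mult.commute linordered_idom_class.abs_sgn)
      moreover have "\<epsilon> < \<bar>D u h\<bar> / N h" using h Nh by (simp add: field_simps)
      ultimately show ?thesis using h Sc e1 by (intro bexI[of _ w]) (auto simp: w_def)
    qed
    \<comment> \<open>\<open>W\<close> points uphill and vertices move by
      \<open>- \<delta> *\<^sub>R W\<close>, so the minus sign in the radial case sends them
      outwards. The choice made by \<open>SOME\<close> is not continuous in \<open>u\<close>, which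
      chains tolerate.\<close>
    define W where "W u = (if J u < c - e1/2 then 0 else if M \<le> N u then - (1 / N u) *\<^sub>R u
        else SOME w. w \<in> S \<and> N w \<le> 1 \<and> e1 \<le> D u w)" for u
    have D_0: "D u 0 = 0" if "u \<in> S" for u using D_scale[OF that Sc(1), of 0] by simp
    have W: "W u \<in> S \<and> N (W u) \<le> 1 \<and> 0 \<le> D u (W u) \<and> (c - e1/2 \<le> J u \<longrightarrow> e1 \<le> D u (W u))"
      if u: "u \<in> S" "N u \<le> M + 1" "J u \<le> c + e1" for u
    proof -
      consider "J u < c - e1/2" | "c - e1/2 \<le> J u" "M \<le> N u" | "c - e1/2 \<le> J u" "N u < M"
        by linarith
      then show ?thesis
      proof cases
        case 1 then show ?thesis using u D_0 N_0 Sc by (simp add: W_def)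
      next
        case 2
        have "J u \<le> L + 1" using u c_le[OF adm_C0] e1 by linarith
        then have "D u u \<le> - \<kappa> * N u" using outward u 2 by blast
        moreover have Nu: "N u > 0" using 2 \<rho> by linarith
        ultimately have "\<kappa> \<le> - D u u / N u" by (simp add: field_simps)
        moreover have "W u = (- (1 / N u)) *\<^sub>R u" using 2 by (simp add: W_def)
        ultimately show ?thesis
          using u Nu Sc(4)[OF u(1), of "- (1 / N u)"] e1 D_scale[of u u "- (1 / N u)"]
            N_scale[of u "- (1 / N u)"] by auto
      next
        case 3
        then have "\<bar>J u - c\<bar> \<le> e1" using u e1 by auto
        then have "\<exists>w. w \<in> S \<and> N w \<le> 1 \<and> e1 \<le> D u w" using dir[OF u(1,2)] by blast
        from someI_ex[OF this] have "W u \<in> S \<and> N (W u) \<le> 1 \<and> e1 \<le> D u (W u)"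
          using 3 by (simp add: W_def)
        then show ?thesis using e1 by auto
      qed
    qed
    have W_0: "W 0 = 0" using J_0 c_ge e1 \<alpha> by (simp add: W_def)
    obtain \<delta>1 where \<delta>1: "\<delta>1 > 0" "\<And>u h. u \<in> S \<Longrightarrow> h \<in> S \<Longrightarrow> N u \<le> M + 1 \<Longrightarrow> N h \<le> \<delta>1 \<Longrightarrow>
          \<bar>J (u + h) - J u - D u h\<bar> \<le> e1/8 * N h"
      using J_diff[of "e1/8" "M + 1"] e1 by auto
    obtain \<delta>2 where \<delta>2: "\<delta>2 > 0" "\<And>u h k. u \<in> S \<Longrightarrow> h \<in> S \<Longrightarrow> N u \<le> M + 1 \<Longrightarrow> N h \<le> \<delta>2 \<Longrightarrow> k \<in> S \<Longrightarrow>
          \<bar>D (u + h) k - D u k\<bar> \<le> e1/8 * N k"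
      using D_unif[of "e1/8" "M + 1"] e1 by auto
    define \<delta> where "\<delta> = min \<delta>1 1"
    have \<delta>: "\<delta> > 0" "\<delta> \<le> \<delta>1" "\<delta> \<le> 1" using \<delta>1 by (auto simp: \<delta>_def)
    \<comment> \<open>The gain is the smaller of what the two cases of \<open>low\<close> leave
      over: \<open>3/4 * \<delta> * e1\<close> minus the surplus
      \<open>a - c < \<delta> * e1 / 4\<close>, or, next to a vertex that is already low,
      \<open>3/8 * e1\<close> minus errors of at most \<open>e1/4\<close>.\<close>
    define a' where "a' = c - min (\<delta> * e1 / 4) (e1 / 8)"
    have "a' < c" using \<delta> e1 by (simp add: a'_def)
    obtain a where a: "adm a" "a < c + min (\<delta> * e1 / 4) e1"
      using c_near[of "min (\<delta> * e1 / 4) e1"] e1 \<delta> by auto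
    have "adm a'"
      unfolding adm_def
    proof (intro allI impI)
      fix \<eta> :: real assume "\<eta> > 0"
      \<comment> \<open>The mesh of the given chain must fit the new one (\<open>\<eta>\<close>),
        keep the last vertex within \<open>M + 1\<close> (\<open>1\<close>), permit both expansions
        (\<open>\<delta>1\<close>, \<open>\<delta>2\<close>) and let \<open>J\<close> vary by at
        most \<open>e1/8\<close> between neighbours (the last term).\<close>
      define \<eta>' where "\<eta>' = min (min \<eta> 1) (min (min \<delta>1 \<delta>2) (e1 / (8 * (C + 1))))"
      have \<eta>': "\<eta>' > 0" "\<eta>' \<le> \<eta>" "\<eta>' \<le> 1" "\<eta>' \<le> \<delta>1" "\<eta>' \<le> \<delta>2" "\<eta>' \<le> e1 / (8 * (C + 1))"
        using \<open>\<eta> > 0\<close> \<delta>1 \<delta>2 e1 C by (auto simp: \<eta>'_def)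
      \<comment> \<open>Stopping at the first vertex with \<open>N \<ge> M\<close> keeps all
        vertices in the ball of radius \<open>M + 1\<close>, where the estimates are
        uniform.\<close>
      define cut where "cut = rel a \<eta>' \<inter> {(x,y). N x < M}"
      obtain u where u: "(0,u) \<in> (rel a \<eta>')\<^sup>*" "M \<le> N u" using a(1) \<eta>' unfolding adm_def by blast
      from u(1) have "(0,u) \<in> cut\<^sup>* \<or> (\<exists>u'. (0,u') \<in> cut\<^sup>* \<and> M \<le> N u')"
      proof (induction rule: rtrancl_induct)
        case (step y z)
        show ?case
        proof (cases "M \<le> N y")
          case False
          then have "(y, z) \<in> cut" using step.hyps by (simp add: cut_def)
          then show ?thesis using step.IH by (meson rtrancl.rtrancl_into_rtrancl)
        qed (use step.IH in blast)
      qed simp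
      then obtain z where z: "(0,z) \<in> cut\<^sup>*" "M \<le> N z" using u by blast
      have low: "J (x - \<delta> *\<^sub>R ((1 - t) *\<^sub>R W x + t *\<^sub>R W y)) \<le> a' \<and>
          x - \<delta> *\<^sub>R ((1 - t) *\<^sub>R W x + t *\<^sub>R W y) \<in> S"
        if x: "x \<in> S" "N x \<le> M + 1" "J x \<le> a" and y: "y \<in> S" "N y \<le> M + 1" "J y \<le> a"
          and xy: "N (y - x) \<le> \<eta>'" and t: "0 \<le> t" "t \<le> 1" for x y t
      proof -
        have ac: "a \<le> c + e1" using a by linarith
        note Wx = W[OF x(1,2) order_trans[OF x(3) ac]] and Wy = W[OF y(1,2) order_trans[OF y(3) ac]]
        define w where "w = (1 - t) *\<^sub>R W x + t *\<^sub>R W y"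
        have wS: "w \<in> S" unfolding w_def by (intro Sc(2) Sc(4)) (use Wx Wy in auto)
        have "N w \<le> (1 - t) * N (W x) + t * N (W y)"
          unfolding w_def using N_add N_scale Wx Wy Sc t by (metis abs_of_nonneg diff_ge_0_iff_ge)
        also have "\<dots> \<le> (1 - t) * 1 + t * 1"
          using Wx Wy t by (intro add_mono mult_left_mono) auto
        finally have Nw: "N w \<le> 1" by simp
        have h: "(-\<delta>) *\<^sub>R w \<in> S" "N ((-\<delta>) *\<^sub>R w) \<le> \<delta>"
          using Sc(4)[OF wS, of "-\<delta>"] N_scale[OF wS, of "-\<delta>"] Nw \<delta> mult_left_mono[OF Nw, of \<delta>] by auto
        have "J (x + (-\<delta>) *\<^sub>R w) \<le> J x + D x ((-\<delta>) *\<^sub>R w) + e1/8 * N ((-\<delta>) *\<^sub>R w)"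
          using \<delta>1(2)[OF x(1) h(1) x(2)] h \<delta> by linarith
        moreover have "e1/8 * N ((-\<delta>) *\<^sub>R w) \<le> e1/8 * \<delta>"
          using h e1 by (intro mult_left_mono) auto
        moreover have "D x ((-\<delta>) *\<^sub>R w) = -\<delta> * D x w" using D_scale x wS by blast
        ultimately have J1: "J (x + (-\<delta>) *\<^sub>R w) \<le> J x - \<delta> * D x w + e1/8 * \<delta>" by simp
        have Dw: "D x w = (1 - t) * D x (W x) + t * D x (W y)"
          unfolding w_def using D_add D_scale x Wx Wy Sc by simp
        have xyx: "x + (y - x) = y" by simp
        have yx: "y - x \<in> S" using x y Sc by blast
        \<comment> \<open>\<open>W y\<close> is an ascent direction at \<open>y\<close>, yet the
          step starts from \<open>x\<close>; uniform continuity of \<open>D\<close> transfers it at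
          a cost of \<open>e1/8\<close>.\<close>
        have "\<bar>D (x + (y - x)) (W y) - D x (W y)\<bar> \<le> e1/8 * N (W y)"
          using \<delta>2(2)[OF x(1) yx x(2)] xy \<eta>' Wy by auto
        moreover have "e1/8 * N (W y) \<le> e1/8 * 1" using Wy e1 by (intro mult_left_mono) auto
        ultimately have Dy: "D y (W y) - e1/8 \<le> D x (W y)" unfolding xyx by linarith
        have "\<bar>J (x + (y - x)) - J x - D x (y - x)\<bar> \<le> e1/8 * N (y - x)"
          using \<delta>1(2)[OF x(1) yx x(2)] xy \<eta>' by auto
        moreover have "\<bar>D x (y - x)\<bar> \<le> C * N (y - x)" using C(2) x yx by blast
        moreover have "e1/8 * N (y - x) \<le> 1 * N (y - x)" 
          using N_nonneg[OF yx] e1 by (intro mult_right_mono) auto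
        moreover have "C * N (y - x) + 1 * N (y - x) \<le> e1 / 8"
        proof -
          have "(C + 1) * N (y - x) \<le> (C + 1) * (e1 / (8 * (C + 1)))"
            using xy \<eta>' C by (intro mult_left_mono) auto
          also have "\<dots> = e1 / 8" using C by (simp add: field_simps)
          finally show ?thesis by (simp add: algebra_simps)
        qed
        ultimately have osc: "\<bar>J y - J x\<bar> \<le> e1/8" unfolding xyx by linarith
        have "J (x + (-\<delta>) *\<^sub>R w) \<le> a'"
        proof (cases "c - e1/2 \<le> J x \<and> c - e1/2 \<le> J y")
          case True
          have "(1 - t) * (7/8 * e1) + t * (7/8 * e1) \<le> D x w"
            unfolding Dw using True Wx Wy Dy t e1 by (intro add_mono mult_left_mono) auto
          moreover have "(1 - t) * (7/8 * e1) + t * (7/8 * e1) = 7/8 * e1" by argo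
          ultimately have "7/8 * e1 \<le> D x w" by linarith
          then have "\<delta> * (7/8 * e1) \<le> \<delta> * D x w" using \<delta> by (intro mult_left_mono) auto
          then have "J (x + (-\<delta>) *\<^sub>R w) \<le> a - 3/4 * (\<delta> * e1)"
            using J1 x(3) by (simp add: algebra_simps)
          moreover have "a \<le> c + \<delta> * e1 / 4" "\<delta> * e1 > 0" using a e1 \<delta> by auto
          moreover have "min (\<delta> * e1 / 4) (e1 / 8) \<le> \<delta> * e1 / 4" by simp
          ultimately show ?thesis unfolding a'_def by argo
        next
          case False
          then have Jx: "J x \<le> c - 3/8 * e1" using osc e1 by linarith
          have "(1 - t) * (- e1/8) + t * (- e1/8) \<le> D x w"
            unfolding Dw using Wx Wy Dy t e1 by (intro add_mono mult_left_mono) auto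
          moreover have "(1 - t) * (- e1/8) + t * (- e1/8) = - e1/8" by argo
          ultimately have "- e1/8 \<le> D x w" by linarith
          then have "\<delta> * (- e1/8) \<le> \<delta> * D x w" using \<delta> by (intro mult_left_mono) auto
          moreover have "\<delta> * e1 \<le> 1 * e1" using \<delta> e1 by (intro mult_right_mono) auto
          ultimately have "J (x + (-\<delta>) *\<^sub>R w) \<le> c - e1/8"
            using J1 Jx by (simp add: algebra_simps)
          moreover have "min (\<delta> * e1 / 4) (e1 / 8) \<le> e1 / 8" by simp
          ultimately show ?thesis unfolding a'_def by argo
        qed
        moreover have "x + (-\<delta>) *\<^sub>R w \<in> S" using x(1) h(1) Sc by blast
        ultimately show ?thesis by (simp add: w_def)
      qed
      have a0: "J 0 \<le> a" using J_0 c_le[OF a(1)] c_ge \<alpha> by linarith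
      have "z \<in> S \<and> N z \<le> M + 1 \<and> J z \<le> a \<and> (0, z - \<delta> *\<^sub>R W z) \<in> (rel a' \<eta>)\<^sup>*"
        using z(1)
      proof (induction rule: rtrancl_induct)
        case base
        then show ?case using W_0 N_0 Sc \<rho> a0 by simp
      next
        case (step x y)
        have x: "x \<in> S" "N x \<le> M + 1" "J x \<le> a" using step.IH by auto
        have y: "y \<in> S" "J y \<le> a" "N (y - x) \<le> \<eta>'" "N x < M"
          using step.hyps by (auto simp: cut_def rel_def)
        have "N y \<le> N x + N (y - x)" using N_add[of x "y - x"] x y Sc by simp
        then have Ny: "N y \<le> M + 1" using y \<eta>' by linarith
        \<comment> \<open>Between \<open>x - \<delta> *\<^sub>R W x\<close> and
          \<open>x - \<delta> *\<^sub>R W y\<close> the direction is interpolated in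
          \<open>m\<close> steps. As \<open>N (W x - W y) \<le> 2\<close>, each has length at most
          \<open>2 * \<delta> / m \<le> \<eta>\<close>. One further step of length
          \<open>N (y - x)\<close> reaches \<open>y - \<delta> *\<^sub>R W y\<close>.\<close>
        obtain m0 :: nat where m0: "2 * \<delta> < real m0 * \<eta>" using reals_Archimedean3[OF \<open>\<eta> > 0\<close>] by blast
        define m where "m = Suc m0"
        have m: "2 * \<delta> \<le> real m * \<eta>" "m > 0"
          using m0 \<open>\<eta> > 0\<close> by (auto simp: m_def algebra_simps)
        define g where "g k = x - \<delta> *\<^sub>R ((1 - k / m) *\<^sub>R W x + (k / m) *\<^sub>R W y)" for k :: nat
        have WS: "W x \<in> S" "W y \<in> S" "N (W x) \<le> 1" "N (W y) \<le> 1"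
          using W[of x] W[of y] x y Ny a e1 by auto
        have "N (W x - W y) \<le> N (W x) + N ((-1) *\<^sub>R W y)"
          using N_add[of "W x" "(-1) *\<^sub>R W y"] WS Sc(4)[OF WS(2), of "-1"] by auto
        then have NW: "N (W x - W y) \<le> 2" using WS N_scale[OF WS(2), of "-1"] by simp
        have g_low: "J (g k) \<le> a' \<and> g k \<in> S" if "k \<le> m" for k
          unfolding g_def using low[OF x y(1) Ny y(2,3), of "k / m"] that m by auto
        have "(g k, g (Suc k)) \<in> rel a' \<eta>" if "k < m" for k
        proof -
          have "g (Suc k) - g k = (\<delta> / m) *\<^sub>R (W x - W y)"
            by (simp add: g_def algebra_simps add_divide_distrib)
          then have "N (g (Suc k) - g k) = \<delta> / m * N (W x - W y)"
            using N_scale[OF Sc(3)[OF WS(1,2)], of "\<delta> / m"] \<delta> by simp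
          also have "\<dots> \<le> \<delta> / m * 2" using NW \<delta> by (intro mult_left_mono) auto
          also have "\<dots> \<le> \<eta>" using m by (simp add: field_simps)
          finally show ?thesis using g_low that by (auto simp: rel_def)
        qed
        then have "(g 0, g m) \<in> (rel a' \<eta>)\<^sup>*" using rtrancl_chain by blast
        moreover have g0: "g 0 = x - \<delta> *\<^sub>R W x" and gm: "g m = x - \<delta> *\<^sub>R W y" using m by (auto simp: g_def)
        moreover have "(x - \<delta> *\<^sub>R W y, y - \<delta> *\<^sub>R W y) \<in> rel a' \<eta>"
          using g_low[of m] gm low[OF y(1) Ny y(2) y(1) Ny y(2), of 0] y \<eta>' N_0
          by (auto simp: rel_def)
        ultimately have "(0, y - \<delta> *\<^sub>R W y) \<in> (rel a' \<eta>)\<^sup>*"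
          using step.IH by (metis rtrancl.rtrancl_into_rtrancl rtrancl_trans)
        then show ?case using y Ny by blast
      qed
      moreover have "M \<le> N (z - \<delta> *\<^sub>R W z)" if "z \<in> S"
      proof (cases "J z < c - e1/2")
        case True then show ?thesis using z by (simp add: W_def)
      next
        case False
        then have "z - \<delta> *\<^sub>R W z = (1 + \<delta> / N z) *\<^sub>R z"
          using z by (simp add: W_def algebra_simps)
        then have "N (z - \<delta> *\<^sub>R W z) = (1 + \<delta> / N z) * N z"
          using N_scale that \<delta> z \<rho> by simp
        also have "\<dots> = N z + \<delta>" using z \<rho> by (simp add: field_simps)
        finally show ?thesis using z \<delta> by linarith
      qed
      ultimately show "\<exists>u. (0, u) \<in> (rel a' \<eta>)\<^sup>* \<and> M \<le> N u" by blast
    qed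
    then show False using c_le \<open>a' < c\<close> by fastforce
  qed
  then show ?thesis using c_ge by blast
qed

section \<open>Lebesgue measure on a product and convergence of integrals\<close>

text \<open>A Lebesgue measurable function may be composed with a Borel map if preimages of null
  sets are null. This makes \<open>u (fst z)\<close> and \<open>K (fst z - snd z)\<close> measurable
  on the product and carries a.e. properties of \<open>u\<close> and \<open>K\<close> there.\<close>

lemma nonsingular_map_lebesgue:
  fixes g :: "'b::euclidean_space \<Rightarrow> 'a::euclidean_space"
  assumes g: "g \<in> borel_measurable borel"
    and null: "\<And>A. A \<in> null_sets lborel \<Longrightarrow> g -` A \<in> null_sets lborel"
  shows "g \<in> lebesgue \<rightarrow>\<^sub>M lebesgue" "(AE x in lebesgue. P x) \<Longrightarrow> AE z in lebesgue. P (g z)"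
proof -
  have g': "g \<in> lebesgue \<rightarrow>\<^sub>M lborel" using g by (intro measurable_completion) simp
  show "g \<in> lebesgue \<rightarrow>\<^sub>M lebesgue"
  proof (rule completion.measurable_completion2[OF g'], rule subsetI)
    fix A assume "A \<in> null_sets (lborel :: 'a measure)"
    then show "A \<in> null_sets (distr lebesgue lborel g)"
      using null[of A] g' null_sets_completionI[of "g -` A" lborel]
      by (auto simp: null_sets_def emeasure_distr)
  qed
  assume P: "AE x in lebesgue. P x"
  obtain A where A: "{x. \<not> P x} \<subseteq> A" "A \<in> null_sets lborel"
    using P unfolding AE_completion_iff by (auto elim!: AE_E simp: null_sets_def)
  show "AE z in lebesgue. P (g z)"
    by (rule AE_I'[OF null_sets_completionI[OF null[OF A(2)]]]) (use A in auto)
qed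

lemma null_sets_vimage_fst:
  fixes A :: "'a::euclidean_space set"
  assumes "A \<in> null_sets lborel"
  shows "fst -` A \<in> null_sets (lborel :: ('a \<times> 'b::euclidean_space) measure)"
proof -
  have "fst -` A = A \<times> (UNIV :: 'b set)" by auto
  moreover have "A \<times> (UNIV :: 'b set) \<in> null_sets (lborel \<Otimes>\<^sub>M lborel)"
    using assms by (subst null_sets_def) (auto simp: null_sets_def lborel.emeasure_pair_measure_Times)
  ultimately show ?thesis by (simp add: lborel_prod)
qed

lemma null_sets_vimage_snd:
  fixes A :: "'b::euclidean_space set"
  assumes "A \<in> null_sets lborel"
  shows "snd -` A \<in> null_sets (lborel :: ('a::euclidean_space \<times> 'b) measure)"
proof -
  have "snd -` A = (UNIV :: 'a set) \<times> A" by auto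
  moreover have "(UNIV :: 'a set) \<times> A \<in> null_sets (lborel \<Otimes>\<^sub>M lborel)"
    using assms by (subst null_sets_def) (auto simp: null_sets_def lborel.emeasure_pair_measure_Times)
  ultimately show ?thesis by (simp add: lborel_prod)
qed

lemma borel_measurable_fst_snd: 
  "fst \<in> borel_measurable (borel :: ('a::second_countable_topology \<times> 'b::second_countable_topology) measure)"
  "snd \<in> borel_measurable (borel :: ('a::second_countable_topology \<times> 'b::second_countable_topology) measure)"
  by (auto intro!: borel_measurable_continuous_onI continuous_intros)

lemma borel_measurable_diff_pair:
  "(\<lambda>z. fst z - snd z) \<in> borel_measurable (borel :: ('a::euclidean_space \<times> 'a) measure)"
  by (auto intro!: borel_measurable_continuous_onI continuous_intros)

text \<open>Every slice in the first variable is a translate of \<open>A\<close>, so Tonelli's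
  theorem gives measure zero.\<close>

lemma null_sets_vimage_diff:
  fixes A :: "'a::euclidean_space set"
  assumes A: "A \<in> null_sets lborel"
  shows "(\<lambda>z. fst z - snd z) -` A \<in> null_sets (lborel :: ('a \<times> 'a) measure)"
proof -
  let ?B = "(\<lambda>z::'a \<times> 'a. fst z - snd z) -` A"
  have B: "?B \<in> sets (lborel \<Otimes>\<^sub>M lborel)"
    using measurable_sets[OF borel_measurable_diff_pair, of A] A
    unfolding lborel_prod by (simp add: null_sets_def)
  have "emeasure (lborel \<Otimes>\<^sub>M lborel) ?B = (\<integral>\<^sup>+ y. emeasure lborel ((\<lambda>x. (x, y)) -` ?B) \<partial>lborel)"
    by (rule lborel_pair.emeasure_pair_measure_alt2[OF B])
  also have "\<dots> = (\<integral>\<^sup>+ y. 0 \<partial>(lborel :: 'a measure))"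
  proof (intro nn_integral_cong)
    fix y :: 'a
    have "(\<lambda>x. (x, y)) -` ?B = {x. x - y \<in> A}" by auto
    then show "emeasure lborel ((\<lambda>x. (x, y)) -` ?B) = 0"
      using null_sets_translation[OF A, of y] by auto
  qed
  finally show ?thesis using B unfolding lborel_prod by (simp add: null_sets_def)
qed

lemma measurable_fst_lebesgue: "fst \<in> (lebesgue :: ('a::euclidean_space \<times> 'b::euclidean_space) measure) \<rightarrow>\<^sub>M lebesgue"
  and AE_lebesgue_fst: "(AE x in lebesgue. P x) \<Longrightarrow> AE z::'a::euclidean_space \<times> 'b::euclidean_space in lebesgue. P (fst z)"
  using nonsingular_map_lebesgue[OF borel_measurable_fst_snd(1) null_sets_vimage_fst] by blast+

lemma measurable_snd_lebesgue: "snd \<in> (lebesgue :: ('a::euclidean_space \<times> 'b::euclidean_space) measure) \<rightarrow>\<^sub>M lebesgue"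
  and AE_lebesgue_snd: "(AE x in lebesgue. P x) \<Longrightarrow> AE z::'a::euclidean_space \<times> 'b::euclidean_space in lebesgue. P (snd z)"
  using nonsingular_map_lebesgue[OF borel_measurable_fst_snd(2) null_sets_vimage_snd] by blast+

lemma measurable_diff_lebesgue: "(\<lambda>z. fst z - snd z) \<in> (lebesgue :: ('a::euclidean_space \<times> 'a) measure) \<rightarrow>\<^sub>M lebesgue"
  and AE_lebesgue_diff: "(AE x in lebesgue. P x) \<Longrightarrow> AE z::'a::euclidean_space \<times> 'a in lebesgue. P (fst z - snd z)"
  using nonsingular_map_lebesgue[OF borel_measurable_diff_pair null_sets_vimage_diff] by blast+

text \<open>Iterated integrals are taken over the Borel product; passing to a Borel representative
  makes them available and changes no integral.\<close>

lemma AE_lebesgue_eq_borel: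
  fixes u :: "'a::euclidean_space \<Rightarrow> real"
  assumes "u \<in> borel_measurable lebesgue"
  obtains v where "v \<in> borel_measurable borel" "AE x in lebesgue. u x = v x"
  using completion_ex_borel_measurable_real[OF assms] by (auto simp: AE_completion_iff)

text \<open>This replaces weak compactness: for a bounded sequence in \<open>L\<^sup>2\<close> that converges almost
  everywhere, \<open>|x y| \<le> y\<^sup>2 / \<epsilon> + \<epsilon> x\<^sup>2\<close> supplies the majorants, so the convergence is also weak.\<close>

lemma dominated_up_to_small:
  fixes a b :: "nat \<Rightarrow> 'a \<Rightarrow> real"
  assumes [measurable]: "\<And>k. a k \<in> borel_measurable M" and a: "\<And>k x. 0 \<le> a k x"
    and lim: "AE x in M. (\<lambda>k. a k x) \<longlonglongrightarrow> 0"
    and b: "\<And>k. integrable M (b k)" "\<And>k. (\<integral>x. b k x \<partial>M) \<le> C" "\<And>k x. 0 \<le> b k x"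
    and W: "\<And>\<epsilon>. \<epsilon> > 0 \<Longrightarrow> \<exists>W. integrable M W \<and> (\<forall>x. 0 \<le> W x) \<and> (\<forall>k x. a k x \<le> W x + \<epsilon> * b k x)"
  shows "integrable M (a k)" "(\<lambda>k. \<integral>x. a k x \<partial>M) \<longlonglongrightarrow> 0"
proof -
  show int: "integrable M (a k)" for k
  proof -
    obtain W where W: "integrable M W" "\<And>x. 0 \<le> W x" "\<And>k x. a k x \<le> W x + 1 * b k x"
      using W[of 1] by auto
    show ?thesis
      by (rule Bochner_Integration.integrable_bound[of _ "\<lambda>x. W x + 1 * b k x"])
        (use W b a in \<open>auto intro!: AE_I2 simp: abs_of_nonneg\<close>)
  qed
  have C: "C \<ge> 0" using b(2,3) order_trans[OF integral_nonneg_AE[of "b 0" M] b(2)[of 0]] by auto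
  show "(\<lambda>k. \<integral>x. a k x \<partial>M) \<longlonglongrightarrow> 0"
  proof (rule LIMSEQ_I)
    fix r :: real assume r: "0 < r"
    define \<epsilon> where "\<epsilon> = r / (2 * (C + 1))"
    have \<epsilon>: "\<epsilon> > 0" using r C by (simp add: \<epsilon>_def)
    obtain W where W: "integrable M W" "\<And>x. 0 \<le> W x" "\<And>k x. a k x \<le> W x + \<epsilon> * b k x"
      using W[OF \<epsilon>] by auto
    note [measurable] = borel_measurable_integrable[OF W(1)]
    \<comment> \<open>In \<open>a k \<le> min (a k) W + \<epsilon> * b k\<close> dominated
      convergence with majorant \<open>W\<close> applies to the first summand, and the integral of
      the second is at most \<open>\<epsilon> * C\<close>.\<close>
    have min_int: "integrable M (\<lambda>x. min (a k x) (W x))" for k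
      by (rule Bochner_Integration.integrable_bound[OF W(1)]) (use W a in \<open>auto intro!: AE_I2 simp: abs_of_nonneg\<close>)
    have "(\<lambda>k. \<integral>x. min (a k x) (W x) \<partial>M) \<longlonglongrightarrow> (\<integral>x. 0 \<partial>M)"
    proof (rule integral_dominated_convergence[where w = W])
      show "AE x in M. (\<lambda>k. min (a k x) (W x)) \<longlonglongrightarrow> 0"
        using lim
      proof eventually_elim
        case (elim x)
        show ?case
          by (rule tendsto_sandwich[OF _ _ tendsto_const elim]) (use a W in auto)
      qed
    qed (use W a in \<open>auto intro!: AE_I2 simp: abs_of_nonneg\<close>)
    then have "(\<lambda>k. \<integral>x. min (a k x) (W x) \<partial>M) \<longlonglongrightarrow> 0" by simp
    then obtain k0 where k0: "\<And>k. k \<ge> k0 \<Longrightarrow> \<bar>\<integral>x. min (a k x) (W x) \<partial>M\<bar> < r / 2"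
      using r half_gt_zero[OF r] unfolding LIMSEQ_iff by (metis real_norm_def diff_zero)
    show "\<exists>no. \<forall>k\<ge>no. norm ((\<integral>x. a k x \<partial>M) - 0) < r"
    proof (intro exI[of _ k0] allI impI)
      fix k assume "k \<ge> k0"
      have "(\<integral>x. a k x \<partial>M) \<le> (\<integral>x. min (a k x) (W x) + \<epsilon> * b k x \<partial>M)"
      proof (intro integral_mono int Bochner_Integration.integrable_add min_int integrable_mult_right b)
        fix x show "a k x \<le> min (a k x) (W x) + \<epsilon> * b k x" 
          using W(3)[of k x] b(3)[of k x] \<epsilon> by (auto simp: min_def)
      qed
      also have "\<dots> = (\<integral>x. min (a k x) (W x) \<partial>M) + \<epsilon> * (\<integral>x. b k x \<partial>M)"
        using min_int b by simp
      also have "\<dots> < r / 2 + \<epsilon> * C"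
        using k0[OF \<open>k \<ge> k0\<close>] b(2)[of k] \<epsilon> by (intro add_less_le_mono mult_left_mono) auto
      also have "\<epsilon> * C \<le> r / 2"
        using C r by (simp add: \<epsilon>_def field_simps)
      finally show "norm ((\<integral>x. a k x \<partial>M) - 0) < r"
        using integral_nonneg_AE[of "a k" M] a by auto
    qed
  qed
qed

section \<open>A weak Sobolev inequality\<close>

locale kernel =
  fixes K :: "'a::euclidean_space \<Rightarrow> real" and s lam :: real
  assumes s: "0 < s" "2 * s < real DIM('a)"
    and K_meas: "K \<in> borel_measurable lebesgue" and K_pos: "\<And>x. 0 < K x"
    and lam: "0 < lam" and K_lower: "AE x in lebesgue. lam \<le> K x * norm x powr (real DIM('a) + 2 * s)"
begin

definition dim :: real where "dim = real DIM('a)"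
text \<open>The power of the measure in \<open>level_step\<close>. Since
  \<open>1 - tau = 2 / qs\<close>, iterating that inequality produces the exponent
  \<open>qs / 2\<close>.\<close>

definition tau :: real where "tau = 2 * s / dim"
text \<open>The critical Sobolev exponent \<open>2n/(n-2s)\<close>.\<close>

definition qs :: real where "qs = 2 * dim / (dim - 2 * s)"

lemma dim_pos: "dim > 0" by (simp add: dim_def)

lemma tau: "0 < tau" "tau < 1" "qs * (1 - tau) = 2" "qs > 2" "qs * tau + 2 = qs"
proof -
  have d: "2 * s < dim" using s by (simp add: dim_def)
  show "0 < tau" "tau < 1" using s d dim_pos by (simp_all add: tau_def)
  have "1 - tau = (dim - 2 * s) / dim" using dim_pos by (simp add: tau_def diff_divide_distrib)
  then show "qs * (1 - tau) = 2" using d dim_pos by (simp add: qs_def)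
  then show "qs * tau + 2 = qs" unfolding right_diff_distrib by linarith
  show "qs > 2" using d s by (simp add: qs_def less_divide_eq)
qed

lemma kform_integrand_measurable:
  assumes u: "u \<in> borel_measurable lebesgue" and v: "v \<in> borel_measurable lebesgue"
  shows "kform_integrand K u v \<in> borel_measurable lebesgue"
proof -
  note [measurable] = measurable_compose[OF measurable_fst_lebesgue u] measurable_compose[OF measurable_snd_lebesgue u]
    measurable_compose[OF measurable_fst_lebesgue v] measurable_compose[OF measurable_snd_lebesgue v]
    measurable_compose[OF measurable_diff_lebesgue K_meas]
  show ?thesis unfolding kform_integrand_def by measurable
qed

lemma kform_integrand_nonneg: "0 \<le> kform_integrand K u u z"
  using K_pos less_imp_le[OF K_pos] by (simp add: kform_integrand_def)

lemma kform_nonneg: "0 \<le> kform K u u"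
  unfolding kform_def by (intro integral_nonneg_AE AE_I2 kform_integrand_nonneg)

lemma inX_measurable: "inX K u \<Longrightarrow> u \<in> borel_measurable lebesgue"
  by (simp add: inX_def)

lemma inX_sq_integrable: "inX K u \<Longrightarrow> integrable lebesgue (\<lambda>x. (u x)\<^sup>2)"
  by (simp add: inX_def)

lemma inX_integrable: assumes "inX K u" shows "integrable lebesgue (kform_integrand K u u)"
  using assms by (intro integrableI_nonneg kform_integrand_measurable AE_I2 kform_integrand_nonneg) (auto simp: inX_def)

lemma inX_nn_integral: assumes "inX K u"
  shows "(\<integral>\<^sup>+ z. ennreal (kform_integrand K u u z) \<partial>lebesgue) = ennreal (kform K u u)"
  unfolding kform_def using inX_integrable[OF assms]
  by (intro nn_integral_eq_integral AE_I2 kform_integrand_nonneg)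

section \<open>The measure of level sets\<close>

definition level :: "('a \<Rightarrow> real) \<Rightarrow> real \<Rightarrow> real" where
  "level u t = measure lebesgue {x. t < \<bar>u x\<bar>}"

lemma level_set_measurable:
  fixes u :: "'b::euclidean_space \<Rightarrow> real"
  shows "u \<in> borel_measurable lebesgue \<Longrightarrow> {x. t < \<bar>u x\<bar>} \<in> sets lebesgue"
  using measurable_sets[of "\<lambda>x. \<bar>u x\<bar>" lebesgue borel "{t<..}"] borel_measurable_abs[of u lebesgue] by (auto simp: vimage_def)

lemma level_finite:
  assumes u: "inX K u" and t: "t > 0"
  shows "emeasure lebesgue {x. t < \<bar>u x\<bar>} = ennreal (level u t)" "t\<^sup>2 * level u t \<le> (\<integral>x. (u x)\<^sup>2 \<partial>lebesgue)"
    "{x. t < \<bar>u x\<bar>} \<in> fmeasurable lebesgue"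
proof -
  note [measurable] = inX_measurable[OF u]
  have "t\<^sup>2 \<le> (u x)\<^sup>2" if "t < \<bar>u x\<bar>" for x
    using power_mono[of t "\<bar>u x\<bar>" 2] that t by simp
  moreover have "{x \<in> space lebesgue. t\<^sup>2 \<le> (u x)\<^sup>2} \<in> sets lebesgue" by measurable
  ultimately have "emeasure lebesgue {x. t < \<bar>u x\<bar>} \<le> emeasure lebesgue {x \<in> space lebesgue. t\<^sup>2 \<le> (u x)\<^sup>2}"
    by (intro emeasure_mono) auto
  also have "\<dots> \<le> ennreal ((1 / t\<^sup>2) * (\<integral>x. (u x)\<^sup>2 \<partial>lebesgue))"
    using t by (intro integral_Markov_inequality inX_sq_integrable u) auto
  finally have le: "emeasure lebesgue {x. t < \<bar>u x\<bar>} \<le> ennreal ((1 / t\<^sup>2) * (\<integral>x. (u x)\<^sup>2 \<partial>lebesgue))" .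
  show fm: "{x. t < \<bar>u x\<bar>} \<in> fmeasurable lebesgue"
    using le level_set_measurable[OF inX_measurable[OF u]] by (intro fmeasurableI) (auto intro: le_less_trans)
  show eq: "emeasure lebesgue {x. t < \<bar>u x\<bar>} = ennreal (level u t)"
    unfolding level_def using fm by (simp add: emeasure_eq_measure2)
  have "level u t \<le> (1 / t\<^sup>2) * (\<integral>x. (u x)\<^sup>2 \<partial>lebesgue)"
    using le unfolding eq by (subst (asm) ennreal_le_iff) auto
  then show "t\<^sup>2 * level u t \<le> (\<integral>x. (u x)\<^sup>2 \<partial>lebesgue)"
    using t by (simp add: field_simps)
qed

lemma level_nonneg: "0 \<le> level u t" by (simp add: level_def)

text \<open>A ball of volume \<open>2 * a\<close> has a radius \<open>r\<close> with
  \<open>r powr (dim + 2 * s) = (2 * a / \<omega>) powr (1 + tau)\<close>, where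
  \<open>\<omega>\<close> is the volume of the unit ball. One factor \<open>a\<close> cancels
  against the measure of the part of the ball that is used.\<close>

definition C1 :: real where "C1 = (2 / unit_ball_vol dim) powr (1 + tau) / lam"

lemma C1_pos: "C1 > 0" unfolding C1_def using lam dim_pos
  by (intro divide_pos_pos) (auto simp: less_imp_neq[THEN not_sym])

text \<open>Around a point with \<open>|u| > 2 t\<close> take the ball of volume \<open>2 * level u t\<close>. On at least half of it
  \<open>|u| \<le> t\<close>, and there the kernel is bounded from below by (K2).\<close>

lemma level_step:
  assumes u: "inX K u" and t: "t > 0"
  shows "t\<^sup>2 * level u (2 * t) \<le> C1 * kform K u u * level u t powr tau"
proof (cases "level u t = 0")
  \<comment> \<open>A ball of volume zero would be useless, so null level sets are treated
    apart.\<close>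
  case True
  have "level u (2 * t) \<le> level u t"
    unfolding level_def using t level_finite(3)[OF u] by (intro measure_mono_fmeasurable) auto
  then have "level u (2 * t) = 0" using True level_nonneg[of u "2 * t"] by simp
  then show ?thesis using True by simp
next
  case False
  define a where "a = level u t"
  define a2 where "a2 = level u (2 * t)"
  define \<omega> where "\<omega> = unit_ball_vol dim"
  have a: "a > 0" using False level_nonneg[of u t] by (simp add: a_def)
  have a2: "a2 \<ge> 0" by (simp add: a2_def level_nonneg)
  have \<omega>: "\<omega> > 0" using dim_pos by (simp add: \<omega>_def)
  define r where "r = (2 * a / \<omega>) powr (1 / dim)"
  have r: "r > 0" using a \<omega> by (simp add: r_def)
  have rn: "\<omega> * r ^ DIM('a) = 2 * a"
  proof -
    have "r ^ DIM('a) = r powr dim" using r by (simp add: powr_realpow dim_def)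
    also have "\<dots> = 2 * a / \<omega>" using a \<omega> dim_pos by (simp add: r_def powr_powr)
    finally show ?thesis using \<omega> by simp
  qed
  obtain v where v[measurable]: "v \<in> borel_measurable borel" and uv: "AE x in lebesgue. u x = v x"
    using AE_lebesgue_eq_borel[OF inX_measurable[OF u]] .
  note [measurable] = inX_measurable[OF u]
  have v'[measurable]: "v \<in> borel_measurable lebesgue" by (intro measurable_completion) simp
  define A where "A = {x. t < \<bar>v x\<bar>}"
  define A2 where "A2 = {x. 2 * t < \<bar>v x\<bar>}"
  have meas[measurable]: "A \<in> sets borel" "A2 \<in> sets borel" unfolding A_def A2_def by auto
  have em: "emeasure lborel {x. c < \<bar>v x\<bar>} = ennreal (level u c)" if "c > 0" for c
  proof -
    have "emeasure lborel {x. c < \<bar>v x\<bar>} = emeasure lebesgue {x. c < \<bar>v x\<bar>}" by simp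
    also have "\<dots> = emeasure lebesgue {x. c < \<bar>u x\<bar>}"
    proof (rule emeasure_eq_AE)
      show "AE x in lebesgue. (x \<in> {x. c < \<bar>v x\<bar>}) = (x \<in> {x. c < \<bar>u x\<bar>})"
        using uv by eventually_elim simp
    qed (use level_set_measurable[OF inX_measurable[OF u]] level_set_measurable[OF v'] in auto)
    finally show ?thesis using level_finite(1)[OF u that] by simp
  qed
  have emA: "emeasure lborel A = ennreal a" "emeasure lborel A2 = ennreal a2"
    using em[of t] em[of "2 * t"] t by (auto simp: A_def A2_def a_def a2_def)
  \<comment> \<open>For \<open>x\<close> in \<open>A2\<close> the slice of \<open>B\<close> is a
    ball of volume \<open>2 * a\<close> without \<open>A\<close>, hence has measure at least
    \<open>a\<close>. Almost everywhere on \<open>B\<close> the two values of \<open>u\<close>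
    differ by at least \<open>t\<close>.\<close>
  define B where "B = {z. fst z \<in> A2 \<and> snd z \<notin> A \<and> norm (fst z - snd z) < r}"
  have "{z \<in> space (borel \<Otimes>\<^sub>M borel). fst z \<in> A2 \<and> snd z \<notin> A \<and> norm (fst z - snd z) < r} \<in> sets (borel \<Otimes>\<^sub>M borel)"
    by measurable
  then have B: "B \<in> sets (borel \<Otimes>\<^sub>M borel)" by (simp add: B_def space_pair_measure)
  then have B': "B \<in> sets (lborel \<Otimes>\<^sub>M lborel)" by simp
  have B'': "B \<in> sets lebesgue" using B' unfolding lborel_prod by simp
  have "ennreal (a2 * a) = (\<integral>\<^sup>+ x. ennreal a * indicator A2 x \<partial>lborel)"
    using a a2 emA by (simp add: nn_integral_cmult_indicator ennreal_mult mult.commute)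
  also have "\<dots> \<le> (\<integral>\<^sup>+ x. emeasure lborel (Pair x -` B) \<partial>lborel)"
  proof (intro nn_integral_mono)
    fix x :: 'a
    show "ennreal a * indicator A2 x \<le> emeasure lborel (Pair x -` B)"
    proof (cases "x \<in> A2")
      case True
      have eq: "Pair x -` B = ball x r - A" using True by (auto simp: B_def dist_norm)
      have Afm: "A \<in> fmeasurable lborel" using emA meas by (intro fmeasurableI) auto
      have bfm: "ball x r - A \<in> fmeasurable lborel"
        by (rule fmeasurable_Diff) (auto intro!: fmeasurableI simp: emeasure_ball r less_imp_le)
      have "2 * a = measure lborel (ball x r)"
        using rn r by (simp add: content_ball \<omega>_def dim_def)
      also have "\<dots> \<le> measure lborel ((ball x r - A) \<union> A)"
        by (rule measure_mono_fmeasurable) (use Afm bfm fmeasurable.Un[OF bfm Afm] in auto)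
      also have "\<dots> \<le> measure lborel (ball x r - A) + measure lborel A"
        by (rule measure_Un_le) auto
      also have "measure lborel A = a" using emA a by (simp add: measure_def)
      finally have "a \<le> measure lborel (ball x r - A)" by simp
      then show ?thesis using True bfm unfolding eq by (simp add: emeasure_eq_measure2 ennreal_leI)
    qed simp
  qed
  also have "\<dots> = emeasure (lborel \<Otimes>\<^sub>M lborel) B"
    by (rule lborel.emeasure_pair_measure_alt[OF B', symmetric])
  also have "\<dots> = emeasure lebesgue B" using B' unfolding lborel_prod by simp
  finally have emB: "ennreal (a2 * a) \<le> emeasure lebesgue B" .
  define c where "c = t\<^sup>2 * (lam / r powr (dim + 2 * s))"
  have c: "c > 0" using t lam r by (simp add: c_def)
  have "ennreal c * ennreal (a2 * a) \<le> ennreal c * emeasure lebesgue B"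
    using emB by (rule mult_left_mono) simp
  also have "\<dots> = (\<integral>\<^sup>+ z. ennreal c * indicator B z \<partial>lebesgue)"
    using B'' by (simp add: nn_integral_cmult_indicator)
  also have "\<dots> \<le> (\<integral>\<^sup>+ z. ennreal (kform_integrand K u u z) \<partial>lebesgue)"
  proof (rule nn_integral_mono_AE)
    have "AE z::'a\<times>'a in lebesgue. u (fst z) = v (fst z)" "AE z::'a\<times>'a in lebesgue. u (snd z) = v (snd z)"
      "AE z in lebesgue. lam \<le> K (fst z - snd z) * norm (fst z - snd z) powr (dim + 2 * s)"
      using AE_lebesgue_fst[OF uv] AE_lebesgue_snd[OF uv] AE_lebesgue_diff[OF K_lower] 
      by (auto simp: dim_def)
    then show "AE z in lebesgue. ennreal c * indicator B z \<le> ennreal (kform_integrand K u u z)"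
    proof eventually_elim
      case (elim z)
      show ?case
      proof (cases "z \<in> B")
        case True
        define d where "d = norm (fst z - snd z)"
        \<comment> \<open>On the diagonal (K2) would read \<open>lam \<le> 0\<close>, because
          \<open>0 powr y = 0\<close>.\<close>
        have "d \<noteq> 0" using elim(3) lam by (auto simp: d_def)
        then have d: "d > 0" "d < r" using True by (auto simp: d_def B_def)
        have "lam / r powr (dim + 2 * s) \<le> lam / d powr (dim + 2 * s)"
          using d lam s dim_pos by (intro divide_left_mono powr_mono2 mult_pos_pos) auto
        also have "\<dots> \<le> K (fst z - snd z)"
          using elim(3) d by (simp add: d_def field_simps)
        finally have K: "lam / r powr (dim + 2 * s) \<le> K (fst z - snd z)" .
        have "\<bar>u (fst z)\<bar> > 2 * t" "\<bar>u (snd z)\<bar> \<le> t"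
          using True elim by (auto simp: B_def A_def A2_def)
        then have "t \<le> \<bar>u (fst z) - u (snd z)\<bar>" by linarith
        then have "t\<^sup>2 \<le> (u (fst z) - u (snd z))\<^sup>2"
          using power_mono[of t "\<bar>u (fst z) - u (snd z)\<bar>" 2] t by simp
        then have "c \<le> (u (fst z) - u (snd z))\<^sup>2 * K (fst z - snd z)"
          unfolding c_def using K lam by (intro mult_mono) auto
        then show ?thesis using True by (simp add: kform_integrand_def power2_eq_square ennreal_leI)
      qed simp
    qed
  qed
  also have "\<dots> = ennreal (kform K u u)" by (rule inX_nn_integral[OF u])
  finally have "c * (a2 * a) \<le> kform K u u"
    using c a a2 kform_nonneg by (simp add: ennreal_mult[symmetric])
  moreover have "r powr (dim + 2 * s) = (2 / \<omega>) powr (1 + tau) * a powr tau * a"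
  proof -
    have "r powr (dim + 2 * s) = (2 * a / \<omega>) powr (1 / dim * (dim + 2 * s))" by (simp add: r_def powr_powr)
    also have "1 / dim * (dim + 2 * s) = 1 + tau" using dim_pos by (simp add: tau_def field_simps)
    also have "(2 * a / \<omega>) = (2 / \<omega>) * a" by simp
    also have "((2 / \<omega>) * a) powr (1 + tau) = (2 / \<omega>) powr (1 + tau) * a powr (1 + tau)"
      by (rule powr_mult)
    also have "a powr (1 + tau) = a powr tau * a" using a by (simp add: powr_add)
    finally show ?thesis by (simp add: mult.assoc)
  qed
  moreover have "c * r powr (dim + 2 * s) = t\<^sup>2 * lam" using r by (simp add: c_def)
  ultimately have "(t\<^sup>2 * lam * a2) * a \<le> (kform K u u * ((2 / \<omega>) powr (1 + tau) * a powr tau)) * a"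
    using mult_right_mono[of "c * (a2 * a)" "kform K u u" "r powr (dim + 2 * s)"] powr_ge_zero[of r "dim + 2 * s"]
    by (simp add: mult_ac)
  then have "t\<^sup>2 * lam * a2 \<le> kform K u u * ((2 / \<omega>) powr (1 + tau) * a powr tau)"
    using a by (rule mult_right_le_imp_le)
  then have "t\<^sup>2 * lam * a2 / lam \<le> kform K u u * ((2 / \<omega>) powr (1 + tau) * a powr tau) / lam"
    using lam by (intro divide_right_mono) auto
  then show ?thesis
    using lam unfolding a_def[symmetric] a2_def[symmetric] C1_def \<omega>_def[symmetric] by (simp add: mult_ac)
qed

text \<open>\<open>D powr (qs / 2)\<close> is the positive fixed point of
  \<open>y \<mapsto> D * y powr tau\<close>, as \<open>qs / 2 = 1 / (1 - tau)\<close>. For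
  \<open>D = 2 powr qs * C1 * G\<close>, with \<open>G\<close> the energy, \<open>Cw\<close> is what
  remains after \<open>G powr (qs / 2)\<close> has been split off.\<close>

definition Cw :: real where "Cw = (2 powr qs * C1) powr (qs / 2)"

lemma Cw_pos: "Cw > 0" using C1_pos by (simp add: Cw_def)

text \<open>With \<open>b t = t powr qs * level u t\<close> the previous lemma reads \<open>b (2 t) \<le> D * b t powr tau\<close>. A value
  above the fixed point of this recursion would persist along \<open>t / 2 ^ k\<close>, whereas \<open>b\<close> tends to \<open>0\<close>
  there by Chebyshev's inequality.\<close>

lemma weak_sobolev:
  assumes u: "inX K u" and t: "t > 0"
  shows "t powr qs * level u t \<le> Cw * kform K u u powr (qs / 2)"
proof -
  define G where "G = kform K u u"
  have G: "G \<ge> 0" by (simp add: G_def kform_nonneg)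
  define D where "D = 2 powr qs * C1 * G"
  define b where "b t = t powr qs * level u t" for t
  have b_nonneg: "b r \<ge> 0" for r by (simp add: b_def level_nonneg)
  have step: "b (2 * r) \<le> D * b r powr tau" if r: "r > 0" for r
  proof -
    \<comment> \<open>The exponent is split so that \<open>r\<^sup>2\<close> goes with the left side
      of \<open>level_step\<close> and \<open>r powr (qs * tau)\<close> completes
      \<open>b r powr tau\<close>.\<close>
    have "r powr qs = r powr (qs * tau + 2)"
      using tau(5) by simp
    also have "\<dots> = r powr (qs * tau) * r powr 2" by (rule powr_add)
    also have "r powr 2 = r\<^sup>2" using r by (simp add: powr_numeral)
    finally have rq: "r powr qs = r powr (qs * tau) * r\<^sup>2" .
    have "b (2 * r) = 2 powr qs * r powr (qs * tau) * (r\<^sup>2 * level u (2 * r))"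
      using r by (simp add: b_def powr_mult rq)
    also have "\<dots> \<le> 2 powr qs * r powr (qs * tau) * (C1 * G * level u r powr tau)"
      unfolding G_def by (intro mult_left_mono level_step u r) auto
    also have "\<dots> = D * b r powr tau"
      using r level_nonneg by (simp add: b_def D_def powr_mult powr_powr)
    finally show ?thesis .
  qed
  have Ds: "Cw * G powr (qs / 2) = D powr (qs / 2)"
    using G C1_pos by (simp add: Cw_def D_def powr_mult)
  have "b t \<le> D powr (qs / 2)"
  proof (rule ccontr)
    assume "\<not> ?thesis"
    then have neg: "D powr (qs / 2) < b t" by simp
    \<comment> \<open>For \<open>D = 0\<close> a single step from \<open>t / 2\<close> already gives
      \<open>b t \<le> 0\<close>.\<close>
    have D: "D > 0"
    proof (rule ccontr)
      assume "\<not> D > 0"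
      then have "D = 0" using G C1_pos by (simp add: D_def zero_less_mult_iff)
      then show False using step[of "t / 2"] t neg by simp
    qed
    have big: "D powr (qs / 2) < b (t / 2 ^ k)" for k
    proof (induction k)
      case (Suc k)
      show ?case
      proof (rule ccontr)
        assume "\<not> ?thesis"
        then have le: "b (t / 2 ^ Suc k) \<le> D powr (qs / 2)" by simp
        have "b (t / 2 ^ k) \<le> D * b (t / 2 ^ Suc k) powr tau"
          using step[of "t / 2 ^ Suc k"] t by simp
        also have "\<dots> \<le> D * (D powr (qs / 2)) powr tau"
          using le b_nonneg D tau(1) by (intro mult_left_mono powr_mono2) auto
        also have "\<dots> = D powr (1 + qs / 2 * tau)" using D by (simp add: powr_powr powr_add)
        also have "1 + qs / 2 * tau = qs / 2" using tau(5) by linarith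
        finally show False using Suc by simp
      qed
    qed (use neg in simp)
    define I where "I = (\<integral>x. (u x)\<^sup>2 \<partial>lebesgue)"
    have bI: "b r \<le> r powr (qs - 2) * I" if r: "r > 0" for r
    proof -
      have "b r = r powr (qs - 2) * (r\<^sup>2 * level u r)"
        using r by (simp add: b_def powr_diff powr_numeral)
      also have "\<dots> \<le> r powr (qs - 2) * I"
        unfolding I_def by (intro mult_left_mono level_finite u r) auto
      finally show ?thesis .
    qed
    have "(\<lambda>k. t / 2 ^ k) \<longlonglongrightarrow> 0"
      by (rule LIMSEQ_divide_realpow_zero) simp
    then have "(\<lambda>k. (t / 2 ^ k) powr (qs - 2)) \<longlonglongrightarrow> 0"
      by (rule tendsto_zero_powrI[OF _ tendsto_const]) (use t tau in \<open>auto intro: always_eventually\<close>)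
    then have "(\<lambda>k. (t / 2 ^ k) powr (qs - 2) * I) \<longlonglongrightarrow> 0" by (rule tendsto_mult_left_zero)
    then have "eventually (\<lambda>k. (t / 2 ^ k) powr (qs - 2) * I < D powr (qs / 2)) sequentially"
      using D by (intro order_tendstoD) auto
    then obtain k where "(t / 2 ^ k) powr (qs - 2) * I < D powr (qs / 2)"
      by (auto simp: eventually_sequentially)
    then show False using big[of k] bI[of "t / 2 ^ k"] t by simp
  qed
  then show ?thesis using Ds by (simp add: b_def G_def)
qed

end

section \<open>Subcritical powers from the weak-type bound\<close>

lemma powr_eq_times_square:
  fixes y r :: real
  assumes "y \<ge> 0"
  shows "y powr r = y powr (r - 2) * y\<^sup>2"
proof (cases "y = 0")
  case False
  have "y powr r = y powr (r - 2 + 2)" by simp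
  also have "\<dots> = y powr (r - 2) * y powr 2" by (rule powr_add)
  finally show ?thesis using False assms by simp
qed simp

lemma ennreal_le_suminf: "f k \<le> (\<Sum>k. f k :: ennreal)"
  using sum_le_suminf[OF summableI, of "{k}" f] by simp

context kernel begin

text \<open>The factor \<open>2 powr p\<close> is the loss from replacing \<open>|u|\<close> by the
  upper end of its dyadic layer; the geometric series over the layers has ratio
  \<open>2 powr (p - qs)\<close>, which is less than 1 exactly for \<open>p < qs\<close>.\<close>

definition Cp :: "real \<Rightarrow> real" where "Cp p = 2 powr p * Cw / (1 - 2 powr (p - qs))"

lemma Cp_pos: "p < qs \<Longrightarrow> Cp p > 0"
  using Cw_pos by (simp add: Cp_def powr_less_one)

lemma dyadic_bracket:
  fixes l y :: real
  assumes "0 < l" "l < y"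
  shows "\<exists>k. 2 ^ k * l < y \<and> y \<le> 2 ^ Suc k * l"
proof -
  have ex: "\<exists>k. y \<le> 2 ^ Suc k * l"
  proof -
    obtain k where "y / l < 2 ^ k" using real_arch_pow[of 2 "y / l"] by auto
    then have "y \<le> 2 ^ k * l" using assms by (simp add: field_simps)
    also have "\<dots> \<le> 2 ^ Suc k * l" using assms by simp
    finally show ?thesis by blast
  qed
  define k where "k = (LEAST k. y \<le> 2 ^ Suc k * l)"
  have k: "y \<le> 2 ^ Suc k * l" unfolding k_def using ex by (rule LeastI_ex)
  have "2 ^ k * l < y"
  proof (cases k)
    case 0 then show ?thesis using assms by simp
  next
    case (Suc j)
    then have "\<not> y \<le> 2 ^ Suc j * l" using not_less_Least[of j "\<lambda>k. y \<le> 2 ^ Suc k * l"] by (simp add: k_def)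
    then show ?thesis using Suc by simp
  qed
  then show ?thesis using k by blast
qed

text \<open>Where \<open>|u| \<le> l\<close>, the power is at most \<open>l powr (p - 2)\<close>
  times the square; higher up, \<open>weak_sobolev\<close> is summed over dyadic layers. The height
  \<open>l\<close> stays free: a large \<open>l\<close> makes the energy term small, and for
  \<open>p > 2\<close> a small \<open>l\<close> the quadratic one. Only the quadratic term keeps the
  restriction to \<open>\<Omega>\<close>, and that is where a large potential helps.\<close>

lemma Lp_nn_bound:
  assumes u: "inX K u" and p: "2 \<le> p" "p < qs" and l: "l > 0" and \<Omega>: "\<Omega> \<in> sets lebesgue"
  shows "(\<integral>\<^sup>+ x. ennreal (indicator \<Omega> x * \<bar>u x\<bar> powr p) \<partial>lebesgue) \<le>
    ennreal (l powr (p - 2) * (\<integral>x. indicator \<Omega> x * (u x)\<^sup>2 \<partial>lebesgue) + Cp p * l powr (p - qs) * kform K u u powr (qs / 2))"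
proof -
  define G where "G = kform K u u powr (qs / 2)"
  have G: "G \<ge> 0" by (simp add: G_def)
  note [measurable] = inX_measurable[OF u] \<Omega>
  have pw: "ennreal (indicator \<Omega> x * \<bar>u x\<bar> powr p) \<le> ennreal (l powr (p - 2) * (indicator \<Omega> x * (u x)\<^sup>2))
      + (\<Sum>k. ennreal ((2 ^ Suc k * l) powr p) * indicator {x. 2 ^ k * l < \<bar>u x\<bar>} x)" for x
  proof (cases "\<bar>u x\<bar> \<le> l")
    case True
    have "\<bar>u x\<bar> powr p = \<bar>u x\<bar> powr (p - 2) * (u x)\<^sup>2"
      using powr_eq_times_square[of "\<bar>u x\<bar>" p] by simp
    also have "\<dots> \<le> l powr (p - 2) * (u x)\<^sup>2"
      using True p by (intro mult_right_mono powr_mono2) auto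
    finally have "indicator \<Omega> x * \<bar>u x\<bar> powr p \<le> l powr (p - 2) * (indicator \<Omega> x * (u x)\<^sup>2)"
      by (simp add: indicator_def)
    then have "ennreal (indicator \<Omega> x * \<bar>u x\<bar> powr p) \<le> ennreal (l powr (p - 2) * (indicator \<Omega> x * (u x)\<^sup>2))"
      by (rule ennreal_leI)
    then show ?thesis by (rule order_trans) (rule add_increasing2, auto)
  next
    case False
    then obtain k where k: "2 ^ k * l < \<bar>u x\<bar>" "\<bar>u x\<bar> \<le> 2 ^ Suc k * l"
      using dyadic_bracket[OF l, of "\<bar>u x\<bar>"] by auto
    have "indicator \<Omega> x * \<bar>u x\<bar> powr p \<le> 1 * (2 ^ Suc k * l) powr p"
      using k p by (intro mult_mono powr_mono2) (auto simp: indicator_def)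
    then have "ennreal (indicator \<Omega> x * \<bar>u x\<bar> powr p) \<le>
        ennreal ((2 ^ Suc k * l) powr p) * indicator {x. 2 ^ k * l < \<bar>u x\<bar>} x"
      using k by (simp add: ennreal_leI)
    also have "\<dots> \<le> (\<Sum>k. ennreal ((2 ^ Suc k * l) powr p) * indicator {x. 2 ^ k * l < \<bar>u x\<bar>} x)"
      by (rule ennreal_le_suminf)
    finally show ?thesis by (rule order_trans) (rule add_increasing, auto)
  qed
  have lm[measurable]: "{x. 2 ^ k * l < \<bar>u x\<bar>} \<in> sets lebesgue" for k :: nat
    by (rule level_set_measurable[OF inX_measurable[OF u]])
  define q where "q = 2 powr (p - qs)"
  have q: "0 < q" "q < 1" using p by (auto simp: q_def powr_less_one)
  define c where "c = 2 powr p * l powr (p - qs) * (Cw * G)"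
  have c: "c \<ge> 0" using Cw_pos G by (simp add: c_def)
  have term_le: "(2 ^ Suc k * l) powr p * level u (2 ^ k * l) \<le> c * q ^ k" for k
  proof -
    define r where "r = 2 ^ k * l"
    have r: "r > 0" using l by (simp add: r_def)
    have "r powr qs * level u r \<le> Cw * G" unfolding G_def by (rule weak_sobolev[OF u r])
    then have "level u r \<le> Cw * G * r powr (- qs)"
      using r by (simp add: powr_minus field_simps)
    then have "(2 * r) powr p * level u r \<le> (2 * r) powr p * (Cw * G * r powr (- qs))"
      by (intro mult_left_mono) auto
    also have "\<dots> = 2 powr p * (r powr p * r powr (- qs)) * (Cw * G)"
      using r by (simp add: powr_mult)
    also have "r powr p * r powr (- qs) = r powr (p - qs)" by (simp add: powr_add[symmetric])
    also have "r powr (p - qs) = (2 ^ k) powr (p - qs) * l powr (p - qs)"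
      unfolding r_def by (rule powr_mult)
    also have "(2 ^ k) powr (p - qs) = q ^ k"
      by (simp add: q_def powr_realpow[symmetric] powr_powr mult.commute)
    finally show ?thesis by (simp add: r_def c_def mult_ac)
  qed
  have "(\<lambda>k. c * q ^ k) sums (c * (1 / (1 - q)))"
    using q by (intro sums_mult geometric_sums) auto
  then have sums: "(\<Sum>k. ennreal (c * q ^ k)) = ennreal (c * (1 / (1 - q)))"
    using q c by (intro suminf_ennreal_eq) auto
  have sq: "integrable lebesgue (\<lambda>x. indicator \<Omega> x * (u x)\<^sup>2)"
    by (rule Bochner_Integration.integrable_bound[OF inX_sq_integrable[OF u]]) (auto simp: indicator_def)
  have "(\<integral>\<^sup>+ x. ennreal (indicator \<Omega> x * \<bar>u x\<bar> powr p) \<partial>lebesgue) \<le>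
     (\<integral>\<^sup>+ x. ennreal (l powr (p - 2) * (indicator \<Omega> x * (u x)\<^sup>2))
      + (\<Sum>k. ennreal ((2 ^ Suc k * l) powr p) * indicator {x. 2 ^ k * l < \<bar>u x\<bar>} x) \<partial>lebesgue)"
    by (intro nn_integral_mono pw)
  also have "\<dots> = (\<integral>\<^sup>+ x. ennreal (l powr (p - 2) * (indicator \<Omega> x * (u x)\<^sup>2)) \<partial>lebesgue)
      + (\<integral>\<^sup>+ x. (\<Sum>k. ennreal ((2 ^ Suc k * l) powr p) * indicator {x. 2 ^ k * l < \<bar>u x\<bar>} x) \<partial>lebesgue)"
    by (intro nn_integral_add) measurable
  also have "(\<integral>\<^sup>+ x. ennreal (l powr (p - 2) * (indicator \<Omega> x * (u x)\<^sup>2)) \<partial>lebesgue) =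
      ennreal (\<integral>x. l powr (p - 2) * (indicator \<Omega> x * (u x)\<^sup>2) \<partial>lebesgue)"
    using sq by (intro nn_integral_eq_integral) auto
  also have "(\<integral>x. l powr (p - 2) * (indicator \<Omega> x * (u x)\<^sup>2) \<partial>lebesgue) =
      l powr (p - 2) * (\<integral>x. indicator \<Omega> x * (u x)\<^sup>2 \<partial>lebesgue)" by simp
  also have "(\<integral>\<^sup>+ x. (\<Sum>k. ennreal ((2 ^ Suc k * l) powr p) * indicator {x. 2 ^ k * l < \<bar>u x\<bar>} x) \<partial>lebesgue)
      = (\<Sum>k. \<integral>\<^sup>+ x. ennreal ((2 ^ Suc k * l) powr p) * indicator {x. 2 ^ k * l < \<bar>u x\<bar>} x \<partial>lebesgue)"
    by (intro nn_integral_suminf) measurable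
  also have "\<dots> = (\<Sum>k. ennreal ((2 ^ Suc k * l) powr p * level u (2 ^ k * l)))"
  proof (intro suminf_cong)
    fix k :: nat
    have "(\<integral>\<^sup>+ x. ennreal ((2 ^ Suc k * l) powr p) * indicator {x. 2 ^ k * l < \<bar>u x\<bar>} x \<partial>lebesgue) =
        ennreal ((2 ^ Suc k * l) powr p) * emeasure lebesgue {x. 2 ^ k * l < \<bar>u x\<bar>}"
      by (rule nn_integral_cmult_indicator[OF lm])
    also have "emeasure lebesgue {x. 2 ^ k * l < \<bar>u x\<bar>} = ennreal (level u (2 ^ k * l))"
      using l by (intro level_finite(1)[OF u]) simp
    finally show "(\<integral>\<^sup>+ x. ennreal ((2 ^ Suc k * l) powr p) * indicator {x. 2 ^ k * l < \<bar>u x\<bar>} x \<partial>lebesgue) =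
        ennreal ((2 ^ Suc k * l) powr p * level u (2 ^ k * l))"
      by (simp add: ennreal_mult level_nonneg)
  qed
  also have "\<dots> \<le> (\<Sum>k. ennreal (c * q ^ k))"
    by (intro suminf_le ennreal_leI term_le summableI)
  also note sums
  finally have "(\<integral>\<^sup>+ x. ennreal (indicator \<Omega> x * \<bar>u x\<bar> powr p) \<partial>lebesgue) \<le>
     ennreal (l powr (p - 2) * (\<integral>x. indicator \<Omega> x * (u x)\<^sup>2 \<partial>lebesgue)) + ennreal (c * (1 / (1 - q)))"
    by (simp add: add_left_mono)
  also have "\<dots> = ennreal (l powr (p - 2) * (\<integral>x. indicator \<Omega> x * (u x)\<^sup>2 \<partial>lebesgue) + c * (1 / (1 - q)))"
    using c q by (intro ennreal_plus[symmetric]) auto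
  also have "c * (1 / (1 - q)) = Cp p * l powr (p - qs) * G"
    by (simp add: c_def Cp_def q_def mult_ac)
  finally show ?thesis unfolding G_def .
qed

lemma Lp_integrable:
  assumes u: "inX K u" and p: "2 \<le> p" "p < qs"
  shows "integrable lebesgue (\<lambda>x. \<bar>u x\<bar> powr p)"
proof (rule integrableI_nonneg)
  note [measurable] = inX_measurable[OF u]
  show "(\<lambda>x. \<bar>u x\<bar> powr p) \<in> borel_measurable lebesgue" by measurable
  show "(\<integral>\<^sup>+ x. ennreal (\<bar>u x\<bar> powr p) \<partial>lebesgue) < \<infinity>"
    using Lp_nn_bound[OF u p, of 1 UNIV] by (auto intro: le_less_trans)
qed auto

lemma Lp_bound:
  assumes u: "inX K u" and p: "2 \<le> p" "p < qs" and l: "l > 0" and \<Omega>: "\<Omega> \<in> sets lebesgue"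
  shows "(\<integral>x. indicator \<Omega> x * \<bar>u x\<bar> powr p \<partial>lebesgue) \<le>
    l powr (p - 2) * (\<integral>x. indicator \<Omega> x * (u x)\<^sup>2 \<partial>lebesgue) + Cp p * l powr (p - qs) * kform K u u powr (qs / 2)"
proof -
  note [measurable] = inX_measurable[OF u] \<Omega>
  have "integrable lebesgue (\<lambda>x. indicator \<Omega> x * \<bar>u x\<bar> powr p)"
    by (rule Bochner_Integration.integrable_bound[OF Lp_integrable[OF u p]]) (auto simp: indicator_def)
  then have "ennreal (\<integral>x. indicator \<Omega> x * \<bar>u x\<bar> powr p \<partial>lebesgue) = (\<integral>\<^sup>+ x. ennreal (indicator \<Omega> x * \<bar>u x\<bar> powr p) \<partial>lebesgue)"
    by (intro nn_integral_eq_integral[symmetric]) auto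
  also note Lp_nn_bound[OF u p l \<Omega>]
  finally show ?thesis
    using Cp_pos[OF p(2)] by (subst (asm) ennreal_le_iff) (auto intro!: add_nonneg_nonneg mult_nonneg_nonneg integral_nonneg_AE)
qed

end

section \<open>Local compactness\<close>

lemma abs_le_1_plus_square: "\<bar>y\<bar> \<le> 1 + (y::real)\<^sup>2"
  using zero_le_power2[of "\<bar>y\<bar> - 1"] zero_le_power2[of y] unfolding power2_diff power2_abs by simp

lemma square_add_le: "(x + y)\<^sup>2 \<le> 2 * x\<^sup>2 + 2 * (y::real)\<^sup>2"
proof -
  have "2 * x\<^sup>2 + 2 * y\<^sup>2 - (x + y)\<^sup>2 = (x - y)\<^sup>2" by (simp add: power2_eq_square algebra_simps)
  then show ?thesis using zero_le_power2[of "x - y"] by linarith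
qed

lemma integrable_indicator_times:
  fixes f :: "'a \<Rightarrow> real"
  assumes "integrable M f" "A \<in> sets M"
  shows "integrable M (\<lambda>x. indicator A x * f x)"
  using integrable_mult_indicator[OF assms(2,1)] by simp

context kernel begin

lemma kform_integrand_lin_le:
  "kform_integrand K (\<lambda>x. a * u x + b * v x) (\<lambda>x. a * u x + b * v x) z \<le>
    2 * a\<^sup>2 * kform_integrand K u u z + 2 * b\<^sup>2 * kform_integrand K v v z"
proof -
  define x where "x = a * (u (fst z) - u (snd z))"
  define y where "y = b * (v (fst z) - v (snd z))"
  have "kform_integrand K (\<lambda>x. a * u x + b * v x) (\<lambda>x. a * u x + b * v x) z = (x + y)\<^sup>2 * K (fst z - snd z)"
    by (simp add: kform_integrand_def x_def y_def power2_eq_square algebra_simps)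
  also have "\<dots> \<le> (2 * x\<^sup>2 + 2 * y\<^sup>2) * K (fst z - snd z)"
    by (intro mult_right_mono square_add_le less_imp_le K_pos)
  also have "\<dots> = 2 * a\<^sup>2 * kform_integrand K u u z + 2 * b\<^sup>2 * kform_integrand K v v z"
    by (simp add: kform_integrand_def x_def y_def power2_eq_square algebra_simps)
  finally show ?thesis .
qed

lemma inX_iff:
  "inX K u \<longleftrightarrow> u \<in> borel_measurable lebesgue \<and> integrable lebesgue (\<lambda>x. (u x)\<^sup>2) \<and>
    integrable lebesgue (kform_integrand K u u)"
proof
  assume "inX K u" then show "u \<in> borel_measurable lebesgue \<and> integrable lebesgue (\<lambda>x. (u x)\<^sup>2) \<and>
    integrable lebesgue (kform_integrand K u u)"
    using inX_integrable by (simp add: inX_def)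
next
  assume A: "u \<in> borel_measurable lebesgue \<and> integrable lebesgue (\<lambda>x. (u x)\<^sup>2) \<and>
    integrable lebesgue (kform_integrand K u u)"
  then have "(\<integral>\<^sup>+ z. ennreal (kform_integrand K u u z) \<partial>lebesgue) = ennreal (kform K u u)"
    unfolding kform_def by (intro nn_integral_eq_integral AE_I2 kform_integrand_nonneg) auto
  then show "inX K u" using A by (simp add: inX_def)
qed

lemma inX_lin:
  assumes u: "inX K u" and v: "inX K v"
  shows "inX K (\<lambda>x. a * u x + b * v x)"
    "kform K (\<lambda>x. a * u x + b * v x) (\<lambda>x. a * u x + b * v x) \<le> 2 * a\<^sup>2 * kform K u u + 2 * b\<^sup>2 * kform K v v"
proof -
  note [measurable] = inX_measurable[OF u] inX_measurable[OF v]
  let ?w = "\<lambda>x. a * u x + b * v x"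
  have m: "?w \<in> borel_measurable lebesgue" by measurable
  have sq: "integrable lebesgue (\<lambda>x. (?w x)\<^sup>2)"
  proof (rule Bochner_Integration.integrable_bound[of _ "\<lambda>x. 2 * a\<^sup>2 * (u x)\<^sup>2 + 2 * b\<^sup>2 * (v x)\<^sup>2"])
    show "integrable lebesgue (\<lambda>x. 2 * a\<^sup>2 * (u x)\<^sup>2 + 2 * b\<^sup>2 * (v x)\<^sup>2)"
      using inX_sq_integrable[OF u] inX_sq_integrable[OF v] by simp
    show "AE x in lebesgue. norm ((?w x)\<^sup>2) \<le> norm (2 * a\<^sup>2 * (u x)\<^sup>2 + 2 * b\<^sup>2 * (v x)\<^sup>2)"
      using square_add_le[of "a * u x" "b * v x" for x] by (auto simp: power_mult_distrib mult_ac)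
  qed measurable
  have bd: "integrable lebesgue (\<lambda>z. 2 * a\<^sup>2 * kform_integrand K u u z + 2 * b\<^sup>2 * kform_integrand K v v z)"
    using inX_integrable[OF u] inX_integrable[OF v] by simp
  have kf: "integrable lebesgue (kform_integrand K ?w ?w)"
    by (rule Bochner_Integration.integrable_bound[OF bd kform_integrand_measurable[OF m m]])
      (use kform_integrand_lin_le kform_integrand_nonneg in \<open>auto intro!: AE_I2 order_trans[OF _ abs_ge_self]\<close>)
  show "inX K ?w" using m sq kf inX_iff by blast
  have "kform K ?w ?w \<le> (\<integral>z. 2 * a\<^sup>2 * kform_integrand K u u z + 2 * b\<^sup>2 * kform_integrand K v v z \<partial>lebesgue)"
    unfolding kform_def by (intro integral_mono kf bd kform_integrand_lin_le)
  also have "\<dots> = 2 * a\<^sup>2 * kform K u u + 2 * b\<^sup>2 * kform K v v"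
    unfolding kform_def using inX_integrable[OF u] inX_integrable[OF v] by simp
  finally show "kform K ?w ?w \<le> 2 * a\<^sup>2 * kform K u u + 2 * b\<^sup>2 * kform K v v" .
qed

end

section \<open>Dyadic cells and a fractional Poincare inequality\<close>

text \<open>A half-open cube of side \<open>1 / 2 ^ j\<close>. Only the values of \<open>z\<close>
  on \<open>Basis\<close> matter, so indices are later taken in \<open>extensional Basis\<close>;
  then distinct indices have disjoint cells, and there are countably many.\<close>

definition cell :: "nat \<Rightarrow> ('a::euclidean_space \<Rightarrow> int) \<Rightarrow> 'a set" where
  "cell j z = {x. \<forall>b\<in>Basis. \<lfloor>(x \<bullet> b) * 2 ^ j\<rfloor> = z b}"

lemma cell_sets[measurable]: "cell j z \<in> sets borel"
proof -
  have "cell j z = (\<Inter>b\<in>Basis. {x. \<lfloor>(x \<bullet> b) * 2 ^ j\<rfloor> = z b})" by (auto simp: cell_def)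
  also have "\<dots> \<in> sets borel"
  proof (intro sets.finite_INT)
    fix b :: 'a
    have "{x. \<lfloor>(x \<bullet> b) * 2 ^ j\<rfloor> = z b} = {x. real_of_int (z b) \<le> (x \<bullet> b) * 2 ^ j} \<inter> {x. (x \<bullet> b) * 2 ^ j < real_of_int (z b) + 1}"
      by (auto simp: floor_eq_iff)
    also have "\<dots> \<in> sets borel"
      by (intro sets.Int borel_closed borel_open closed_Collect_le open_Collect_less continuous_intros)
    finally show "{x. \<lfloor>(x \<bullet> b) * 2 ^ j\<rfloor> = z b} \<in> sets borel" .
  qed auto
  finally show ?thesis .
qed

lemma cell_measure:
  fixes z :: "'a::euclidean_space \<Rightarrow> int"
  shows "emeasure lborel (cell j z) = ennreal ((1 / 2 ^ j) ^ DIM('a))"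
proof -
  define l where "l = (\<Sum>b\<in>Basis. (z b / 2 ^ j) *\<^sub>R b :: 'a)"
  define h where "h = (\<Sum>b\<in>Basis. ((z b + 1) / 2 ^ j) *\<^sub>R b :: 'a)"
  have l: "l \<bullet> b = z b / 2 ^ j" and h: "h \<bullet> b = (z b + 1) / 2 ^ j" if "b \<in> Basis" for b
    using that by (simp_all add: l_def h_def)
  have hl: "(h - l) \<bullet> b = 1 / 2 ^ j" "l \<bullet> b \<le> h \<bullet> b" if "b \<in> Basis" for b
    using that by (auto simp: inner_diff_left l h diff_divide_distrib[symmetric] divide_right_mono)
  have p: "(\<Prod>b\<in>Basis. (h - l) \<bullet> b) = (1 / 2 ^ j) ^ DIM('a)"
    using hl by (simp cong: prod.cong)
  have "box l h \<subseteq> cell j z" "cell j z \<subseteq> cbox l h"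
    by (auto simp: cell_def mem_box l h floor_eq_iff field_simps less_imp_le)
  then have "emeasure lborel (box l h) \<le> emeasure lborel (cell j z)" "emeasure lborel (cell j z) \<le> emeasure lborel (cbox l h)"
    by (auto intro!: emeasure_mono)
  then show ?thesis using hl p by (auto simp: emeasure_lborel_box emeasure_lborel_cbox antisym)
qed

lemma cell_diam:
  fixes x y :: "'a::euclidean_space"
  assumes "x \<in> cell j z" "y \<in> cell j z"
  shows "norm (x - y) \<le> real DIM('a) / 2 ^ j"
proof -
  have "norm (x - y) \<le> (\<Sum>b\<in>Basis. \<bar>(x - y) \<bullet> b\<bar>)" by (rule norm_le_l1)
  also have "\<dots> \<le> (\<Sum>b\<in>(Basis::'a set). 1 / 2 ^ j)"
  proof (rule sum_mono)
    fix b :: 'a assume b: "b \<in> Basis"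
    have "\<bar>(x \<bullet> b) * 2 ^ j - (y \<bullet> b) * 2 ^ j\<bar> \<le> 1"
      using assms b by (auto simp: cell_def floor_eq_iff) (smt (verit) floor_eq_iff)
    then have "\<bar>(x - y) \<bullet> b\<bar> * 2 ^ j \<le> 1"
      by (simp add: inner_diff_left left_diff_distrib[symmetric] abs_mult)
    then show "\<bar>(x - y) \<bullet> b\<bar> \<le> 1 / 2 ^ j" by (simp add: field_simps)
  qed
  finally show ?thesis by simp
qed

lemma cell_cover:
  fixes R :: real
  shows "\<exists>Z \<subseteq> extensional (Basis :: 'a::euclidean_space set). finite Z \<and> ball 0 R \<subseteq> (\<Union>z\<in>Z. cell j z)"
proof (intro exI[of _ "PiE (Basis :: 'a set) (\<lambda>_. {-\<lceil>R * 2 ^ j\<rceil> - 1..\<lceil>R * 2 ^ j\<rceil> + 1})"] conjI subsetI)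
  fix x :: 'a assume x: "x \<in> ball 0 R"
  define z where "z = restrict (\<lambda>b. \<lfloor>(x \<bullet> b) * 2 ^ j\<rfloor>) Basis"
  have "z \<in> PiE Basis (\<lambda>_. {-\<lceil>R * 2 ^ j\<rceil> - 1..\<lceil>R * 2 ^ j\<rceil> + 1})"
  proof (rule PiE_I)
    fix b :: 'a assume b: "b \<in> Basis"
    have "\<bar>x \<bullet> b\<bar> \<le> R" using Basis_le_norm[OF b, of x] x by simp
    then have "\<bar>x \<bullet> b\<bar> * 2 ^ j \<le> R * 2 ^ j" by (intro mult_right_mono) auto
    then have "\<bar>(x \<bullet> b) * 2 ^ j\<bar> \<le> R * 2 ^ j" by (simp add: abs_mult)
    then have "-\<lceil>R * 2 ^ j\<rceil> - 1 \<le> \<lfloor>(x \<bullet> b) * 2 ^ j\<rfloor>" "\<lfloor>(x \<bullet> b) * 2 ^ j\<rfloor> \<le> \<lceil>R * 2 ^ j\<rceil> + 1"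
      by linarith+
    then show "z b \<in> {-\<lceil>R * 2 ^ j\<rceil> - 1..\<lceil>R * 2 ^ j\<rceil> + 1}" using b by (simp add: z_def)
  qed (simp add: z_def)
  moreover have "x \<in> cell j z" by (simp add: cell_def z_def)
  ultimately show "x \<in> (\<Union>z\<in>PiE Basis (\<lambda>_. {-\<lceil>R * 2 ^ j\<rceil> - 1..\<lceil>R * 2 ^ j\<rceil> + 1}). cell j z)" by blast
qed (auto simp: PiE_iff intro!: finite_PiE)

text \<open>Expanding the square turns the integral over pairs into twice the measure times the
  \<open>L^2\<close> mass minus the square of the integral. Read backwards, it bounds the mass on a
  cell by the average and by the oscillation between pairs of points, which the form
  controls.\<close>

lemma variance_identity:
  fixes w :: "'a::euclidean_space \<Rightarrow> real"
  assumes w[measurable]: "w \<in> borel_measurable borel" and C[measurable]: "C \<in> sets borel"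
    and m: "emeasure lborel C = ennreal m" "m \<ge> 0" and sq: "integrable lborel (\<lambda>x. indicator C x * (w x)\<^sup>2)"
  shows "(\<integral>\<^sup>+ z. ennreal (indicator C (fst z) * indicator C (snd z) * (w (fst z) - w (snd z))\<^sup>2) \<partial>lborel) =
    ennreal (2 * (m * (\<integral>x. indicator C x * (w x)\<^sup>2 \<partial>lborel) - (\<integral>x. indicator C x * w x \<partial>lborel)\<^sup>2))"
    and "integrable lborel (\<lambda>x. indicator C x * w x)"
proof -
  define S where "S = (\<integral>x. indicator C x * (w x)\<^sup>2 \<partial>lborel)"
  define I where "I = (\<integral>x. indicator C x * w x \<partial>lborel)"
  have fin: "emeasure lborel C < \<infinity>" using m by simp
  have iC: "integrable lborel (\<lambda>x. indicator C x :: real)"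
    using fin by (intro integrable_real_indicator) auto
  have mC: "(\<integral>x. indicator C x \<partial>lborel) = m" using m by (simp add: measure_def)
  show iw: "integrable lborel (\<lambda>x. indicator C x * w x)"
  proof (rule Bochner_Integration.integrable_bound[of _ "\<lambda>x. indicator C x + indicator C x * (w x)\<^sup>2"])
    show "integrable lborel (\<lambda>x. indicator C x + indicator C x * (w x)\<^sup>2)" using iC sq by simp
    show "AE x in lborel. norm (indicator C x * w x) \<le> norm (indicator C x + indicator C x * (w x)\<^sup>2)"
      using abs_le_1_plus_square by (intro AE_I2) (auto simp: indicator_def intro: order_trans[OF _ abs_ge_self])
  qed measurable
  have inner: "(\<integral>\<^sup>+ y. ennreal (indicator C x * indicator C y * (w x - w y)\<^sup>2) \<partial>lborel) =
      ennreal (indicator C x * ((w x)\<^sup>2 * m - 2 * w x * I + S))" for x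
  proof -
    have eq: "indicator C x * indicator C y * (w x - w y)\<^sup>2 =
        indicator C x * ((w x)\<^sup>2 * indicator C y - 2 * w x * (indicator C y * w y) + indicator C y * (w y)\<^sup>2)" for y
      by (simp add: indicator_def power2_diff)
    have int: "integrable lborel (\<lambda>y. indicator C x * ((w x)\<^sup>2 * indicator C y - 2 * w x * (indicator C y * w y) + indicator C y * (w y)\<^sup>2))"
      using iC iw sq by simp
    have "(\<integral>\<^sup>+ y. ennreal (indicator C x * indicator C y * (w x - w y)\<^sup>2) \<partial>lborel) =
       ennreal (\<integral>y. indicator C x * indicator C y * (w x - w y)\<^sup>2 \<partial>lborel)"
      using int unfolding eq[symmetric] by (intro nn_integral_eq_integral) auto
    also have "(\<integral>y. indicator C x * indicator C y * (w x - w y)\<^sup>2 \<partial>lborel) =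
       indicator C x * ((w x)\<^sup>2 * m - 2 * w x * I + S)"
      unfolding eq using iC iw sq mC by (simp add: I_def S_def)
    finally show ?thesis .
  qed
  have nonneg: "0 \<le> indicator C x * ((w x)\<^sup>2 * m - 2 * w x * I + S)" for x
  proof -
    have "indicator C x * ((w x)\<^sup>2 * m - 2 * w x * I + S) = (\<integral>y. indicator C x * ((w x)\<^sup>2 * indicator C y - 2 * w x * (indicator C y * w y) + indicator C y * (w y)\<^sup>2) \<partial>lborel)"
      using iC iw sq mC by (simp add: I_def S_def)
    also have "\<dots> \<ge> 0"
    proof (intro integral_nonneg_AE AE_I2)
      fix y
      have "indicator C x * ((w x)\<^sup>2 * indicator C y - 2 * w x * (indicator C y * w y) + indicator C y * (w y)\<^sup>2)
         = indicator C x * indicator C y * (w x - w y)\<^sup>2" 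
        by (simp add: indicator_def power2_diff)
      then show "0 \<le> indicator C x * ((w x)\<^sup>2 * indicator C y - 2 * w x * (indicator C y * w y) + indicator C y * (w y)\<^sup>2)"
        by (simp only:) (simp add: indicator_def)
    qed
    finally show ?thesis .
  qed
  have "(\<integral>\<^sup>+ z. ennreal (indicator C (fst z) * indicator C (snd z) * (w (fst z) - w (snd z))\<^sup>2) \<partial>lborel)
      = (\<integral>\<^sup>+ x. \<integral>\<^sup>+ y. ennreal (indicator C x * indicator C y * (w x - w y)\<^sup>2) \<partial>lborel \<partial>lborel)"
    unfolding lborel_prod[symmetric] by (subst lborel.nn_integral_fst[symmetric]) auto
  also have "\<dots> = (\<integral>\<^sup>+ x. ennreal (indicator C x * ((w x)\<^sup>2 * m - 2 * w x * I + S)) \<partial>lborel)"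
    by (simp only: inner)
  also have "\<dots> = (\<integral>\<^sup>+ x. ennreal (m * (indicator C x * (w x)\<^sup>2) - 2 * I * (indicator C x * w x) + S * indicator C x) \<partial>lborel)"
    by (intro nn_integral_cong arg_cong[where f = ennreal]) (simp add: indicator_def mult_ac)
  also have "\<dots> = ennreal (\<integral>x. m * (indicator C x * (w x)\<^sup>2) - 2 * I * (indicator C x * w x) + S * indicator C x \<partial>lborel)"
  proof (rule nn_integral_eq_integral)
    show "AE x in lborel. 0 \<le> m * (indicator C x * (w x)\<^sup>2) - 2 * I * (indicator C x * w x) + S * indicator C x"
    proof (rule AE_I2)
      fix x
      have "m * (indicator C x * (w x)\<^sup>2) - 2 * I * (indicator C x * w x) + S * indicator C x =
          indicator C x * ((w x)\<^sup>2 * m - 2 * w x * I + S)" by (simp add: indicator_def)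
      then show "0 \<le> m * (indicator C x * (w x)\<^sup>2) - 2 * I * (indicator C x * w x) + S * indicator C x"
        using nonneg[of x] by (simp only:)
    qed
  qed (use iC iw sq in simp)
  also have "(\<integral>x. m * (indicator C x * (w x)\<^sup>2) - 2 * I * (indicator C x * w x) + S * indicator C x \<partial>lborel) = 2 * (m * S - I\<^sup>2)"
  proof -
    have "(\<integral>x. m * (indicator C x * (w x)\<^sup>2) - 2 * I * (indicator C x * w x) + S * indicator C x \<partial>lborel) =
        m * S - 2 * I * I + S * m"
      using iC iw sq mC by (simp add: I_def[symmetric] S_def[symmetric])
    then show ?thesis by (simp add: power2_eq_square algebra_simps)
  qed
  finally show "(\<integral>\<^sup>+ z. ennreal (indicator C (fst z) * indicator C (snd z) * (w (fst z) - w (snd z))\<^sup>2) \<partial>lborel) =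
    ennreal (2 * (m * (\<integral>x. indicator C x * (w x)\<^sup>2 \<partial>lborel) - (\<integral>x. indicator C x * w x \<partial>lborel)\<^sup>2))"
    unfolding S_def I_def .
qed

context kernel begin

text \<open>Points of one cell have distance at most \<open>\<delta> = dim / 2 ^ j\<close>, so (K2)
  costs \<open>\<delta> powr (dim + 2 * s) / lam\<close>. Dividing by twice the volume of the cell
  leaves this constant times \<open>(1 / 2 ^ j) powr (2 * s)\<close>.\<close>

definition Cc :: real where "Cc = dim powr (dim + 2 * s) / (2 * lam)"

lemma Cc_pos: "Cc > 0" using lam dim_pos by (simp add: Cc_def)

text \<open>The oscillation on a cell is controlled by the pairs inside it, where (K2) bounds the
  kernel from below. The products of a cell with itself are disjoint, so these contributions add up
  to at most the whole form, whatever the number of cells.\<close>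

lemma cells_L2:
  assumes v: "inX K v" and Z: "finite Z" "Z \<subseteq> extensional Basis"
  shows "(\<Sum>z\<in>Z. \<integral>x. indicator (cell j z) x * (v x)\<^sup>2 \<partial>lebesgue) \<le>
    Cc * (1 / 2 ^ j) powr (2 * s) * kform K v v +
      (2 ^ j) ^ DIM('a) * (\<Sum>z\<in>Z. (\<integral>x. indicator (cell j z) x * v x \<partial>lebesgue)\<^sup>2)"
proof -
  define m :: real where "m = (1 / 2 ^ j) ^ DIM('a)"
  have m: "m > 0" by (simp add: m_def)
  define \<delta> :: real where "\<delta> = dim / 2 ^ j"
  have \<delta>: "\<delta> > 0" using dim_pos by (simp add: \<delta>_def)
  obtain w where w[measurable]: "w \<in> borel_measurable borel" and vw: "AE x in lebesgue. v x = w x"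
    using AE_lebesgue_eq_borel[OF inX_measurable[OF v]] .
  note [measurable] = inX_measurable[OF v]
  have w'[measurable]: "w \<in> borel_measurable lebesgue" by (intro measurable_completion) simp
  have cl[measurable]: "cell j z \<in> sets lebesgue" for z :: "'a \<Rightarrow> int" using cell_sets by (simp add: sets_completionI_sets)
  define S where "S z = (\<integral>x. indicator (cell j z) x * (v x)\<^sup>2 \<partial>lebesgue)" for z
  define I where "I z = (\<integral>x. indicator (cell j z) x * v x \<partial>lebesgue)" for z
  have vsq: "integrable lebesgue (\<lambda>x. indicator (cell j z) x * (v x)\<^sup>2)" for z
    by (rule integrable_indicator_times[OF inX_sq_integrable[OF v] cl])
  have ae1: "AE x in lebesgue. indicator (cell j z) x * (v x)\<^sup>2 = indicator (cell j z) x * (w x)\<^sup>2"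
    and ae2: "AE x in lebesgue. indicator (cell j z) x * v x = indicator (cell j z) x * w x" for z :: "'a \<Rightarrow> int"
    using vw by (eventually_elim, simp)+
  have "integrable lebesgue (\<lambda>x. indicator (cell j z) x * (w x)\<^sup>2)" for z
    by (rule integrable_cong_AE_imp[OF vsq _ ae1]) measurable
  then have wsq: "integrable lborel (\<lambda>x. indicator (cell j z) x * (w x)\<^sup>2)" for z
    by (subst (asm) integrable_completion) auto
  have "S z = (\<integral>x. indicator (cell j z) x * (w x)\<^sup>2 \<partial>lebesgue)" for z
    unfolding S_def by (rule integral_cong_AE[OF _ _ ae1]) measurable
  then have Sw: "S z = (\<integral>x. indicator (cell j z) x * (w x)\<^sup>2 \<partial>lborel)" for z
    by (subst (asm) integral_completion) auto
  have "I z = (\<integral>x. indicator (cell j z) x * w x \<partial>lebesgue)" for z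
    unfolding I_def by (rule integral_cong_AE[OF _ _ ae2]) measurable
  then have Iw: "I z = (\<integral>x. indicator (cell j z) x * w x \<partial>lborel)" for z
    by (subst (asm) integral_completion) auto
  define A where "A z = (\<lambda>y::'a \<times> 'a. indicator (cell j z) (fst y) * indicator (cell j z) (snd y) :: real)" for z
  have A01: "A z y \<ge> 0" for z y by (simp add: A_def)
  have Am[measurable]: "A z \<in> borel_measurable lebesgue" for z
  proof -
    have c: "indicator (cell j z) \<in> borel_measurable (lebesgue :: 'a measure)" by measurable
    show ?thesis unfolding A_def
      by (intro borel_measurable_times measurable_compose[OF measurable_fst_lebesgue c] measurable_compose[OF measurable_snd_lebesgue c])
  qed
  have A1: "(\<Sum>z\<in>Z. A z y) \<le> 1" for y
  proof (cases "\<exists>z\<in>Z. A z y \<noteq> 0")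
    case True
    then obtain z where z: "z \<in> Z" "A z y \<noteq> 0" by blast
    have "A z' y = 0" if z': "z' \<in> Z" "z' \<noteq> z" for z'
    proof -
      obtain b where b: "b \<in> Basis" "z' b \<noteq> z b"
        using extensionalityI[of z' Basis z] z' z Z by blast
      have "fst y \<in> cell j z" using z by (auto simp: A_def indicator_def split: if_splits)
      then have "fst y \<notin> cell j z'" using b unfolding cell_def by force
      then show ?thesis by (simp add: A_def)
    qed
    then have "(\<Sum>z\<in>Z. A z y) = A z y" using z Z by (simp add: sum.remove[of Z z])
    also have "\<dots> \<le> 1" by (simp add: A_def indicator_def)
    finally show ?thesis .
  next
    case False
    then have "(\<Sum>z\<in>Z. A z y) = 0" by (intro sum.neutral) blast
    then show ?thesis by simp
  qed
  define c where "c = \<delta> powr (dim + 2 * s) / lam"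
  have c: "c > 0" using \<delta> lam by (simp add: c_def)
  have pw: "AE y in lebesgue. \<forall>z. A z y * (w (fst y) - w (snd y))\<^sup>2 \<le> c * (A z y * kform_integrand K v v y)"
  proof -
    have "AE z::'a\<times>'a in lebesgue. v (fst z) = w (fst z)" "AE z::'a\<times>'a in lebesgue. v (snd z) = w (snd z)"
      "AE z in lebesgue. lam \<le> K (fst z - snd z) * norm (fst z - snd z) powr (dim + 2 * s)"
      using AE_lebesgue_fst[OF vw] AE_lebesgue_snd[OF vw] AE_lebesgue_diff[OF K_lower]
      by (auto simp: dim_def)
    then show ?thesis
    proof eventually_elim
      case (elim y)
      show ?case
      proof
        fix z
        show "A z y * (w (fst y) - w (snd y))\<^sup>2 \<le> c * (A z y * kform_integrand K v v y)"
        proof (cases "fst y \<in> cell j z \<and> snd y \<in> cell j z")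
          case True
          then have "norm (fst y - snd y) \<le> \<delta>" using cell_diam[of "fst y" j z "snd y"] by (simp add: \<delta>_def dim_def)
          then have "norm (fst y - snd y) powr (dim + 2 * s) \<le> \<delta> powr (dim + 2 * s)"
            using s dim_pos by (intro powr_mono2) auto
          then have "K (fst y - snd y) * norm (fst y - snd y) powr (dim + 2 * s) \<le> K (fst y - snd y) * \<delta> powr (dim + 2 * s)"
            by (rule mult_left_mono[OF _ less_imp_le[OF K_pos]])
          then have "lam \<le> K (fst y - snd y) * \<delta> powr (dim + 2 * s)" using elim(3) by linarith
          then have "1 \<le> c * K (fst y - snd y)" using lam by (simp add: c_def field_simps)
          then have "(w (fst y) - w (snd y))\<^sup>2 * 1 \<le> (w (fst y) - w (snd y))\<^sup>2 * (c * K (fst y - snd y))"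
            by (rule mult_left_mono) simp
          then show ?thesis using True elim by (simp add: A_def kform_integrand_def power2_eq_square mult_ac)
        next
          case False
          then have "A z y = 0" by (auto simp: A_def)
          then show ?thesis by simp
        qed
      qed
    qed
  qed
  have Aint: "integrable lebesgue (\<lambda>y. A z y * kform_integrand K v v y)" for z
  proof (rule Bochner_Integration.integrable_bound[OF inX_integrable[OF v]])
    show "(\<lambda>y. A z y * kform_integrand K v v y) \<in> borel_measurable lebesgue"
      using kform_integrand_measurable[OF inX_measurable[OF v] inX_measurable[OF v]] by measurable
  qed (auto simp: A_def indicator_def)
  have cellbd: "2 * (m * S z - (I z)\<^sup>2) \<le> c * (\<integral>y. A z y * kform_integrand K v v y \<partial>lebesgue)" for z
  proof -
    have "ennreal (2 * (m * S z - (I z)\<^sup>2)) = (\<integral>\<^sup>+ y. ennreal (A z y * (w (fst y) - w (snd y))\<^sup>2) \<partial>lborel)"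
      unfolding Sw Iw A_def m_def
      by (rule variance_identity(1)[symmetric, OF w cell_sets cell_measure _ wsq]) simp
    also have "\<dots> = (\<integral>\<^sup>+ y. ennreal (A z y * (w (fst y) - w (snd y))\<^sup>2) \<partial>lebesgue)"
      by (rule nn_integral_completion[symmetric])
    also have "\<dots> \<le> (\<integral>\<^sup>+ y. ennreal (c * (A z y * kform_integrand K v v y)) \<partial>lebesgue)"
      by (rule nn_integral_mono_AE) (use pw in \<open>eventually_elim, auto intro: ennreal_leI\<close>)
    also have "\<dots> = ennreal (\<integral>y. c * (A z y * kform_integrand K v v y) \<partial>lebesgue)"
      using Aint c A01 kform_integrand_nonneg by (intro nn_integral_eq_integral AE_I2) auto
    finally have "2 * (m * S z - (I z)\<^sup>2) \<le> (\<integral>y. c * (A z y * kform_integrand K v v y) \<partial>lebesgue)"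
      using c A01 kform_integrand_nonneg 
      by (subst (asm) ennreal_le_iff) (auto intro!: integral_nonneg_AE AE_I2 mult_nonneg_nonneg)
    then show ?thesis by simp
  qed
  have "(\<Sum>z\<in>Z. 2 * (m * S z - (I z)\<^sup>2)) \<le> (\<Sum>z\<in>Z. c * (\<integral>y. A z y * kform_integrand K v v y \<partial>lebesgue))"
    by (intro sum_mono cellbd)
  also have "\<dots> = c * (\<integral>y. (\<Sum>z\<in>Z. A z y * kform_integrand K v v y) \<partial>lebesgue)"
    using Aint by (simp add: Bochner_Integration.integral_sum sum_distrib_left)
  also have "\<dots> \<le> c * kform K v v"
    unfolding kform_def
  proof (intro mult_left_mono integral_mono Bochner_Integration.integrable_sum Aint inX_integrable v)
    fix y
    have "(\<Sum>z\<in>Z. A z y) * kform_integrand K v v y \<le> 1 * kform_integrand K v v y"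
      by (intro mult_right_mono A1 kform_integrand_nonneg)
    then show "(\<Sum>z\<in>Z. A z y * kform_integrand K v v y) \<le> kform_integrand K v v y"
      by (simp add: sum_distrib_right)
  qed (use c in simp)
  finally have "2 * m * (\<Sum>z\<in>Z. S z) - 2 * (\<Sum>z\<in>Z. (I z)\<^sup>2) \<le> c * kform K v v"
    by (simp add: sum_subtractf right_diff_distrib sum_distrib_left mult.assoc)
  then have "2 * m * (\<Sum>z\<in>Z. S z) \<le> 2 * (\<Sum>z\<in>Z. (I z)\<^sup>2) + c * kform K v v" by simp
  then have "(\<Sum>z\<in>Z. S z) \<le> (2 * (\<Sum>z\<in>Z. (I z)\<^sup>2) + c * kform K v v) / (2 * m)"
    using m by (simp add: pos_le_divide_eq mult_ac)
  also have "\<dots> = c / (2 * m) * kform K v v + (1 / m) * (\<Sum>z\<in>Z. (I z)\<^sup>2)"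
    using m by (simp add: add_divide_distrib)
  also have "1 / m = (2 ^ j) ^ DIM('a)" by (simp add: m_def power_one_over)
  also have "c / (2 * m) = Cc * (1 / 2 ^ j) powr (2 * s)"
  proof -
    have "\<delta> powr (dim + 2 * s) = dim powr (dim + 2 * s) * (1 / 2 ^ j) powr (dim + 2 * s)"
      using powr_mult[of dim "1 / 2 ^ j" "dim + 2 * s"] by (simp add: \<delta>_def)
    also have "(1 / 2 ^ j :: real) powr (dim + 2 * s) = (1 / 2 ^ j) powr dim * (1 / 2 ^ j) powr (2 * s)" by (rule powr_add)
    also have "(1 / 2 ^ j :: real) powr dim = m" unfolding m_def dim_def by (rule powr_realpow) simp
    finally have "\<delta> powr (dim + 2 * s) = dim powr (dim + 2 * s) * (m * (1 / 2 ^ j) powr (2 * s))" .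
    then show ?thesis using m lam unfolding c_def Cc_def by (simp add: field_simps)
  qed
  finally show ?thesis unfolding S_def I_def .
qed

text \<open>\<open>Z\<close> depends on \<open>R\<close> and \<open>j\<close> but not on
  \<open>v\<close>: up to an error that tends to 0 for large \<open>j\<close>, uniformly on sets of
  bounded energy, the local \<open>L^2\<close> norm is governed by finitely many averages. This is
  local compactness in quantitative form.\<close>

lemma L2_ball_bound:
  fixes R :: real
  shows "\<exists>Z. finite Z \<and> Z \<subseteq> extensional Basis \<and> (\<forall>v. inX K v \<longrightarrow>
    (\<integral>x. indicator (ball 0 R) x * (v x)\<^sup>2 \<partial>lebesgue) \<le> Cc * (1 / 2 ^ j) powr (2 * s) * kform K v v +
      (2 ^ j) ^ DIM('a) * (\<Sum>z\<in>Z. (\<integral>x. indicator (cell j z) x * v x \<partial>lebesgue)\<^sup>2))"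
proof -
  obtain Z :: "('a \<Rightarrow> int) set" where Z: "Z \<subseteq> extensional Basis" "finite Z" "ball 0 R \<subseteq> (\<Union>z\<in>Z. cell j z)"
    using cell_cover[of R j, where ?'a = 'a] by (elim exE conjE) (rule that)
  have "(\<integral>x. indicator (ball 0 R) x * (v x)\<^sup>2 \<partial>lebesgue) \<le> Cc * (1 / 2 ^ j) powr (2 * s) * kform K v v +
      (2 ^ j) ^ DIM('a) * (\<Sum>z\<in>Z. (\<integral>x. indicator (cell j z) x * v x \<partial>lebesgue)\<^sup>2)" if v: "inX K v" for v
  proof -
    note [measurable] = inX_measurable[OF v]
    have cl[measurable]: "cell j z \<in> sets lebesgue" for z :: "'a \<Rightarrow> int" using cell_sets by (simp add: sets_completionI_sets)
    have vsq: "integrable lebesgue (\<lambda>x. indicator (cell j z) x * (v x)\<^sup>2)" for z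
      by (rule integrable_indicator_times[OF inX_sq_integrable[OF v] cl])
    have bsq: "integrable lebesgue (\<lambda>x. indicator (ball 0 R) x * (v x)\<^sup>2)"
      by (rule integrable_indicator_times[OF inX_sq_integrable[OF v]]) simp
    have "(\<integral>x. indicator (ball 0 R) x * (v x)\<^sup>2 \<partial>lebesgue) \<le> (\<integral>x. (\<Sum>z\<in>Z. indicator (cell j z) x * (v x)\<^sup>2) \<partial>lebesgue)"
    proof (intro integral_mono bsq Bochner_Integration.integrable_sum vsq)
      fix x
      show "indicator (ball 0 R) x * (v x)\<^sup>2 \<le> (\<Sum>z\<in>Z. indicator (cell j z) x * (v x)\<^sup>2)"
      proof (cases "x \<in> ball 0 R")
        case True
        then obtain z where z: "z \<in> Z" "x \<in> cell j z" using Z by blast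
        then have "indicator (cell j z) x * (v x)\<^sup>2 \<le> (\<Sum>z\<in>Z. indicator (cell j z) x * (v x)\<^sup>2)"
          using Z by (intro member_le_sum) auto
        then show ?thesis using True z by simp
      qed (simp add: sum_nonneg)
    qed
    also have "\<dots> = (\<Sum>z\<in>Z. \<integral>x. indicator (cell j z) x * (v x)\<^sup>2 \<partial>lebesgue)"
      using vsq by (rule Bochner_Integration.integral_sum)
    also note cells_L2[OF v Z(2,1)]
    finally show ?thesis .
  qed
  then show ?thesis using Z by blast
qed

end

section \<open>Extraction of an a.e. convergent subsequence\<close>

lemma convergent_if_increments_small:
  fixes x :: "nat \<Rightarrow> real"
  assumes "eventually (\<lambda>i. \<bar>x (Suc i) - x i\<bar> \<le> (1/2) ^ i) sequentially"
  shows "convergent x"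
proof -
  have "summable (\<lambda>i. x (Suc i) - x i)"
    by (rule summable_comparison_test_ev[of _ "\<lambda>i. (1/2) ^ i"]) (use assms in \<open>auto intro: summable_geometric\<close>)
  then have "convergent (\<lambda>n. \<Sum>i<n. x (Suc i) - x i)" by (simp add: summable_iff_convergent)
  then have "convergent (\<lambda>n. x n - x 0)" by (simp add: sum_lessThan_telescope)
  then have "convergent (\<lambda>n. (x n - x 0) + x 0)" by (rule convergent_add[OF _ convergent_const])
  then show ?thesis by simp
qed

context kernel begin

text \<open>The averages over all cells of all sizes form a countable family of bounded sequences,
  so a diagonal subsequence makes every one of them converge.\<close>

lemma cell_average_subsequence:
  fixes u :: "nat \<Rightarrow> 'a \<Rightarrow> real"
  assumes u: "\<And>k. inX K (u k)" and B: "\<And>k. (\<integral>x. (u k x)\<^sup>2 \<partial>lebesgue) \<le> B"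
  obtains r where "strict_mono r"
    "\<And>j z. z \<in> extensional Basis \<Longrightarrow> convergent (\<lambda>k. \<integral>x. indicator (cell j z) x * u (r k) x \<partial>lebesgue)"
proof -
  define I where "I = (UNIV :: nat set) \<times> (PiE (Basis :: 'a set) (\<lambda>_. UNIV :: int set))"
  have I: "countable I" "I \<noteq> {}" unfolding I_def by (auto intro!: countable_PiE countable_SIGMA simp: PiE_eq_empty_iff)
  define e where "e = from_nat_into I"
  have e: "range e = I" unfolding e_def using I by simp
  have cl[measurable]: "cell j z \<in> sets lebesgue" for j and z :: "'a \<Rightarrow> int" using cell_sets by (simp add: sets_completionI_sets)
  define a where "a n k = (\<integral>x. indicator (cell (fst (e n)) (snd (e n))) x * u k x \<partial>lebesgue)" for n k
  have bd: "\<bar>a n k\<bar> \<le> (1 / 2 ^ fst (e n)) ^ DIM('a) + B" for n k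
  proof -
    let ?C = "cell (fst (e n)) (snd (e n))"
    have em: "emeasure lebesgue ?C = ennreal ((1 / 2 ^ fst (e n)) ^ DIM('a))"
      using cell_measure[of "fst (e n)" "snd (e n)"] by simp
    have iC: "integrable lebesgue (\<lambda>x. indicator ?C x :: real)"
      using em by (intro integrable_real_indicator) auto
    have mC: "measure lebesgue ?C = (1 / 2 ^ fst (e n)) ^ DIM('a)"
      by (rule measure_eq_emeasure_eq_ennreal[OF _ em]) simp
    have "\<bar>a n k\<bar> \<le> (\<integral>x. \<bar>indicator ?C x * u k x\<bar> \<partial>lebesgue)"
      unfolding a_def by (rule integral_abs_bound)
    also have "\<dots> \<le> (\<integral>x. indicator ?C x + (u k x)\<^sup>2 \<partial>lebesgue)"
    proof (rule integral_mono')
      show "integrable lebesgue (\<lambda>x. indicator ?C x + (u k x)\<^sup>2)" using iC inX_sq_integrable[OF u] by simp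
      fix x
      show "\<bar>indicator ?C x * u k x\<bar> \<le> indicator ?C x + (u k x)\<^sup>2"
        using abs_le_1_plus_square[of "u k x"] by (simp add: indicator_def)
    qed simp
    also have "\<dots> = (1 / 2 ^ fst (e n)) ^ DIM('a) + (\<integral>x. (u k x)\<^sup>2 \<partial>lebesgue)"
      using iC inX_sq_integrable[OF u] mC by (subst Bochner_Integration.integral_add) auto
    finally show ?thesis using B[of k] by linarith
  qed
  interpret subseqs "\<lambda>n r. convergent (\<lambda>k. a n (r k))"
  proof
    fix n and r :: "nat \<Rightarrow> nat"
    have "bounded (range (\<lambda>k. a n (r k)))" by (rule boundedI[of _ "(1 / 2 ^ fst (e n)) ^ DIM('a) + B"]) (use bd in auto)
    then obtain l r' where "strict_mono r'" "((\<lambda>k. a n (r k)) \<circ> r') \<longlonglongrightarrow> l"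
      using bounded_imp_convergent_subsequence by blast
    then show "\<exists>r'. strict_mono r' \<and> convergent (\<lambda>k. a n ((r \<circ> r') k))"
      by (auto simp: o_def convergent_def)
  qed
  have conv: "convergent (\<lambda>k. a n (diagseq k))" for n
  proof -
    \<comment> \<open>From position \<open>Suc n\<close> on, the diagonal sequence is a subsequence
      of one along which \<open>a n\<close> converges.\<close>
    have "convergent (\<lambda>k. a n ((diagseq \<circ> (+) (Suc n)) k))"
    proof (rule diagseq_holds)
      fix r s :: "nat \<Rightarrow> nat" and n assume "strict_mono r" "convergent (\<lambda>k. a n (s k))"
      then show "convergent (\<lambda>k. a n ((s \<circ> r) k))"
        using convergent_subseq_convergent[of "\<lambda>k. a n (s k)" r] by (simp add: o_def)
    qed
    then have "convergent (\<lambda>k. a n (diagseq (k + Suc n)))" by (simp add: add.commute)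
    then show ?thesis using convergent_ignore_initial_segment[of "\<lambda>k. a n (diagseq k)" "Suc n"] by blast
  qed
  show thesis
  proof (rule that[OF subseq_diagseq])
    fix j and z :: "'a \<Rightarrow> int" assume "z \<in> extensional Basis"
    then have "(j, z) \<in> range e" unfolding e I_def by (simp add: PiE_def)
    then obtain n where "e n = (j, z)" by (metis imageE)
    then show "convergent (\<lambda>k. \<integral>x. indicator (cell j z) x * u (diagseq k) x \<partial>lebesgue)"
      using conv[of n] by (simp add: a_def)
  qed
qed

text \<open>A large \<open>j\<close> makes the energy error smaller than
  \<open>\<epsilon> / 2\<close>, where \<open>4 * B\<close> bounds the energy of a difference; after
  that only finitely many averages are left, each of them Cauchy.\<close>

lemma L2_ball_Cauchy:
  fixes u :: "nat \<Rightarrow> 'a \<Rightarrow> real"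
  assumes u: "\<And>k. inX K (u k)" and B: "\<And>k. kform K (u k) (u k) \<le> B"
    and conv: "\<And>j z. z \<in> extensional Basis \<Longrightarrow> convergent (\<lambda>k. \<integral>x. indicator (cell j z) x * u k x \<partial>lebesgue)"
    and \<epsilon>: "\<epsilon> > 0"
  shows "\<exists>n. \<forall>k\<ge>n. \<forall>l\<ge>n. (\<integral>x. indicator (ball 0 R) x * (u k x - u l x)\<^sup>2 \<partial>lebesgue) \<le> \<epsilon>"
proof -
  have "(\<lambda>j. (1 / 2 ^ j :: real) powr (2 * s)) \<longlonglongrightarrow> 0"
    by (rule tendsto_zero_powrI[OF LIMSEQ_divide_realpow_zero tendsto_const]) (use s in auto)
  then have "(\<lambda>j. Cc * (1 / 2 ^ j) powr (2 * s) * (4 * B)) \<longlonglongrightarrow> 0"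
    by (intro tendsto_mult_left_zero tendsto_mult_right_zero)
  then have "eventually (\<lambda>j. Cc * (1 / 2 ^ j) powr (2 * s) * (4 * B) < \<epsilon> / 2) sequentially"
    using \<epsilon> by (intro order_tendstoD) auto
  then obtain j where j: "Cc * (1 / 2 ^ j) powr (2 * s) * (4 * B) < \<epsilon> / 2"
    by (auto simp: eventually_sequentially)
  obtain Z :: "('a \<Rightarrow> int) set" where Z: "finite Z" "Z \<subseteq> extensional Basis" and bd: "\<And>v. inX K v \<Longrightarrow>
    (\<integral>x. indicator (ball 0 R) x * (v x)\<^sup>2 \<partial>lebesgue) \<le> Cc * (1 / 2 ^ j) powr (2 * s) * kform K v v +
      (2 ^ j) ^ DIM('a) * (\<Sum>z\<in>Z. (\<integral>x. indicator (cell j z) x * v x \<partial>lebesgue)\<^sup>2)"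
    using L2_ball_bound[of R j] by (elim exE conjE) auto
  define a where "a z k = (\<integral>x. indicator (cell j z) x * u k x \<partial>lebesgue)" for z k
  define c :: real where "c = (2 ^ j) ^ DIM('a)"
  have c: "c > 0" by (simp add: c_def)
  \<comment> \<open>Chosen so that \<open>c\<close> times \<open>card Z\<close> copies of
    \<open>\<eta>\<^sup>2\<close> is at most \<open>\<epsilon> / 2\<close>; the \<open>+ 1\<close>
    covers an empty \<open>Z\<close>.\<close>
  define \<eta> where "\<eta> = sqrt (\<epsilon> / (2 * c * (card Z + 1)))"
  have \<eta>: "\<eta> > 0" using \<epsilon> c by (simp add: \<eta>_def)
  have "\<forall>z\<in>Z. \<exists>n. \<forall>k\<ge>n. \<forall>l\<ge>n. \<bar>a z k - a z l\<bar> < \<eta>"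
  proof
    fix z assume "z \<in> Z"
    then have "Cauchy (a z)" unfolding a_def using conv[of z j] Z by (intro convergent_Cauchy) auto
    then show "\<exists>n. \<forall>k\<ge>n. \<forall>l\<ge>n. \<bar>a z k - a z l\<bar> < \<eta>" using \<eta> by (auto simp: Cauchy_def dist_real_def)
  qed
  then obtain n where n: "\<And>z k l. z \<in> Z \<Longrightarrow> k \<ge> n z \<Longrightarrow> l \<ge> n z \<Longrightarrow> \<bar>a z k - a z l\<bar> < \<eta>" by metis
  define N where "N = (\<Sum>z\<in>Z. n z)"
  have N: "n z \<le> N" if "z \<in> Z" for z unfolding N_def using that Z by (intro member_le_sum) auto
  have cl[measurable]: "cell j z \<in> sets lebesgue" for z :: "'a \<Rightarrow> int" using cell_sets by (simp add: sets_completionI_sets)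
  show ?thesis
  proof (intro exI[of _ N] allI impI)
    fix k l assume kl: "N \<le> k" "N \<le> l"
    let ?v = "\<lambda>x. 1 * u k x + (-1) * u l x"
    have v: "inX K ?v" by (rule inX_lin(1)[OF u u])
    have "kform K ?v ?v \<le> 2 * 1\<^sup>2 * kform K (u k) (u k) + 2 * (-1)\<^sup>2 * kform K (u l) (u l)"
      by (rule inX_lin(2)[OF u u])
    then have kf: "kform K ?v ?v \<le> 4 * B" using B[of k] B[of l] by simp
    have ic: "integrable lebesgue (\<lambda>x. indicator (cell j z) x * u k x)" for z k
    proof (rule Bochner_Integration.integrable_bound[of _ "\<lambda>x. indicator (cell j z) x + (u k x)\<^sup>2"])
      have "emeasure lebesgue (cell j z) < \<infinity>" using cell_measure[of j z] by simp
      then show "integrable lebesgue (\<lambda>x. indicator (cell j z) x + (u k x)\<^sup>2)"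
        using inX_sq_integrable[OF u] by (intro Bochner_Integration.integrable_add integrable_real_indicator) auto
      show "(\<lambda>x. indicator (cell j z) x * u k x) \<in> borel_measurable lebesgue"
        using inX_measurable[OF u] by measurable
      show "AE x in lebesgue. norm (indicator (cell j z) x * u k x) \<le> norm (indicator (cell j z) x + (u k x)\<^sup>2)"
        using abs_le_1_plus_square by (intro AE_I2) (auto simp: indicator_def intro: order_trans[OF _ abs_ge_self])
    qed
    have av: "(\<integral>x. indicator (cell j z) x * ?v x \<partial>lebesgue) = a z k - a z l" for z
    proof -
      have "(\<integral>x. indicator (cell j z) x * ?v x \<partial>lebesgue) = (\<integral>x. indicator (cell j z) x * u k x - indicator (cell j z) x * u l x \<partial>lebesgue)"
        by (simp add: algebra_simps)
      then show ?thesis using ic by (simp add: a_def)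
    qed
    have "(\<Sum>z\<in>Z. (\<integral>x. indicator (cell j z) x * ?v x \<partial>lebesgue)\<^sup>2) \<le> (\<Sum>z\<in>Z. \<eta>\<^sup>2)"
    proof (rule sum_mono)
      fix z assume "z \<in> Z"
      then have "\<bar>a z k - a z l\<bar> \<le> \<eta>" using n[of z k l] N[of z] kl by auto
      then have "\<bar>a z k - a z l\<bar>\<^sup>2 \<le> \<eta>\<^sup>2" by (rule power_mono) simp
      then show "(\<integral>x. indicator (cell j z) x * ?v x \<partial>lebesgue)\<^sup>2 \<le> \<eta>\<^sup>2" unfolding av by simp
    qed
    also have "\<dots> = card Z * \<eta>\<^sup>2" by simp
    also have "\<dots> \<le> (card Z + 1) * \<eta>\<^sup>2" by (intro mult_right_mono) auto
    also have "\<dots> = \<epsilon> / (2 * c)" using \<epsilon> c by (simp add: \<eta>_def)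
    finally have s2: "c * (\<Sum>z\<in>Z. (\<integral>x. indicator (cell j z) x * ?v x \<partial>lebesgue)\<^sup>2) \<le> \<epsilon> / 2"
      using c by (simp add: field_simps)
    have s1: "Cc * (1 / 2 ^ j) powr (2 * s) * kform K ?v ?v \<le> Cc * (1 / 2 ^ j) powr (2 * s) * (4 * B)"
      using kf Cc_pos by (intro mult_left_mono) auto
    show "(\<integral>x. indicator (ball 0 R) x * (u k x - u l x)\<^sup>2 \<partial>lebesgue) \<le> \<epsilon>"
      using bd[OF v] s1 s2 j unfolding c_def by simp
  qed
qed

text \<open>The argument is that of the completeness of \<open>L^2\<close>, but with balls that grow
  along the sequence. Every point lies in all balls from some index on, so one extraction serves the
  whole space.\<close>

lemma ae_convergent_subsequence:
  fixes u :: "nat \<Rightarrow> 'a \<Rightarrow> real"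
  assumes u: "\<And>k. inX K (u k)" and B1: "\<And>k. (\<integral>x. (u k x)\<^sup>2 \<partial>lebesgue) \<le> B1" and B2: "\<And>k. kform K (u k) (u k) \<le> B2"
  obtains r v where "strict_mono r" "v \<in> borel_measurable lebesgue" "AE x in lebesgue. (\<lambda>k. u (r k) x) \<longlonglongrightarrow> v x"
proof -
  obtain r where r: "strict_mono r"
    and conv: "\<And>j z. z \<in> extensional Basis \<Longrightarrow> convergent (\<lambda>k. \<integral>x. indicator (cell j z) x * u (r k) x \<partial>lebesgue)"
    by (rule cell_average_subsequence[of u B1, OF u B1]) blast
  have "\<forall>i::nat. \<exists>n. \<forall>k\<ge>n. \<forall>l\<ge>n. (\<integral>x. indicator (ball 0 (real i)) x * (u (r k) x - u (r l) x)\<^sup>2 \<partial>lebesgue) \<le> (1/8) ^ i"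
    by (intro allI L2_ball_Cauchy[OF u B2 conv]) auto
  then obtain n where n: "\<And>i k l. k \<ge> n i \<Longrightarrow> l \<ge> n i \<Longrightarrow>
      (\<integral>x. indicator (ball 0 (real i)) x * (u (r k) x - u (r l) x)\<^sup>2 \<partial>lebesgue) \<le> (1/8) ^ i"
    by metis
  \<comment> \<open>Strictly increasing, with \<open>q i\<close> and \<open>q (Suc i)\<close> both
    beyond \<open>n i\<close>, so that consecutive members are as close as index \<open>i\<close>
    demands.\<close>
  define q where "q i = (\<Sum>j\<le>i. n j) + i" for i
  have q: "strict_mono q" by (auto simp: strict_mono_Suc_iff q_def)
  have qn: "n i \<le> q i" "n i \<le> q (Suc i)" for i
  proof -
    have "n i \<le> (\<Sum>j\<le>i. n j)" by (rule member_le_sum) auto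
    then show "n i \<le> q i" by (simp add: q_def)
    then show "n i \<le> q (Suc i)" using strict_monoD[OF q, of i "Suc i"] by simp
  qed
  define w where "w i = u (r (q i))" for i
  have w: "inX K (w i)" for i by (simp add: w_def u)
  have wm[measurable]: "w i \<in> borel_measurable lebesgue" for i by (rule inX_measurable[OF w])
  \<comment> \<open>By Markov's inequality this set has measure at most
    \<open>4 ^ i / 8 ^ i = 1 / 2 ^ i\<close>, which is summable; off it the increment on the ball is
    below \<open>1 / 2 ^ i\<close>.\<close>
  define A where "A i = {x \<in> space lebesgue. (1/4) ^ i \<le> indicator (ball 0 (real i)) x * (w (Suc i) x - w i x)\<^sup>2}" for i
  have bl[measurable]: "ball 0 (real i) \<in> sets (lebesgue :: 'a measure)" for i by simp
  have dint: "integrable lebesgue (\<lambda>x. indicator (ball 0 (real i)) x * (w (Suc i) x - w i x)\<^sup>2)" for i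
  proof (rule integrable_indicator_times[OF _ bl])
    show "integrable lebesgue (\<lambda>x. (w (Suc i) x - w i x)\<^sup>2)"
      using inX_sq_integrable[OF inX_lin(1)[OF w w, of 1 "Suc i" "-1" i]] by simp
  qed
  have Am: "A i \<in> sets lebesgue" for i unfolding A_def by measurable
  have emA: "emeasure lebesgue (A i) \<le> ennreal ((1/2) ^ i)" for i
  proof -
    have "emeasure lebesgue (A i) \<le> ennreal (1 / (1/4) ^ i * (\<integral>x. indicator (ball 0 (real i)) x * (w (Suc i) x - w i x)\<^sup>2 \<partial>lebesgue))"
      unfolding A_def by (rule integral_Markov_inequality[OF dint]) auto
    also have "\<dots> \<le> ennreal (1 / (1/4) ^ i * (1/8) ^ i)"
      unfolding w_def using qn by (intro ennreal_leI mult_left_mono n) auto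
    also have "1 / (1/4) ^ i * (1/8) ^ i = ((1/2) ^ i :: real)"
      by (simp add: power_divide power_mult_distrib[symmetric] field_simps)
    finally show ?thesis .
  qed
  have "AE x in lebesgue. eventually (\<lambda>i. x \<in> space lebesgue - A i) sequentially"
  proof (rule borel_cantelli_AE1[OF Am])
    show "emeasure lebesgue (A i) < \<infinity>" for i using emA[of i] by (rule le_less_trans) simp
    show "summable (\<lambda>i. measure lebesgue (A i))"
    proof (rule summable_comparison_test'[of "\<lambda>i. (1/2) ^ i" 0])
      fix i
      have "measure lebesgue (A i) \<le> (1/2) ^ i"
        using emA[of i] unfolding measure_def by (intro enn2real_leI) auto
      then show "norm (measure lebesgue (A i)) \<le> (1/2) ^ i" by simp
    qed (simp add: summable_geometric)
  qed
  then have cv: "AE x in lebesgue. convergent (\<lambda>i. w i x)"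
  proof eventually_elim
    case (elim x)
    have "eventually (\<lambda>i. norm x < real i) sequentially"
      using eventually_gt_at_top[of "nat \<lceil>norm x\<rceil>"] by eventually_elim linarith
    with elim show ?case
    proof (intro convergent_if_increments_small, eventually_elim)
      case (elim i)
      then have "(w (Suc i) x - w i x)\<^sup>2 < (1/4) ^ i" by (simp add: A_def)
      also have "(1/4) ^ i = ((1/2 :: real) ^ i)\<^sup>2" unfolding power2_eq_square power_mult_distrib[symmetric] by simp
      finally have "\<bar>w (Suc i) x - w i x\<bar>\<^sup>2 < ((1/2) ^ i)\<^sup>2" by simp
      then have "\<bar>w (Suc i) x - w i x\<bar> < (1/2) ^ i" by (rule power2_less_imp_less) simp
      then show ?case by simp
    qed
  qed
  show thesis
  proof (rule that[of "r \<circ> q" "\<lambda>x. lim (\<lambda>i. w i x)"])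
    show "strict_mono (r \<circ> q)" using r q by (rule strict_mono_o)
    show "(\<lambda>x. lim (\<lambda>i. w i x)) \<in> borel_measurable lebesgue" by measurable
    show "AE x in lebesgue. (\<lambda>k. u ((r \<circ> q) k) x) \<longlonglongrightarrow> lim (\<lambda>i. w i x)"
      using cv by eventually_elim (simp add: convergent_LIMSEQ_iff w_def)
  qed
qed

end

section \<open>The energy space\<close>

text \<open>The mountain pass principle asks for a real vector space. Genuine functions are used,
  not classes modulo null sets, so the energy norm is only a seminorm.\<close>

instantiation "fun" :: (type, real_vector) real_vector
begin
definition scaleR_fun :: "real \<Rightarrow> ('a \<Rightarrow> 'b) \<Rightarrow> 'a \<Rightarrow> 'b" where "scaleR_fun r g = (\<lambda>x. r *\<^sub>R g x)"
instance by standard (auto simp: scaleR_fun_def fun_eq_iff algebra_simps)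
end

lemma nonneg_quadratic_discriminant:
  fixes a b c :: real
  assumes "c \<ge> 0" and "\<And>t. 0 \<le> a + 2 * b * t + c * t\<^sup>2"
  shows "b\<^sup>2 \<le> a * c"
proof (cases "c = 0")
  case True
  have "b = 0"
  proof (rule ccontr)
    assume "b \<noteq> 0"
    \<comment> \<open>At this \<open>t\<close> the expression takes the value -1.\<close>
    then show False using assms(2)[of "- (a + 1) / (2 * b)"] True by simp
  qed
  then show ?thesis using True by simp
next
  case False
  have "0 \<le> a + 2 * b * (- b / c) + c * (- b / c)\<^sup>2" by (rule assms(2))
  also have "\<dots> = a - b\<^sup>2 / c" using False by (simp add: power2_eq_square)
  finally have "b\<^sup>2 / c \<le> a" by simp
  then show ?thesis using False assms(1) by (simp add: pos_divide_le_eq)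
qed

lemma abs_mult_le_squares: "\<bar>x * y\<bar> \<le> x\<^sup>2 + (y::real)\<^sup>2"
proof -
  have "2 * \<bar>x * y\<bar> \<le> x\<^sup>2 + y\<^sup>2"
    using zero_le_power2[of "\<bar>x\<bar> - \<bar>y\<bar>"] by (simp add: power2_diff abs_mult)
  then show ?thesis using abs_ge_zero[of "x * y"] by linarith
qed

lemma integrable_mult_L2:
  fixes u v :: "'b \<Rightarrow> real"
  assumes [measurable]: "u \<in> borel_measurable M" "v \<in> borel_measurable M"
    and "integrable M (\<lambda>x. (u x)\<^sup>2)" "integrable M (\<lambda>x. (v x)\<^sup>2)"
  shows "integrable M (\<lambda>x. u x * v x)"
  by (rule Bochner_Integration.integrable_bound[of _ "\<lambda>x. (u x)\<^sup>2 + (v x)\<^sup>2"])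
    (use assms abs_mult_le_squares in \<open>auto intro!: AE_I2\<close>)

lemma Cauchy_Schwarz_L2:
  fixes u v :: "'b \<Rightarrow> real"
  assumes [measurable]: "u \<in> borel_measurable M" "v \<in> borel_measurable M"
    and u: "integrable M (\<lambda>x. (u x)\<^sup>2)" and v: "integrable M (\<lambda>x. (v x)\<^sup>2)"
  shows "(\<integral>x. \<bar>u x\<bar> * \<bar>v x\<bar> \<partial>M)\<^sup>2 \<le> (\<integral>x. (u x)\<^sup>2 \<partial>M) * (\<integral>x. (v x)\<^sup>2 \<partial>M)"
proof (rule nonneg_quadratic_discriminant)
  show "0 \<le> (\<integral>x. (v x)\<^sup>2 \<partial>M)" by simp
  fix t :: real
  have uv: "integrable M (\<lambda>x. \<bar>u x\<bar> * \<bar>v x\<bar>)"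
    by (rule integrable_mult_L2) (use u v in auto)
  have "0 \<le> (\<integral>x. (\<bar>u x\<bar> + t * \<bar>v x\<bar>)\<^sup>2 \<partial>M)" by simp
  also have "\<dots> = (\<integral>x. (u x)\<^sup>2 + 2 * t * (\<bar>u x\<bar> * \<bar>v x\<bar>) + t\<^sup>2 * (v x)\<^sup>2 \<partial>M)"
    by (intro Bochner_Integration.integral_cong) (auto simp: power2_sum power_mult_distrib)
  also have "\<dots> = (\<integral>x. (u x)\<^sup>2 \<partial>M) + 2 * (\<integral>x. \<bar>u x\<bar> * \<bar>v x\<bar> \<partial>M) * t + (\<integral>x. (v x)\<^sup>2 \<partial>M) * t\<^sup>2"
    using u v uv by simp
  finally show "0 \<le> (\<integral>x. (u x)\<^sup>2 \<partial>M) + 2 * (\<integral>x. \<bar>u x\<bar> * \<bar>v x\<bar> \<partial>M) * t + (\<integral>x. (v x)\<^sup>2 \<partial>M) * t\<^sup>2" .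
qed

section \<open>The inner product and the norm of the energy space\<close>

locale kernel_potential = kernel K s lam for K :: "'a::euclidean_space \<Rightarrow> real" and s lam +
  fixes V :: "'a \<Rightarrow> real" and c :: real
  assumes V_cont: "continuous_on UNIV V" and c_pos: "c > 0" and V_ge: "\<And>x. c \<le> V x"
begin

lemma V_measurable[measurable]: "V \<in> borel_measurable lebesgue"
  using borel_measurable_continuous_onI[OF V_cont] by (intro measurable_completion) simp

lemma V_pos: "V x > 0" using c_pos V_ge[of x] by linarith

lemma inE_inX: "inE K V u \<Longrightarrow> inX K u" by (simp add: inE_def)

lemmas inE_measurable = inX_measurable[OF inE_inX] and inE_sq_integrable = inX_sq_integrable[OF inE_inX]

lemma inE_iff: "inE K V u \<longleftrightarrow> inX K u \<and> integrable lebesgue (\<lambda>x. V x * (u x)\<^sup>2)"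
proof
  assume u: "inE K V u"
  note [measurable] = inE_measurable[OF u]
  show "inX K u \<and> integrable lebesgue (\<lambda>x. V x * (u x)\<^sup>2)"
    using u less_imp_le[OF V_pos] unfolding inE_def by (auto intro!: integrableI_nonneg)
next
  assume u: "inX K u \<and> integrable lebesgue (\<lambda>x. V x * (u x)\<^sup>2)"
  then have "(\<integral>\<^sup>+ x. ennreal (V x * (u x)\<^sup>2) \<partial>lebesgue) = ennreal (\<integral>x. V x * (u x)\<^sup>2 \<partial>lebesgue)"
    using less_imp_le[OF V_pos] by (intro nn_integral_eq_integral AE_I2) auto
  then show "inE K V u" using u by (simp add: inE_def)
qed

lemma inE_V_integrable: "inE K V u \<Longrightarrow> integrable lebesgue (\<lambda>x. V x * (u x)\<^sup>2)"
  by (simp add: inE_iff)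

lemma inE_lin:
  assumes u: "inE K V u" and v: "inE K V v"
  shows "inE K V (\<lambda>x. a * u x + b * v x)"
proof -
  note [measurable] = inE_measurable[OF u] inE_measurable[OF v]
  have "integrable lebesgue (\<lambda>x. V x * (a * u x + b * v x)\<^sup>2)"
  proof (rule Bochner_Integration.integrable_bound[of _ "\<lambda>x. 2 * a\<^sup>2 * (V x * (u x)\<^sup>2) + 2 * b\<^sup>2 * (V x * (v x)\<^sup>2)"])
    show "integrable lebesgue (\<lambda>x. 2 * a\<^sup>2 * (V x * (u x)\<^sup>2) + 2 * b\<^sup>2 * (V x * (v x)\<^sup>2))"
      using inE_V_integrable[OF u] inE_V_integrable[OF v] by simp
    show "AE x in lebesgue. norm (V x * (a * u x + b * v x)\<^sup>2) \<le> norm (2 * a\<^sup>2 * (V x * (u x)\<^sup>2) + 2 * b\<^sup>2 * (V x * (v x)\<^sup>2))"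
    proof (rule AE_I2)
      fix x
      have "V x * (a * u x + b * v x)\<^sup>2 \<le> V x * (2 * (a * u x)\<^sup>2 + 2 * (b * v x)\<^sup>2)"
        by (intro mult_left_mono square_add_le less_imp_le V_pos)
      also have "\<dots> = 2 * a\<^sup>2 * (V x * (u x)\<^sup>2) + 2 * b\<^sup>2 * (V x * (v x)\<^sup>2)"
        by (simp add: power_mult_distrib algebra_simps)
      finally show "norm (V x * (a * u x + b * v x)\<^sup>2) \<le> norm (2 * a\<^sup>2 * (V x * (u x)\<^sup>2) + 2 * b\<^sup>2 * (V x * (v x)\<^sup>2))"
        using less_imp_le[OF V_pos] by simp
    qed
  qed measurable
  then show ?thesis using inX_lin(1)[OF inE_inX[OF u] inE_inX[OF v]] by (simp add: inE_iff)
qed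

definition E :: "('a \<Rightarrow> real) set" where "E = Collect (inE K V)"

lemma inE_zero: "inE K V (\<lambda>x. 0)"
  by (simp add: inE_def inX_def kform_integrand_def)

lemma E_subspace: "subspace E"
proof (rule subspaceI)
  show "0 \<in> E" using inE_zero by (simp add: E_def zero_fun_def)
  fix u v assume "u \<in> E" "v \<in> E"
  then show "u + v \<in> E" using inE_lin[of u v 1 1] by (simp add: E_def plus_fun_def)
next
  fix r u assume "u \<in> E"
  then show "r *\<^sub>R u \<in> E" using inE_lin[of u u r 0] by (simp add: E_def scaleR_fun_def)
qed

lemma E_D: "u \<in> E \<Longrightarrow> inE K V u" by (simp add: E_def)

lemma kform_integrable:
  assumes u: "inX K u" and v: "inX K v"
  shows "integrable lebesgue (kform_integrand K u v)"
proof (rule Bochner_Integration.integrable_bound[of _ "\<lambda>z. kform_integrand K u u z + kform_integrand K v v z"])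
  show "integrable lebesgue (\<lambda>z. kform_integrand K u u z + kform_integrand K v v z)"
    using inX_integrable[OF u] inX_integrable[OF v] by simp
  show "AE z in lebesgue. norm (kform_integrand K u v z) \<le> norm (kform_integrand K u u z + kform_integrand K v v z)"
  proof (rule AE_I2)
    fix z
    have "\<bar>kform_integrand K u v z\<bar> = \<bar>(u (fst z) - u (snd z)) * (v (fst z) - v (snd z))\<bar> * K (fst z - snd z)"
      using K_pos[of "fst z - snd z"] by (simp add: kform_integrand_def abs_mult)
    also have "\<dots> \<le> ((u (fst z) - u (snd z))\<^sup>2 + (v (fst z) - v (snd z))\<^sup>2) * K (fst z - snd z)"
      by (intro mult_right_mono abs_mult_le_squares less_imp_le K_pos)
    also have "\<dots> = kform_integrand K u u z + kform_integrand K v v z"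
      by (simp add: kform_integrand_def power2_eq_square algebra_simps)
    finally show "norm (kform_integrand K u v z) \<le> norm (kform_integrand K u u z + kform_integrand K v v z)" by simp
  qed
qed (rule kform_integrand_measurable[OF inX_measurable[OF u] inX_measurable[OF v]])

lemma Vuv_integrable:
  assumes u: "inE K V u" and v: "inE K V v"
  shows "integrable lebesgue (\<lambda>x. V x * u x * v x)"
proof (rule Bochner_Integration.integrable_bound[of _ "\<lambda>x. V x * (u x)\<^sup>2 + V x * (v x)\<^sup>2"])
  note [measurable] = inE_measurable[OF u] inE_measurable[OF v]
  show "(\<lambda>x. V x * u x * v x) \<in> borel_measurable lebesgue" by measurable
  show "integrable lebesgue (\<lambda>x. V x * (u x)\<^sup>2 + V x * (v x)\<^sup>2)"
    using inE_V_integrable[OF u] inE_V_integrable[OF v] by simp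
  show "AE x in lebesgue. norm (V x * u x * v x) \<le> norm (V x * (u x)\<^sup>2 + V x * (v x)\<^sup>2)"
  proof (rule AE_I2)
    fix x
    have "V x * \<bar>u x * v x\<bar> \<le> V x * ((u x)\<^sup>2 + (v x)\<^sup>2)"
      by (intro mult_left_mono abs_mult_le_squares less_imp_le V_pos)
    then show "norm (V x * u x * v x) \<le> norm (V x * (u x)\<^sup>2 + V x * (v x)\<^sup>2)"
      using V_pos[of x] by (simp add: abs_mult algebra_simps)
  qed
qed

definition form :: "('a \<Rightarrow> real) \<Rightarrow> ('a \<Rightarrow> real) \<Rightarrow> real" where
  "form u v = kform K u v + (\<integral>x. V x * u x * v x \<partial>lebesgue)"

lemma form_sym: "form u v = form v u"
  unfolding form_def kform_def kform_integrand_def by (simp add: mult_ac)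

lemma form_lin:
  assumes u: "inE K V u" and v: "inE K V v" and w: "inE K V w"
  shows "form u (\<lambda>x. a * v x + b * w x) = a * form u v + b * form u w"
proof -
  note i = kform_integrable[OF inE_inX[OF u] inE_inX[OF v]] kform_integrable[OF inE_inX[OF u] inE_inX[OF w]]
    Vuv_integrable[OF u v] Vuv_integrable[OF u w]
  have "kform_integrand K u (\<lambda>x. a * v x + b * w x) = (\<lambda>z. a * kform_integrand K u v z + b * kform_integrand K u w z)"
    by (simp add: kform_integrand_def fun_eq_iff algebra_simps)
  then have 1: "kform K u (\<lambda>x. a * v x + b * w x) = a * kform K u v + b * kform K u w"
    unfolding kform_def using i by simp
  have "V x * u x * (a * v x + b * w x) = a * (V x * u x * v x) + b * (V x * u x * w x)" for x
    by (simp add: algebra_simps)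
  then have 2: "(\<integral>x. V x * u x * (a * v x + b * w x) \<partial>lebesgue) = a * (\<integral>x. V x * u x * v x \<partial>lebesgue) + b * (\<integral>x. V x * u x * w x \<partial>lebesgue)"
    using i by simp
  show ?thesis unfolding form_def 1 2 by (simp add: algebra_simps)
qed

lemma V_sq_nonneg: "0 \<le> (\<integral>x. V x * u x * u x \<partial>lebesgue)"
  using less_imp_le[OF V_pos] by (intro integral_nonneg_AE AE_I2) (simp add: mult.assoc)

lemma form_nonneg: "0 \<le> form u u"
  unfolding form_def using kform_nonneg[of u] V_sq_nonneg[of u] by simp

definition N :: "('a \<Rightarrow> real) \<Rightarrow> real" where "N u = sqrt (form u u)"

lemma N_nonneg: "0 \<le> N u" by (simp add: N_def form_nonneg)

lemma N_sq: "(N u)\<^sup>2 = form u u" by (simp add: N_def form_nonneg)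

lemma form_quadratic:
  assumes u: "inE K V u" and v: "inE K V v"
  shows "form (\<lambda>x. a * u x + b * v x) (\<lambda>x. a * u x + b * v x) = a\<^sup>2 * form u u + 2 * a * b * form u v + b\<^sup>2 * form v v"
proof -
  have w: "inE K V (\<lambda>x. a * u x + b * v x)" by (rule inE_lin[OF u v])
  have "form (\<lambda>x. a * u x + b * v x) u = a * form u u + b * form u v"
    using form_lin[OF u u v] form_sym[of "\<lambda>x. a * u x + b * v x" u] by simp
  moreover have "form (\<lambda>x. a * u x + b * v x) v = a * form u v + b * form v v"
    using form_lin[OF v u v] form_sym[of "\<lambda>x. a * u x + b * v x" v] form_sym[of v u] by simp
  ultimately show ?thesis
    unfolding form_lin[OF w u v] by (simp add: power2_eq_square algebra_simps)
qed

lemma form_Cauchy_Schwarz: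
  assumes u: "inE K V u" and v: "inE K V v"
  shows "\<bar>form u v\<bar> \<le> N u * N v"
proof -
  have "(form u v)\<^sup>2 \<le> form u u * form v v"
  proof (rule nonneg_quadratic_discriminant[OF form_nonneg])
    fix t
    show "0 \<le> form u u + 2 * form u v * t + form v v * t\<^sup>2"
      using form_nonneg[of "\<lambda>x. 1 * u x + t * v x"] unfolding form_quadratic[OF u v] by (simp add: mult_ac)
  qed
  also have "\<dots> = (N u * N v)\<^sup>2" by (simp add: power_mult_distrib N_sq)
  finally have "\<bar>form u v\<bar>\<^sup>2 \<le> (N u * N v)\<^sup>2" by simp
  then show ?thesis by (rule power2_le_imp_le) (simp add: N_nonneg)
qed

lemma N_add: assumes u: "inE K V u" and v: "inE K V v" shows "N (u + v) \<le> N u + N v"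
proof -
  have "(N (u + v))\<^sup>2 = form u u + 2 * form u v + form v v"
    using form_quadratic[OF u v, of 1 1] by (simp add: N_sq plus_fun_def)
  also have "\<dots> \<le> (N u)\<^sup>2 + 2 * (N u * N v) + (N v)\<^sup>2"
    using form_Cauchy_Schwarz[OF u v] by (simp add: N_sq)
  also have "\<dots> = (N u + N v)\<^sup>2" by (simp add: power2_sum)
  finally show ?thesis by (rule power2_le_imp_le) (simp add: N_nonneg)
qed

lemma N_scale: assumes u: "inE K V u" shows "N (r *\<^sub>R u) = \<bar>r\<bar> * N u"
proof -
  have "form (r *\<^sub>R u) (r *\<^sub>R u) = r\<^sup>2 * form u u"
    using form_quadratic[OF u u, of r 0] by (simp add: scaleR_fun_def)
  then show ?thesis by (simp add: N_def real_sqrt_mult)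
qed

lemma kform_le_N: "kform K u u \<le> (N u)\<^sup>2"
  unfolding N_sq form_def using V_sq_nonneg[of u] by simp

text \<open>Used with \<open>L = c\<close> on the whole space and with the large lower bound of
  \<open>V\<close> outside a ball; the gain from a large potential enters through this
  inequality.\<close>

lemma L2_region_le_N:
  assumes u: "inE K V u" and \<Omega>: "\<Omega> \<in> sets lebesgue" and L: "L > 0" "\<And>x. x \<in> \<Omega> \<Longrightarrow> L \<le> V x"
  shows "(\<integral>x. indicator \<Omega> x * (u x)\<^sup>2 \<partial>lebesgue) \<le> (N u)\<^sup>2 / L"
proof -
  have "L * (\<integral>x. indicator \<Omega> x * (u x)\<^sup>2 \<partial>lebesgue) = (\<integral>x. L * (indicator \<Omega> x * (u x)\<^sup>2) \<partial>lebesgue)" by simp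
  also have "\<dots> \<le> (\<integral>x. V x * (u x)\<^sup>2 \<partial>lebesgue)"
  proof (rule integral_mono[OF _ inE_V_integrable[OF u]])
    show "integrable lebesgue (\<lambda>x. L * (indicator \<Omega> x * (u x)\<^sup>2))"
      by (intro integrable_mult_right integrable_indicator_times inE_sq_integrable u \<Omega>)
    fix x show "L * (indicator \<Omega> x * (u x)\<^sup>2) \<le> V x * (u x)\<^sup>2"
      using L(2)[of x] V_pos[of x] by (auto simp: indicator_def intro!: mult_right_mono)
  qed
  also have "\<dots> = (\<integral>x. V x * u x * u x \<partial>lebesgue)" by (simp add: power2_eq_square mult.assoc)
  also have "\<dots> \<le> (N u)\<^sup>2" unfolding N_sq form_def using kform_nonneg[of u] by simp
  finally show ?thesis using L by (simp add: field_simps)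
qed

lemma L2_le_N: assumes u: "inE K V u" shows "(\<integral>x. (u x)\<^sup>2 \<partial>lebesgue) \<le> (N u)\<^sup>2 / c"
  using L2_region_le_N[OF u, of UNIV c] c_pos V_ge by simp

lemma L1_product_le_N:
  assumes u: "inE K V u" and v: "inE K V v"
  shows "(\<integral>x. \<bar>u x\<bar> * \<bar>v x\<bar> \<partial>lebesgue) \<le> N u * N v / c"
proof -
  have "(\<integral>x. \<bar>u x\<bar> * \<bar>v x\<bar> \<partial>lebesgue)\<^sup>2 \<le> (\<integral>x. (u x)\<^sup>2 \<partial>lebesgue) * (\<integral>x. (v x)\<^sup>2 \<partial>lebesgue)"
    by (intro Cauchy_Schwarz_L2 inE_measurable inE_sq_integrable u v)
  also have "\<dots> \<le> ((N u)\<^sup>2 / c) * ((N v)\<^sup>2 / c)"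
    using c_pos by (intro mult_mono L2_le_N u v) auto
  also have "\<dots> = (N u * N v / c)\<^sup>2" by (simp add: power2_eq_square)
  finally show ?thesis by (rule power2_le_imp_le) (use c_pos N_nonneg in auto)
qed

text \<open>Apart from the norm, the potential occurs only through \<open>L\<close> in the first
  coefficient. So a large \<open>l\<close>, chosen without knowledge of \<open>V\<close>, settles
  the second term, and a large \<open>L\<close> afterwards the first.\<close>

lemma Lp_region_le:
  assumes u: "inE K V u" and p: "2 \<le> p" "p < qs" and l: "l > 0" 
    and \<Omega>: "\<Omega> \<in> sets lebesgue" and L: "L > 0" "\<And>x. x \<in> \<Omega> \<Longrightarrow> L \<le> V x"
  shows "(\<integral>x. indicator \<Omega> x * \<bar>u x\<bar> powr p \<partial>lebesgue) \<le>
    l powr (p - 2) / L * (N u)\<^sup>2 + Cp p * l powr (p - qs) * N u powr qs"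
proof -
  have "kform K u u powr (qs / 2) \<le> ((N u)\<^sup>2) powr (qs / 2)"
    using kform_le_N[of u] kform_nonneg[of u] tau by (intro powr_mono2) auto
  also have "\<dots> = N u powr qs"
  proof (cases "N u = 0")
    case False
    then have "N u > 0" using N_nonneg[of u] by simp
    then have "(N u)\<^sup>2 = N u powr 2" by simp
    then have "((N u)\<^sup>2) powr (qs / 2) = N u powr (2 * (qs / 2))" by (simp only: powr_powr)
    then show ?thesis by simp
  qed simp
  finally have G: "kform K u u powr (qs / 2) \<le> N u powr qs" .
  have "(\<integral>x. indicator \<Omega> x * \<bar>u x\<bar> powr p \<partial>lebesgue) \<le>
    l powr (p - 2) * (\<integral>x. indicator \<Omega> x * (u x)\<^sup>2 \<partial>lebesgue) + Cp p * l powr (p - qs) * kform K u u powr (qs / 2)"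
    by (rule Lp_bound[OF inE_inX[OF u] p l \<Omega>])
  also have "\<dots> \<le> l powr (p - 2) * ((N u)\<^sup>2 / L) + Cp p * l powr (p - qs) * N u powr qs"
    using Cp_pos[OF p(2)] by (intro add_mono mult_left_mono L2_region_le_N u \<Omega> L G) auto
  finally show ?thesis by simp
qed

end

section \<open>The nonlinearity\<close>

locale nonlinearity =
  fixes f :: "real \<Rightarrow> real" and c0 p theta :: real
  assumes f_cont: "continuous_on UNIV f" and c0: "c0 > 0" and p: "p > 2"
    and growth: "\<And>t. \<bar>f t\<bar> \<le> c0 * \<bar>t\<bar> powr (p - 1)"
    and theta: "theta > 2" and AR: "\<And>t. t > 0 \<Longrightarrow> theta * prim f t \<le> t * f t"
    and f_pos: "\<And>t. t > 0 \<Longrightarrow> f t > 0" and f_neg: "\<And>t. t < 0 \<Longrightarrow> f t = 0"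
begin

lemma f_0: "f 0 = 0" using growth[of 0] by simp

lemma f_nonpos: "t \<le> 0 \<Longrightarrow> f t = 0" using f_0 f_neg[of t] by (cases "t = 0") auto

lemma f_nonneg: "0 \<le> f t" using f_nonpos[of t] f_pos[of t] by (cases "t \<le> 0") auto

lemma f_measurable[measurable]: "f \<in> borel_measurable borel"
  by (rule borel_measurable_continuous_onI[OF f_cont])

lemma prim_nonpos: "t \<le> 0 \<Longrightarrow> prim f t = 0"
  by (cases "t = 0") (simp_all add: prim_def)

text \<open>To the left of 0 the interval \<open>{0..t}\<close> is empty and \<open>prim f\<close>
  is 0, in agreement with the vanishing of \<open>f\<close> there. Integrating from a base point
  \<open>a \<le> 0\<close> therefore gives the same function, and differentiability at 0 and on the
  negative axis follows.\<close>

lemma prim_shift: assumes "a \<le> 0" "a \<le> t" shows "prim f t = integral {a..t} f"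
proof (cases "t \<le> 0")
  case True
  have "integral {a..t} f = integral {a..t} (\<lambda>_. 0)"
    using True f_nonpos by (intro Henstock_Kurzweil_Integration.integral_cong) auto
  then show ?thesis using prim_nonpos[OF True] by simp
next
  case False
  have "integral {a..0} f = integral {a..0} (\<lambda>_. 0)"
    using f_nonpos by (intro Henstock_Kurzweil_Integration.integral_cong) auto
  moreover have "integral {a..0} f + integral {0..t} f = integral {a..t} f"
    using False assms by (intro Henstock_Kurzweil_Integration.integral_combine integrable_continuous_real continuous_on_subset[OF f_cont]) auto
  ultimately show ?thesis by (simp add: prim_def)
qed

lemma prim_deriv: "(prim f has_real_derivative f t) (at t)"
proof -
  define a where "a = - \<bar>t\<bar> - 1"
  have "((\<lambda>x. integral {a..x} f) has_real_derivative f t) (at t within {a..\<bar>t\<bar> + 1})"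
    by (intro integral_has_real_derivative continuous_on_subset[OF f_cont]) (auto simp: a_def)
  then have "((\<lambda>x. integral {a..x} f) has_real_derivative f t) (at t)"
    by (subst (asm) at_within_interior) (auto simp: a_def)
  moreover have "eventually (\<lambda>x. x \<in> {a<..}) (nhds t)"
    by (intro eventually_nhds_in_open) (auto simp: a_def)
  then have "eventually (\<lambda>x. prim f x = integral {a..x} f) (nhds t)"
    by eventually_elim (rule prim_shift, auto simp: a_def)
  ultimately show ?thesis by (subst DERIV_cong_ev[OF refl _ refl])
qed

lemma prim_continuous: "continuous_on UNIV (prim f)"
  using prim_deriv by (intro continuous_at_imp_continuous_on ballI DERIV_isCont)

lemma prim_measurable[measurable]: "prim f \<in> borel_measurable borel"
  by (rule borel_measurable_continuous_onI[OF prim_continuous])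

lemma prim_MVT: obtains z where "\<bar>z - t\<bar> \<le> \<bar>h\<bar>" "prim f (t + h) - prim f t = f z * h"
proof -
  consider "h = 0" | "h > 0" | "h < 0" by linarith
  then show thesis
  proof cases
    case 1 then show ?thesis using that[of t] by simp
  next
    case 2
    obtain z where "t < z" "z < t + h" "prim f (t + h) - prim f t = (t + h - t) * f z"
      using MVT2[of t "t + h" "prim f" f] prim_deriv 2 by auto
    then show ?thesis using that[of z] 2 by (simp add: mult.commute)
  next
    case 3
    obtain z where "t + h < z" "z < t" "prim f t - prim f (t + h) = (t - (t + h)) * f z"
      using MVT2[of "t + h" t "prim f" f] prim_deriv 3 by auto
    then show ?thesis using that[of z] 3 by (simp add: algebra_simps)
  qed
qed

lemma prim_nonneg: "0 \<le> prim f t"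
proof (cases "t \<le> 0")
  case False
  obtain z where "\<bar>z - 0\<bar> \<le> \<bar>t\<bar>" "prim f (0 + t) - prim f 0 = f z * t" by (rule prim_MVT)
  then show ?thesis using prim_nonpos[of 0] f_nonneg[of z] False by simp
qed (simp add: prim_nonpos)

lemma prim_1_pos: "0 < prim f 1"
proof -
  obtain z where "0 < z" "z < 1" "prim f 1 - prim f 0 = (1 - 0) * f z"
    using MVT2[of 0 1 "prim f" f] prim_deriv by auto
  then show ?thesis using prim_nonpos[of 0] f_pos[of z] by simp
qed

lemma prim_growth: "\<bar>prim f t\<bar> \<le> c0 * \<bar>t\<bar> powr p"
proof -
  obtain z where z: "\<bar>z - 0\<bar> \<le> \<bar>t\<bar>" "prim f (0 + t) - prim f 0 = f z * t" by (rule prim_MVT)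
  have "\<bar>prim f t\<bar> = \<bar>f z\<bar> * \<bar>t\<bar>" using z prim_nonpos[of 0] by (simp add: abs_mult)
  also have "\<dots> \<le> (c0 * \<bar>z\<bar> powr (p - 1)) * \<bar>t\<bar>" by (intro mult_right_mono growth) simp
  also have "\<dots> \<le> (c0 * \<bar>t\<bar> powr (p - 1)) * \<bar>t\<bar>"
    using z c0 p by (intro mult_right_mono mult_left_mono powr_mono2) auto
  also have "\<dots> = c0 * \<bar>t\<bar> powr p"
    using powr_mult_base[of "\<bar>t\<bar>" "p - 1"] by (simp add: mult_ac)
  finally show ?thesis .
qed

lemma AR_all: "theta * prim f t \<le> t * f t"
  using AR[of t] prim_nonpos[of t] f_nonpos[of t] by (cases "t > 0") auto

text \<open>(f2) means that \<open>prim f t * t powr (- theta)\<close> is nondecreasing for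
  \<open>t > 0\<close>; its value at 1 is the constant.\<close>

lemma prim_superquadratic: assumes t: "1 \<le> t" shows "prim f 1 * t powr theta \<le> prim f t"
proof -
  let ?g = "\<lambda>x. prim f x * x powr (- theta)"
  have "?g 1 \<le> ?g t"
  proof (rule DERIV_nonneg_imp_nondecreasing[OF t])
    fix x :: real assume x: "1 \<le> x" "x \<le> t"
    have "(?g has_real_derivative f x * x powr (- theta) + (- theta * x powr (- theta - 1)) * prim f x) (at x)"
      using x by (intro DERIV_mult prim_deriv has_real_derivative_powr) auto
    moreover have "f x * x powr (- theta) + (- theta * x powr (- theta - 1)) * prim f x =
        x powr (- theta - 1) * (x * f x - theta * prim f x)"
    proof -
      have "x powr (- theta) = x * x powr (- theta - 1)"
        using powr_mult_base[of x "- theta - 1"] x by simp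
      then show ?thesis by (simp add: algebra_simps)
    qed
    moreover have "\<dots> \<ge> 0" using AR_all[of x] by simp
    ultimately show "\<exists>y. (?g has_real_derivative y) (at x) \<and> 0 \<le> y" by metis
  qed
  then have "prim f 1 \<le> prim f t * t powr (- theta)" by simp
  then have "prim f 1 * t powr theta \<le> prim f t * t powr (- theta) * t powr theta"
    by (intro mult_right_mono) auto
  also have "\<dots> = prim f t" using t by (simp add: powr_minus)
  finally show ?thesis .
qed

text \<open>Up to an error that is small relative to \<open>|t| + |t| powr (q - 1)\<close>, the function \<open>f\<close> is Lipschitz.
  Because \<open>q\<close> can be taken subcritical, this makes the derivative of the energy uniformly
  continuous on bounded sets although \<open>f\<close> is only continuous.\<close>

lemma f_modulus:
  assumes q: "p < q" and \<eta>: "\<eta> > 0"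
  shows "\<exists>C\<ge>0. \<forall>t r. \<bar>f t - f r\<bar> \<le> \<eta> * (\<bar>t\<bar> + \<bar>r\<bar> + \<bar>t\<bar> powr (q - 1) + \<bar>r\<bar> powr (q - 1)) + C * \<bar>t - r\<bar>"
proof -
  \<comment> \<open>\<open>m\<close> and \<open>T\<close> solve
    \<open>c0 * m powr (p - 2) = \<eta>\<close> and \<open>c0 * T powr (p - q) = \<eta>\<close>: up
    to \<open>m\<close> the growth bound is at most \<open>\<eta> * |t|\<close>, from
    \<open>T\<close> on at most \<open>\<eta> * |t| powr (q - 1)\<close>.\<close>
  define m where "m = (\<eta> / c0) powr (1 / (p - 2))"
  define T where "T = (\<eta> / c0) powr (1 / (p - q))"
  have m: "m > 0" and T: "T > 0" using \<eta> c0 by (auto simp: m_def T_def)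
  have mp: "c0 * m powr (p - 2) = \<eta>" using \<eta> c0 p by (simp add: m_def powr_powr)
  have Tp: "c0 * T powr (p - q) = \<eta>" using \<eta> c0 q by (simp add: T_def powr_powr)
  have small: "\<bar>f t\<bar> \<le> \<eta> * \<bar>t\<bar>" if "\<bar>t\<bar> \<le> m" for t
  proof -
    have "\<bar>f t\<bar> \<le> c0 * \<bar>t\<bar> powr (p - 1)" by (rule growth)
    also have "\<bar>t\<bar> powr (p - 1) = \<bar>t\<bar> powr (p - 2) * \<bar>t\<bar>"
      using powr_mult_base[of "\<bar>t\<bar>" "p - 2"] by (simp add: mult_ac)
    also have "c0 * (\<bar>t\<bar> powr (p - 2) * \<bar>t\<bar>) \<le> c0 * (m powr (p - 2) * \<bar>t\<bar>)"
      using that c0 p by (intro mult_left_mono mult_right_mono powr_mono2) auto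
    finally show ?thesis using mp by (simp add: mult.assoc[symmetric])
  qed
  have large: "\<bar>f t\<bar> \<le> \<eta> * \<bar>t\<bar> powr (q - 1)" if "T \<le> \<bar>t\<bar>" for t
  proof -
    have "\<bar>f t\<bar> \<le> c0 * \<bar>t\<bar> powr (p - 1)" by (rule growth)
    also have "\<bar>t\<bar> powr (p - 1) = \<bar>t\<bar> powr (p - q) * \<bar>t\<bar> powr (q - 1)"
      by (simp add: powr_add[symmetric])
    also have "c0 * (\<bar>t\<bar> powr (p - q) * \<bar>t\<bar> powr (q - 1)) \<le> c0 * (T powr (p - q) * \<bar>t\<bar> powr (q - 1))"
      using that c0 q T by (intro mult_left_mono mult_right_mono powr_mono2') auto
    finally show ?thesis using Tp by (simp add: mult.assoc[symmetric])
  qed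
  define B where "B = c0 * T powr (p - 1)"
  have B: "B \<ge> 0" using c0 by (simp add: B_def)
  have all: "\<bar>f t\<bar> \<le> \<eta> * \<bar>t\<bar> powr (q - 1) + B" for t
  proof (cases "T \<le> \<bar>t\<bar>")
    case True then show ?thesis using large[OF True] B by linarith
  next
    case False
    have "\<bar>f t\<bar> \<le> c0 * \<bar>t\<bar> powr (p - 1)" by (rule growth)
    also have "\<dots> \<le> B" unfolding B_def using False c0 p by (intro mult_left_mono powr_mono2) auto
    moreover have "0 \<le> \<eta> * \<bar>t\<bar> powr (q - 1)" using \<eta> by simp
    ultimately show ?thesis by linarith
  qed
  \<comment> \<open>The tolerance \<open>\<eta> * m\<close> below is absorbed by
    \<open>\<eta> * |t|\<close> as soon as \<open>|t| > m\<close>; the margin 1 of the interval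
    leaves room for \<open>r\<close> with \<open>|t - r| < d \<le> 1\<close>.\<close>
  have "uniformly_continuous_on {-T-1..T+1} f"
    by (intro compact_uniformly_continuous continuous_on_subset[OF f_cont]) auto
  then obtain d0 where d0: "d0 > 0" "\<And>x y. x \<in> {-T-1..T+1} \<Longrightarrow> y \<in> {-T-1..T+1} \<Longrightarrow> dist y x < d0 \<Longrightarrow> dist (f y) (f x) < \<eta> * m"
    unfolding uniformly_continuous_on_def using \<eta> m by (metis mult_pos_pos)
  define d where "d = min d0 1"
  have d: "d > 0" "d \<le> d0" "d \<le> 1" using d0 by (auto simp: d_def)
  \<comment> \<open>For arguments at distance at least \<open>d\<close> the Lipschitz term covers
    the constant \<open>B\<close> from both values.\<close>
  define C where "C = 2 * B / d"
  have C: "C \<ge> 0" using B d by (simp add: C_def)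
  have far: "2 * B \<le> C * \<bar>t - r\<bar>" if "d \<le> \<bar>t - r\<bar>" for t r
  proof -
    have "2 * B = C * d" using d by (simp add: C_def)
    also have "\<dots> \<le> C * \<bar>t - r\<bar>" using that C by (rule mult_left_mono)
    finally show ?thesis .
  qed
  have mid: "\<bar>f t - f r\<bar> \<le> \<eta> * \<bar>t\<bar>" if "m < \<bar>t\<bar>" "\<bar>t\<bar> < T" "\<bar>t - r\<bar> < d" for t r
  proof -
    have "dist (f r) (f t) < \<eta> * m" using that d by (intro d0) (auto simp: dist_real_def)
    moreover have "\<eta> * m \<le> \<eta> * \<bar>t\<bar>" using that \<eta> by (intro mult_left_mono) auto
    ultimately show ?thesis by (simp add: dist_real_def abs_minus_commute)
  qed
  have "\<bar>f t - f r\<bar> \<le> \<eta> * (\<bar>t\<bar> + \<bar>r\<bar> + \<bar>t\<bar> powr (q - 1) + \<bar>r\<bar> powr (q - 1)) + C * \<bar>t - r\<bar>" for t r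
  proof -
    have nn: "0 \<le> \<eta> * \<bar>t\<bar>" "0 \<le> \<eta> * \<bar>r\<bar>" "0 \<le> \<eta> * \<bar>t\<bar> powr (q - 1)" "0 \<le> \<eta> * \<bar>r\<bar> powr (q - 1)" "0 \<le> C * \<bar>t - r\<bar>"
      using \<eta> C by auto
    have "\<bar>f t - f r\<bar> \<le> \<eta> * \<bar>t\<bar> + \<eta> * \<bar>r\<bar> + \<eta> * \<bar>t\<bar> powr (q - 1) + \<eta> * \<bar>r\<bar> powr (q - 1) + C * \<bar>t - r\<bar>"
    proof (cases "d \<le> \<bar>t - r\<bar>")
      case True
      then show ?thesis using far[OF True] all[of t] all[of r] nn by linarith
    next
      case False
      then have close: "\<bar>t - r\<bar> < d" "\<bar>r - t\<bar> < d" by linarith+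
      \<comment> \<open>For close arguments one intermediate argument suffices; if neither is
        intermediate, both values of \<open>f\<close> are small on their own.\<close>
      consider "m < \<bar>t\<bar>" "\<bar>t\<bar> < T" | "m < \<bar>r\<bar>" "\<bar>r\<bar> < T" | "(\<bar>t\<bar> \<le> m \<or> T \<le> \<bar>t\<bar>) \<and> (\<bar>r\<bar> \<le> m \<or> T \<le> \<bar>r\<bar>)" by linarith
      then show ?thesis
      proof cases
        case 1 then show ?thesis using mid[of t r] close nn by linarith
      next
        case 2 then show ?thesis using mid[of r t] close nn by linarith
      next
        case 3
        have "\<bar>f t\<bar> \<le> \<eta> * \<bar>t\<bar> + \<eta> * \<bar>t\<bar> powr (q - 1)" using 3 small[of t] large[of t] nn by linarith
        moreover have "\<bar>f r\<bar> \<le> \<eta> * \<bar>r\<bar> + \<eta> * \<bar>r\<bar> powr (q - 1)" using 3 small[of r] large[of r] nn by linarith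
        ultimately show ?thesis using nn by linarith
      qed
    qed
    then show ?thesis by (simp add: algebra_simps)
  qed
  then show ?thesis using C by blast
qed

text \<open>The factors 2 give the bound the form that \<open>pairing\<close> requires, with
  \<open>h = 0\<close>.\<close>

lemma f_growth_two_powers: "p < q \<Longrightarrow> \<bar>f t\<bar> \<le> c0 * (2 * \<bar>t\<bar> + 2 * \<bar>t\<bar> powr (q - 1))"
proof -
  assume q: "p < q"
  have "\<bar>t\<bar> powr (p - 1) \<le> \<bar>t\<bar> + \<bar>t\<bar> powr (q - 1)"
  proof (cases "\<bar>t\<bar> \<le> 1")
    case True
    have "\<bar>t\<bar> powr (p - 1) \<le> \<bar>t\<bar> powr 1" using True p by (intro powr_mono') auto
    moreover have "\<bar>t\<bar> powr 1 = \<bar>t\<bar>" by simp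
    moreover have "0 \<le> \<bar>t\<bar> powr (q - 1)" by simp
    ultimately show ?thesis by linarith
  next
    case False
    have "\<bar>t\<bar> powr (p - 1) \<le> \<bar>t\<bar> powr (q - 1)" using False q by (intro powr_mono) auto
    then show ?thesis by linarith
  qed
  then have "c0 * \<bar>t\<bar> powr (p - 1) \<le> c0 * (2 * \<bar>t\<bar> + 2 * \<bar>t\<bar> powr (q - 1))"
    using c0 powr_ge_zero[of "\<bar>t\<bar>" "q - 1"] by (intro mult_left_mono) linarith+
  then show ?thesis using growth[of t] by linarith
qed

end

section \<open>The energy functional\<close>

lemma Young_powr:
  fixes a b q :: real
  assumes "a \<ge> 0" "b \<ge> 0" "q > 1"
  shows "a powr (q - 1) * b \<le> a powr q + b powr q"
proof -
  have x: "x powr (q - 1) * x = x powr q" if "x \<ge> 0" for x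
    using powr_mult_base[OF that, of "q - 1"] by (simp add: mult.commute)
  show ?thesis
  proof (cases "a \<le> b")
    case True
    have "a powr (q - 1) * b \<le> b powr (q - 1) * b" using assms True by (intro mult_right_mono powr_mono2) auto
    then show ?thesis using x[of b] assms powr_ge_zero[of a q] by linarith
  next
    case False
    have "a powr (q - 1) * b \<le> a powr (q - 1) * a" using False by (intro mult_left_mono) auto
    then show ?thesis using x[of a] assms powr_ge_zero[of b q] by linarith
  qed
qed

lemma sum_powr_le:
  fixes a b q :: real
  assumes "a \<ge> 0" "b \<ge> 0" "q > 0"
  shows "(a + b) powr q \<le> 2 powr q * (a powr q + b powr q)"
proof -
  have "(a + b) powr q \<le> (2 * max a b) powr q" using assms by (intro powr_mono2) auto
  also have "\<dots> = 2 powr q * max a b powr q" using assms by (intro powr_mult)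
  also have "max a b powr q \<le> a powr q + b powr q" by (auto simp: max_def)
  finally show ?thesis by simp
qed

locale problem = kernel_potential K s lam V c + nonlinearity f c0 p theta
  for K :: "'a::euclidean_space \<Rightarrow> real" and s lam V c f c0 p theta +
  assumes p_subcritical: "p < 2 * real DIM('a) / (real DIM('a) - 2 * s)"
begin

lemma p_qs: "p < qs" using p_subcritical by (simp add: qs_def dim_def)

text \<open>An exponent strictly between \<open>p\<close> and the critical one: it beats the growth
  of \<open>f\<close> at infinity, and the corresponding integral is still bounded on bounded
  sets.\<close>

definition q :: real where "q = (p + qs) / 2"

lemma q: "p < q" "q < qs" "2 < q" using p_qs p by (auto simp: q_def)

lemma Lp_le_N:
  assumes "inE K V u" "2 \<le> r" "r < qs" "l > 0"
  shows "(\<integral>x. \<bar>u x\<bar> powr r \<partial>lebesgue) \<le> l powr (r - 2) / c * (N u)\<^sup>2 + Cp r * l powr (r - qs) * N u powr qs"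
  using Lp_region_le[OF assms, of UNIV c] c_pos V_ge by simp

definition Aq :: "real \<Rightarrow> real" where "Aq M = M\<^sup>2 / c + Cp q * M powr qs"

lemma Aq_nonneg: "0 \<le> Aq M" using c_pos Cp_pos[OF q(2)] by (simp add: Aq_def)

lemma Lq_le:
  assumes u: "inE K V u" and M: "N u \<le> M"
  shows "(\<integral>x. \<bar>u x\<bar> powr q \<partial>lebesgue) \<le> Aq M"
proof -
  have "(\<integral>x. \<bar>u x\<bar> powr q \<partial>lebesgue) \<le> (N u)\<^sup>2 / c + Cp q * N u powr qs"
    using Lp_le_N[OF u _ q(2), of 1] q by simp
  also have "\<dots> \<le> M\<^sup>2 / c + Cp q * M powr qs"
    using c_pos Cp_pos[OF q(2)] M N_nonneg[of u] tau
    by (intro add_mono divide_right_mono mult_left_mono power_mono powr_mono2) auto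
  finally show ?thesis by (simp add: Aq_def)
qed

lemma L2_le: assumes u: "inE K V u" and M: "N u \<le> M" shows "(\<integral>x. (u x)\<^sup>2 \<partial>lebesgue) \<le> M\<^sup>2 / c"
proof -
  have "(N u)\<^sup>2 / c \<le> M\<^sup>2 / c" using M N_nonneg[of u] c_pos by (intro divide_right_mono power_mono) auto
  then show ?thesis using L2_le_N[OF u] by linarith
qed

lemmas Lp_int = Lp_integrable[OF inE_inX]

section \<open>Pairing estimates that are uniform on balls\<close>

text \<open>Collects the integrals of the majorant \<open>W\<close> in \<open>pairing_unit\<close>:
  squares of \<open>u\<close>, \<open>h\<close>, \<open>\<phi>\<close> in the first group,
  \<open>q\<close>-th powers in the second, for norms at most \<open>M\<close>, 1 and 1.\<close>

definition pair_const :: "real \<Rightarrow> real" where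
  "pair_const M = 2 * (2 * (M\<^sup>2 / c) + 2 * (1\<^sup>2 / c) + 1\<^sup>2 / c) + 2 * (2 powr q * (Aq M + Aq 1) + Aq 1)"

lemma pair_const_nonneg: "0 \<le> pair_const M"
  using c_pos Aq_nonneg[of M] Aq_nonneg[of 1] by (auto simp: pair_const_def intro!: add_nonneg_nonneg)

text \<open>The estimate behind continuity and differentiability of the energy: \<open>g\<close>
  will be \<open>f (u x)\<close>, an increment of it, or the quotient of a Taylor remainder by
  \<open>h\<close>. The first part is small by the choice of \<open>\<eta>\<close>, the Lipschitz
  part because it carries the factor \<open>N h\<close>. For \<open>N \<phi> \<le> 1\<close> Young's
  inequality can be used without weights; linearity in \<open>\<phi>\<close> is restored in
  \<open>pairing\<close>.\<close>

lemma pairing_unit: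
  assumes u: "inE K V u" and h: "inE K V h" and \<phi>: "inE K V \<phi>" and Nu: "N u \<le> M" and Nh: "N h \<le> 1" and N\<phi>: "N \<phi> \<le> 1"
    and g[measurable]: "g \<in> borel_measurable lebesgue" and \<eta>: "\<eta> \<ge> 0" and C: "C \<ge> 0"
    and bd: "\<And>x. \<bar>g x\<bar> \<le> \<eta> * (2 * (\<bar>u x\<bar> + \<bar>h x\<bar>) + 2 * (\<bar>u x\<bar> + \<bar>h x\<bar>) powr (q - 1)) + C * \<bar>h x\<bar>"
  shows "integrable lebesgue (\<lambda>x. g x * \<phi> x)"
    "(\<integral>x. \<bar>g x * \<phi> x\<bar> \<partial>lebesgue) \<le> \<eta> * pair_const M + C * N h / c"
proof -
  note [measurable] = inE_measurable[OF u] inE_measurable[OF h] inE_measurable[OF \<phi>]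
  define W where "W x = \<eta> * (2 * (2 * (u x)\<^sup>2 + 2 * (h x)\<^sup>2 + (\<phi> x)\<^sup>2) +
      2 * (2 powr q * (\<bar>u x\<bar> powr q + \<bar>h x\<bar> powr q) + \<bar>\<phi> x\<bar> powr q)) + C * (\<bar>h x\<bar> * \<bar>\<phi> x\<bar>)" for x
  have gW: "\<bar>g x * \<phi> x\<bar> \<le> W x" for x
  proof -
    define a where "a = \<bar>u x\<bar> + \<bar>h x\<bar>"
    have a: "a \<ge> 0" by (simp add: a_def)
    have "\<bar>g x * \<phi> x\<bar> = \<bar>g x\<bar> * \<bar>\<phi> x\<bar>" by (simp add: abs_mult)
    also have "\<dots> \<le> (\<eta> * (2 * a + 2 * a powr (q - 1)) + C * \<bar>h x\<bar>) * \<bar>\<phi> x\<bar>"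
      unfolding a_def by (intro mult_right_mono bd) simp
    also have "\<dots> = \<eta> * (2 * (a * \<bar>\<phi> x\<bar>) + 2 * (a powr (q - 1) * \<bar>\<phi> x\<bar>)) + C * (\<bar>h x\<bar> * \<bar>\<phi> x\<bar>)"
      by (simp add: algebra_simps)
    also have "\<dots> \<le> W x"
      unfolding W_def
    proof (intro add_mono mult_left_mono order_refl \<eta>)
      have "a * \<bar>\<phi> x\<bar> \<le> a\<^sup>2 + \<bar>\<phi> x\<bar>\<^sup>2" using abs_mult_le_squares[of a "\<bar>\<phi> x\<bar>"] a by simp
      moreover have "a\<^sup>2 \<le> 2 * (u x)\<^sup>2 + 2 * (h x)\<^sup>2"
        using square_add_le[of "\<bar>u x\<bar>" "\<bar>h x\<bar>"] by (simp add: a_def)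
      ultimately show "a * \<bar>\<phi> x\<bar> \<le> 2 * (u x)\<^sup>2 + 2 * (h x)\<^sup>2 + (\<phi> x)\<^sup>2" by simp
      have "a powr (q - 1) * \<bar>\<phi> x\<bar> \<le> a powr q + \<bar>\<phi> x\<bar> powr q" using a q by (intro Young_powr) auto
      moreover have "a powr q \<le> 2 powr q * (\<bar>u x\<bar> powr q + \<bar>h x\<bar> powr q)"
        unfolding a_def using q by (intro sum_powr_le) auto
      ultimately show "a powr (q - 1) * \<bar>\<phi> x\<bar> \<le> 2 powr q * (\<bar>u x\<bar> powr q + \<bar>h x\<bar> powr q) + \<bar>\<phi> x\<bar> powr q" by simp
    qed (use C in auto)
    finally show ?thesis .
  qed
  have q2: "2 \<le> q" using q by simp
  have h\<phi>: "integrable lebesgue (\<lambda>x. \<bar>h x\<bar> * \<bar>\<phi> x\<bar>)"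
    by (rule integrable_mult_L2) (use inE_sq_integrable h \<phi> in auto)
  note ints = inE_sq_integrable[OF u] inE_sq_integrable[OF h] inE_sq_integrable[OF \<phi>]
    Lp_int[OF u q2 q(2)] Lp_int[OF h q2 q(2)] Lp_int[OF \<phi> q2 q(2)] h\<phi>
  have Wi: "integrable lebesgue W" unfolding W_def using ints by simp
  show int: "integrable lebesgue (\<lambda>x. g x * \<phi> x)"
    by (rule Bochner_Integration.integrable_bound[OF Wi]) (use gW in \<open>auto intro!: AE_I2 order_trans[OF _ abs_ge_self] simp del: abs_mult\<close>)
  have "(\<integral>x. \<bar>g x * \<phi> x\<bar> \<partial>lebesgue) \<le> (\<integral>x. W x \<partial>lebesgue)"
    using int Wi gW by (intro integral_mono) auto
  also have "\<dots> = \<eta> * (2 * (2 * (\<integral>x. (u x)\<^sup>2 \<partial>lebesgue) + 2 * (\<integral>x. (h x)\<^sup>2 \<partial>lebesgue) + (\<integral>x. (\<phi> x)\<^sup>2 \<partial>lebesgue)) +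
      2 * (2 powr q * ((\<integral>x. \<bar>u x\<bar> powr q \<partial>lebesgue) + (\<integral>x. \<bar>h x\<bar> powr q \<partial>lebesgue)) + (\<integral>x. \<bar>\<phi> x\<bar> powr q \<partial>lebesgue)))
       + C * (\<integral>x. \<bar>h x\<bar> * \<bar>\<phi> x\<bar> \<partial>lebesgue)"
    unfolding W_def using ints by simp
  also have "\<dots> \<le> \<eta> * pair_const M + C * (N h / c)"
    unfolding pair_const_def
  proof (intro add_mono mult_left_mono \<eta> C L2_le Lq_le u h \<phi> Nu Nh N\<phi>)
    have "N h * N \<phi> / c \<le> N h * 1 / c"
      using N\<phi> c_pos N_nonneg by (intro divide_right_mono mult_left_mono) auto
    then show "(\<integral>x. \<bar>h x\<bar> * \<bar>\<phi> x\<bar> \<partial>lebesgue) \<le> N h / c" using L1_product_le_N[OF h \<phi>] by simp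
  qed auto
  finally show "(\<integral>x. \<bar>g x * \<phi> x\<bar> \<partial>lebesgue) \<le> \<eta> * pair_const M + C * N h / c" by simp
qed

lemma pairing:
  assumes u: "inE K V u" and h: "inE K V h" and \<phi>: "inE K V \<phi>" and Nu: "N u \<le> M" and Nh: "N h \<le> 1"
    and g: "g \<in> borel_measurable lebesgue" and \<eta>: "\<eta> \<ge> 0" and C: "C \<ge> 0"
    and bd: "\<And>x. \<bar>g x\<bar> \<le> \<eta> * (2 * (\<bar>u x\<bar> + \<bar>h x\<bar>) + 2 * (\<bar>u x\<bar> + \<bar>h x\<bar>) powr (q - 1)) + C * \<bar>h x\<bar>"
  shows "integrable lebesgue (\<lambda>x. g x * \<phi> x)"
    "(\<integral>x. \<bar>g x * \<phi> x\<bar> \<partial>lebesgue) \<le> (\<eta> * pair_const M + C * N h / c) * N \<phi>"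
proof -
  define B where "B = \<eta> * pair_const M + C * N h / c"
  have B: "B \<ge> 0" unfolding B_def using \<eta> C c_pos N_nonneg pair_const_nonneg by (intro add_nonneg_nonneg) auto
  \<comment> \<open>Scaling by an arbitrary \<open>\<tau> > N \<phi>\<close> and letting it decrease
    to \<open>N \<phi>\<close> includes the case \<open>N \<phi> = 0\<close>, where normalisation is
    impossible.\<close>
  have scaled: "integrable lebesgue (\<lambda>x. g x * \<phi> x) \<and> (\<integral>x. \<bar>g x * \<phi> x\<bar> \<partial>lebesgue) \<le> B * \<tau>" if \<tau>: "\<tau> > N \<phi>" for \<tau>
  proof -
    have \<tau>0: "\<tau> > 0" using \<tau> N_nonneg[of \<phi>] by linarith
    define \<psi> where "\<psi> = (1 / \<tau>) *\<^sub>R \<phi>"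
    have \<psi>: "inE K V \<psi>" unfolding \<psi>_def using inE_lin[OF \<phi> \<phi>, of "1 / \<tau>" 0] by (simp add: scaleR_fun_def)
    have "N \<psi> = N \<phi> / \<tau>" unfolding \<psi>_def using N_scale[OF \<phi>] \<tau>0 by simp
    then have N\<psi>: "N \<psi> \<le> 1" using \<tau> \<tau>0 by simp
    have eq: "g x * \<phi> x = \<tau> * (g x * \<psi> x)" for x using \<tau>0 by (simp add: \<psi>_def scaleR_fun_def)
    note pu = pairing_unit[OF u h \<psi> Nu Nh N\<psi> g \<eta> C bd]
    have "(\<integral>x. \<bar>g x * \<phi> x\<bar> \<partial>lebesgue) = \<tau> * (\<integral>x. \<bar>g x * \<psi> x\<bar> \<partial>lebesgue)"
      unfolding eq using \<tau>0 by (simp add: abs_mult)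
    also have "\<dots> \<le> \<tau> * B" unfolding B_def using \<tau>0 pu(2) by (intro mult_left_mono) auto
    finally show ?thesis using pu(1) unfolding eq by (simp add: mult.commute)
  qed
  show "integrable lebesgue (\<lambda>x. g x * \<phi> x)" using scaled[of "N \<phi> + 1"] by simp
  have "(\<integral>x. \<bar>g x * \<phi> x\<bar> \<partial>lebesgue) \<le> B * N \<phi>"
  proof (rule field_le_epsilon)
    fix e :: real assume e: "e > 0"
    have "(\<integral>x. \<bar>g x * \<phi> x\<bar> \<partial>lebesgue) \<le> B * (N \<phi> + e / (B + 1))" using scaled[of "N \<phi> + e / (B + 1)"] e B by simp
    also have "\<dots> = B * N \<phi> + e * (B / (B + 1))" by (simp add: algebra_simps)
    also have "e * (B / (B + 1)) \<le> e * 1" using e B by (intro mult_left_mono) auto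
    finally show "(\<integral>x. \<bar>g x * \<phi> x\<bar> \<partial>lebesgue) \<le> B * N \<phi> + e" by simp
  qed
  then show "(\<integral>x. \<bar>g x * \<phi> x\<bar> \<partial>lebesgue) \<le> (\<eta> * pair_const M + C * N h / c) * N \<phi>" by (simp add: B_def)
qed

lemma fu_pairing:
  assumes u: "inE K V u" and \<phi>: "inE K V \<phi>" and M: "N u \<le> M"
  shows "integrable lebesgue (\<lambda>x. f (u x) * \<phi> x)" "\<bar>\<integral>x. f (u x) * \<phi> x \<partial>lebesgue\<bar> \<le> c0 * pair_const M * N \<phi>"
proof -
  note [measurable] = inE_measurable[OF u]
  have N0: "N (\<lambda>x. 0) = 0" using N_scale[OF inE_zero, of 0] by (simp add: scaleR_fun_def)
  have "\<bar>f (u x)\<bar> \<le> c0 * (2 * (\<bar>u x\<bar> + \<bar>0\<bar>) + 2 * (\<bar>u x\<bar> + \<bar>0\<bar>) powr (q - 1)) + 0 * \<bar>0\<bar>" for x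
    using f_growth_two_powers[OF q(1), of "u x"] by simp
  note * = pairing[OF u inE_zero \<phi> M _ _ _ _ this]
  show "integrable lebesgue (\<lambda>x. f (u x) * \<phi> x)" by (rule *(1)) (use N0 c0 in auto)
  have "\<bar>\<integral>x. f (u x) * \<phi> x \<partial>lebesgue\<bar> \<le> (\<integral>x. \<bar>f (u x) * \<phi> x\<bar> \<partial>lebesgue)" by (rule integral_abs_bound)
  also have "\<dots> \<le> (c0 * pair_const M + 0 * N (\<lambda>x. 0) / c) * N \<phi>" by (rule *(2)) (use N0 c0 in auto)
  finally show "\<bar>\<integral>x. f (u x) * \<phi> x \<partial>lebesgue\<bar> \<le> c0 * pair_const M * N \<phi>" by simp
qed

lemma prim_integrable:
  assumes u: "inE K V u" shows "integrable lebesgue (\<lambda>x. prim f (u x))"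
proof (rule Bochner_Integration.integrable_bound[of _ "\<lambda>x. c0 * \<bar>u x\<bar> powr p"])
  note [measurable] = inE_measurable[OF u]
  show "integrable lebesgue (\<lambda>x. c0 * \<bar>u x\<bar> powr p)" using Lp_int[OF u _ p_qs] p by simp
  show "(\<lambda>x. prim f (u x)) \<in> borel_measurable lebesgue" by measurable
  show "AE x in lebesgue. norm (prim f (u x)) \<le> norm (c0 * \<bar>u x\<bar> powr p)"
    using prim_growth by (intro AE_I2) (auto intro: order_trans[OF _ abs_ge_self])
qed

section \<open>The energy, its derivative and its shape near 0\<close>

definition J :: "('a \<Rightarrow> real) \<Rightarrow> real" where "J u = form u u / 2 - (\<integral>x. prim f (u x) \<partial>lebesgue)"
definition D :: "('a \<Rightarrow> real) \<Rightarrow> ('a \<Rightarrow> real) \<Rightarrow> real" where "D u h = form u h - (\<integral>x. f (u x) * h x \<partial>lebesgue)"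

lemma D_lin:
  assumes u: "inE K V u" and v: "inE K V v" and w: "inE K V w"
  shows "D u (\<lambda>x. a * v x + b * w x) = a * D u v + b * D u w"
proof -
  have "(\<integral>x. f (u x) * (a * v x + b * w x) \<partial>lebesgue) = (\<integral>x. a * (f (u x) * v x) + b * (f (u x) * w x) \<partial>lebesgue)"
    by (simp add: algebra_simps)
  also have "\<dots> = a * (\<integral>x. f (u x) * v x \<partial>lebesgue) + b * (\<integral>x. f (u x) * w x \<partial>lebesgue)"
    using fu_pairing(1)[OF u v order_refl] fu_pairing(1)[OF u w order_refl] by simp
  finally show ?thesis unfolding D_def form_lin[OF u v w] by (simp add: algebra_simps)
qed

lemma D_bounded:
  assumes u: "inE K V u" and h: "inE K V h" and M: "N u \<le> M"
  shows "\<bar>D u h\<bar> \<le> (M + c0 * pair_const M) * N h"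
proof -
  have "\<bar>form u h\<bar> \<le> M * N h"
    using form_Cauchy_Schwarz[OF u h] mult_right_mono[OF M N_nonneg[of h]] by linarith
  then show ?thesis using fu_pairing(2)[OF u h M] unfolding D_def by (simp add: algebra_simps)
qed

lemma modulus_bound:
  assumes C: "C \<ge> 0" "\<And>t r. \<bar>f t - f r\<bar> \<le> \<eta> * (\<bar>t\<bar> + \<bar>r\<bar> + \<bar>t\<bar> powr (q - 1) + \<bar>r\<bar> powr (q - 1)) + C * \<bar>t - r\<bar>"
    and \<eta>: "\<eta> > 0" and z: "\<bar>z - t\<bar> \<le> \<bar>y\<bar>"
  shows "\<bar>f z - f t\<bar> \<le> \<eta> * (2 * (\<bar>t\<bar> + \<bar>y\<bar>) + 2 * (\<bar>t\<bar> + \<bar>y\<bar>) powr (q - 1)) + C * \<bar>y\<bar>"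
proof -
  have z1: "\<bar>z\<bar> \<le> \<bar>t\<bar> + \<bar>y\<bar>" using z by linarith
  have "\<bar>f z - f t\<bar> \<le> \<eta> * (\<bar>z\<bar> + \<bar>t\<bar> + \<bar>z\<bar> powr (q - 1) + \<bar>t\<bar> powr (q - 1)) + C * \<bar>z - t\<bar>" by (rule C)
  also have "\<dots> \<le> \<eta> * ((\<bar>t\<bar> + \<bar>y\<bar>) + (\<bar>t\<bar> + \<bar>y\<bar>) + (\<bar>t\<bar> + \<bar>y\<bar>) powr (q - 1) + (\<bar>t\<bar> + \<bar>y\<bar>) powr (q - 1)) + C * \<bar>y\<bar>"
    using z1 z \<eta> C q by (intro add_mono mult_left_mono powr_mono2) auto
  finally show ?thesis by (simp add: algebra_simps)
qed

text \<open>\<open>\<eta>\<close> comes first, small against \<open>pair_const M\<close>;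
  \<open>f_modulus\<close> then returns a possibly huge \<open>C\<close>, and
  \<open>\<delta>\<close> is taken small against \<open>C\<close>. Of \<open>u\<close> only the
  bound \<open>M\<close> is used.\<close>

lemma D_unif:
  assumes \<epsilon>: "\<epsilon> > 0"
  shows "\<exists>\<delta>>0. \<forall>u\<in>E. \<forall>h\<in>E. N u \<le> M \<and> N h \<le> \<delta> \<longrightarrow> (\<forall>k\<in>E. \<bar>D (u + h) k - D u k\<bar> \<le> \<epsilon> * N k)"
  and J_diff: "\<exists>\<delta>>0. \<forall>u\<in>E. \<forall>h\<in>E. N u \<le> M \<and> N h \<le> \<delta> \<longrightarrow> \<bar>J (u + h) - J u - D u h\<bar> \<le> \<epsilon> * N h"
proof -
  define \<eta> where "\<eta> = \<epsilon> / (2 * (pair_const M + 1))"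
  have \<eta>: "\<eta> > 0" using \<epsilon> pair_const_nonneg[of M] by (simp add: \<eta>_def)
  have \<eta>p: "\<eta> * pair_const M \<le> \<epsilon> / 2" using \<epsilon> pair_const_nonneg[of M] by (simp add: \<eta>_def field_simps)
  obtain C where C: "C \<ge> 0" "\<And>t r. \<bar>f t - f r\<bar> \<le> \<eta> * (\<bar>t\<bar> + \<bar>r\<bar> + \<bar>t\<bar> powr (q - 1) + \<bar>r\<bar> powr (q - 1)) + C * \<bar>t - r\<bar>"
    using f_modulus[OF q(1) \<eta>] by blast
  define \<delta> where "\<delta> = min 1 (\<epsilon> / (2 * (C / c + 2)))"
  have den: "C / c + 2 > 0" using C c_pos by (intro add_nonneg_pos) auto
  have \<delta>: "\<delta> > 0" "\<delta> \<le> 1" using den \<epsilon> by (auto simp: \<delta>_def)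
  have \<delta>C: "(C / c + 2) * \<delta> \<le> \<epsilon> / 2"
  proof -
    have "(C / c + 2) * \<delta> \<le> (C / c + 2) * (\<epsilon> / (2 * (C / c + 2)))" using den by (intro mult_left_mono) (auto simp: \<delta>_def)
    also have "w * (\<epsilon> / (2 * w)) = \<epsilon> / 2" if "w > 0" for w using that by simp
    note this[OF den]
    finally show ?thesis .
  qed
  have small: "\<eta> * pair_const M + C * N h / c + 2 * N h \<le> \<epsilon>" if "N h \<le> \<delta>" for h
  proof -
    have "(C / c + 2) * N h \<le> (C / c + 2) * \<delta>" using that den by (intro mult_left_mono) auto
    moreover have "(C / c + 2) * N h = C * N h / c + 2 * N h" by (simp add: algebra_simps)
    ultimately have "C * N h / c + 2 * N h \<le> \<epsilon> / 2" using \<delta>C by linarith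
    then show ?thesis using \<eta>p by linarith
  qed
  show "\<exists>\<delta>>0. \<forall>u\<in>E. \<forall>h\<in>E. N u \<le> M \<and> N h \<le> \<delta> \<longrightarrow> (\<forall>k\<in>E. \<bar>D (u + h) k - D u k\<bar> \<le> \<epsilon> * N k)"
  proof (rule exI[of _ \<delta>], intro conjI \<delta> ballI impI)
    fix u h k assume "u \<in> E" "h \<in> E" "k \<in> E" and uh: "N u \<le> M \<and> N h \<le> \<delta>"
    then have u: "inE K V u" and h: "inE K V h" and k: "inE K V k" by (auto simp: E_def)
    note [measurable] = inE_measurable[OF u] inE_measurable[OF h]
    have uhE: "inE K V (u + h)" using inE_lin[OF u h, of 1 1] by (simp add: plus_fun_def)
    define g where "g x = f (u x + h x) - f (u x)" for x
    have gm: "g \<in> borel_measurable lebesgue" unfolding g_def by measurable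
    have gb: "\<bar>g x\<bar> \<le> \<eta> * (2 * (\<bar>u x\<bar> + \<bar>h x\<bar>) + 2 * (\<bar>u x\<bar> + \<bar>h x\<bar>) powr (q - 1)) + C * \<bar>h x\<bar>" for x
      unfolding g_def by (rule modulus_bound[OF C \<eta>]) simp
    have Nh: "N h \<le> 1" using uh \<delta> by simp
    note pr = pairing[OF u h k conjunct1[OF uh] Nh gm less_imp_le[OF \<eta>] C(1) gb]
    have "form (u + h) k = form u k + form h k"
      using form_lin[OF k u h, of 1 1] by (simp add: plus_fun_def form_sym[of k])
    moreover have "(\<integral>x. g x * k x \<partial>lebesgue) = (\<integral>x. f ((u + h) x) * k x \<partial>lebesgue) - (\<integral>x. f (u x) * k x \<partial>lebesgue)"
      using fu_pairing(1)[OF uhE k order_refl] fu_pairing(1)[OF u k order_refl]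
      by (simp add: g_def left_diff_distrib plus_fun_def)
    ultimately have "D (u + h) k - D u k = form h k - (\<integral>x. g x * k x \<partial>lebesgue)" by (simp add: D_def)
    moreover have "\<bar>\<integral>x. g x * k x \<partial>lebesgue\<bar> \<le> (\<eta> * pair_const M + C * N h / c) * N k"
      using order_trans[OF integral_abs_bound pr(2)] .
    moreover have "\<bar>form h k\<bar> \<le> N h * N k" by (rule form_Cauchy_Schwarz[OF h k])
    ultimately have "\<bar>D (u + h) k - D u k\<bar> \<le> (\<eta> * pair_const M + C * N h / c) * N k + N h * N k" by linarith
    also have "\<dots> = (\<eta> * pair_const M + C * N h / c + N h) * N k" by (simp add: algebra_simps)
    also have "\<dots> \<le> \<epsilon> * N k" using small[of h] uh N_nonneg[of h] by (intro mult_right_mono N_nonneg) linarith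
    finally show "\<bar>D (u + h) k - D u k\<bar> \<le> \<epsilon> * N k" .
  qed
  show "\<exists>\<delta>>0. \<forall>u\<in>E. \<forall>h\<in>E. N u \<le> M \<and> N h \<le> \<delta> \<longrightarrow> \<bar>J (u + h) - J u - D u h\<bar> \<le> \<epsilon> * N h"
  proof (rule exI[of _ \<delta>], intro conjI \<delta> ballI impI)
    fix u h assume "u \<in> E" "h \<in> E" and uh: "N u \<le> M \<and> N h \<le> \<delta>"
    then have u: "inE K V u" and h: "inE K V h" by (auto simp: E_def)
    note [measurable] = inE_measurable[OF u] inE_measurable[OF h]
    have uhE: "inE K V (u + h)" using inE_lin[OF u h, of 1 1] by (simp add: plus_fun_def)
    define G where "G x = prim f (u x + h x) - prim f (u x) - f (u x) * h x" for x
    \<comment> \<open>Dividing the remainder by \<open>h\<close> gives it the form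
      \<open>g * h\<close> that \<open>pairing\<close> handles with \<open>\<phi> = h\<close>; by
      the mean value theorem the quotient is bounded by an increment of \<open>f\<close>.\<close>
    define g where "g x = (if h x = 0 then 0 else G x / h x)" for x
    have gm: "g \<in> borel_measurable lebesgue" unfolding g_def G_def by measurable
    have gh: "g x * h x = G x" for x by (simp add: g_def G_def)
    have gb: "\<bar>g x\<bar> \<le> \<eta> * (2 * (\<bar>u x\<bar> + \<bar>h x\<bar>) + 2 * (\<bar>u x\<bar> + \<bar>h x\<bar>) powr (q - 1)) + C * \<bar>h x\<bar>" for x
    proof -
      obtain z where z: "\<bar>z - u x\<bar> \<le> \<bar>h x\<bar>" "prim f (u x + h x) - prim f (u x) = f z * h x" by (rule prim_MVT)
      have "\<bar>g x\<bar> \<le> \<bar>f z - f (u x)\<bar>" using z by (simp add: g_def G_def left_diff_distrib[symmetric])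
      also have "\<dots> \<le> \<eta> * (2 * (\<bar>u x\<bar> + \<bar>h x\<bar>) + 2 * (\<bar>u x\<bar> + \<bar>h x\<bar>) powr (q - 1)) + C * \<bar>h x\<bar>"
        by (rule modulus_bound[OF C \<eta> z(1)])
      finally show ?thesis .
    qed
    have Nh: "N h \<le> 1" using uh \<delta> by simp
    note pr = pairing[OF u h h conjunct1[OF uh] Nh gm less_imp_le[OF \<eta>] C(1) gb]
    have "form (u + h) (u + h) = form u u + 2 * form u h + form h h"
      using form_quadratic[OF u h, of 1 1] by (simp add: plus_fun_def)
    moreover have "(\<integral>x. G x \<partial>lebesgue) = (\<integral>x. prim f ((u + h) x) \<partial>lebesgue) - (\<integral>x. prim f (u x) \<partial>lebesgue) - (\<integral>x. f (u x) * h x \<partial>lebesgue)"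
      using prim_integrable[OF uhE] prim_integrable[OF u] fu_pairing(1)[OF u h order_refl]
      by (simp add: G_def plus_fun_def)
    ultimately have "J (u + h) - J u - D u h = form h h / 2 - (\<integral>x. G x \<partial>lebesgue)" unfolding J_def D_def by linarith
    moreover have "\<bar>\<integral>x. G x \<partial>lebesgue\<bar> \<le> (\<eta> * pair_const M + C * N h / c) * N h"
      using order_trans[OF integral_abs_bound pr(2)] unfolding gh .
    moreover have "form h h = N h * N h" using N_sq[of h] by (simp add: power2_eq_square)
    ultimately have "\<bar>J (u + h) - J u - D u h\<bar> \<le> N h * N h / 2 + (\<eta> * pair_const M + C * N h / c) * N h"
      using mult_nonneg_nonneg[OF N_nonneg[of h] N_nonneg[of h]] by linarith
    also have "\<dots> = (\<eta> * pair_const M + C * N h / c + N h / 2) * N h" by (simp add: algebra_simps)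
    also have "\<dots> \<le> \<epsilon> * N h" using small[of h] uh N_nonneg[of h] by (intro mult_right_mono N_nonneg) linarith
    finally show "\<bar>J (u + h) - J u - D u h\<bar> \<le> \<epsilon> * N h" .
  qed
qed

text \<open>At bounded energy the radial derivative is strongly negative for large norms, as
  \<open>theta > 2\<close>. This supplies the hypothesis \<open>outward\<close> of the mountain pass
  principle.\<close>

lemma AR_functional:
  assumes u: "inE K V u"
  shows "D u u \<le> theta * J u - (theta / 2 - 1) * (N u)\<^sup>2"
proof -
  have "theta * (\<integral>x. prim f (u x) \<partial>lebesgue) = (\<integral>x. theta * prim f (u x) \<partial>lebesgue)" by simp
  also have "\<dots> \<le> (\<integral>x. f (u x) * u x \<partial>lebesgue)"
    using AR_all prim_integrable[OF u] fu_pairing(1)[OF u u order_refl]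
    by (intro integral_mono) (auto simp: mult.commute)
  finally show ?thesis unfolding D_def J_def N_sq by (simp add: algebra_simps)
qed

text \<open>The height \<open>l\<close> makes the quadratic coefficient 1/8, and
  \<open>\<rho>\<close> does the same for the critical term because \<open>qs > 2\<close>. The total
  1/4 leaves \<open>J u \<ge> (N u)\<^sup>2 / 4\<close> on the ball.\<close>

lemma small_ball:
  obtains \<rho> where "0 < \<rho>" "\<rho> \<le> 1"
    "\<And>u. inE K V u \<Longrightarrow> N u \<le> \<rho> \<Longrightarrow> c0 * (\<integral>x. \<bar>u x\<bar> powr p \<partial>lebesgue) \<le> (N u)\<^sup>2 / 4"
proof -
  define l where "l = (c / (8 * c0)) powr (1 / (p - 2))"
  have l: "l > 0" using c_pos c0 by (simp add: l_def)
  have lp: "c0 * (l powr (p - 2) / c) = 1 / 8" using c_pos c0 p by (simp add: l_def powr_powr)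
  define A where "A = c0 * (Cp p * l powr (p - qs))"
  have A: "A > 0" using c0 Cp_pos[OF p_qs] l by (simp add: A_def)
  define \<rho> where "\<rho> = min 1 ((1 / (8 * A)) powr (1 / (qs - 2)))"
  have \<rho>: "\<rho> > 0" "\<rho> \<le> 1" using A by (auto simp: \<rho>_def)
  have A\<rho>: "A * \<rho> powr (qs - 2) \<le> 1 / 8"
  proof -
    have "\<rho> powr (qs - 2) \<le> ((1 / (8 * A)) powr (1 / (qs - 2))) powr (qs - 2)"
      using \<rho> tau by (intro powr_mono2) (auto simp: \<rho>_def)
    also have "\<dots> = 1 / (8 * A)" using A tau by (simp add: powr_powr)
    finally have "A * \<rho> powr (qs - 2) \<le> A * (1 / (8 * A))" using A by (intro mult_left_mono) auto
    then show ?thesis using A by simp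
  qed
  show thesis
  proof (rule that[OF \<rho>])
    fix u assume u: "inE K V u" and Nu: "N u \<le> \<rho>"
    have Nq: "N u powr qs = N u powr (qs - 2) * (N u)\<^sup>2"
      by (rule powr_eq_times_square[OF N_nonneg])
    have "c0 * (\<integral>x. \<bar>u x\<bar> powr p \<partial>lebesgue) \<le> c0 * (l powr (p - 2) / c * (N u)\<^sup>2 + Cp p * l powr (p - qs) * N u powr qs)"
      using c0 p by (intro mult_left_mono Lp_le_N u p_qs l) auto
    also have "\<dots> = c0 * (l powr (p - 2) / c) * (N u)\<^sup>2 + A * N u powr (qs - 2) * (N u)\<^sup>2"
      unfolding Nq A_def by (simp add: algebra_simps)
    also have "\<dots> \<le> 1 / 8 * (N u)\<^sup>2 + 1 / 8 * (N u)\<^sup>2"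
    proof (intro add_mono mult_right_mono)
      have "A * N u powr (qs - 2) \<le> A * \<rho> powr (qs - 2)"
        using A Nu N_nonneg[of u] tau by (intro mult_left_mono powr_mono2) auto
      then show "A * N u powr (qs - 2) \<le> 1 / 8" using A\<rho> by linarith
    qed (use lp in auto)
    finally show "c0 * (\<integral>x. \<bar>u x\<bar> powr p \<partial>lebesgue) \<le> (N u)\<^sup>2 / 4" by simp
  qed
qed

lemma prim_integral_le:
  assumes u: "inE K V u"
  shows "\<bar>\<integral>x. prim f (u x) \<partial>lebesgue\<bar> \<le> c0 * (\<integral>x. \<bar>u x\<bar> powr p \<partial>lebesgue)"
proof -
  have "\<bar>\<integral>x. prim f (u x) \<partial>lebesgue\<bar> \<le> (\<integral>x. \<bar>prim f (u x)\<bar> \<partial>lebesgue)" by (rule integral_abs_bound)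
  also have "\<dots> \<le> (\<integral>x. c0 * \<bar>u x\<bar> powr p \<partial>lebesgue)"
    using prim_integrable[OF u] Lp_int[OF u _ p_qs] p prim_growth by (intro integral_mono) auto
  finally show ?thesis by simp
qed

end

section \<open>The test function\<close>

text \<open>Lipschitz, hence compatible with the singularity of \<open>K\<close> that (K3) allows,
  and supported where (V2) bounds the potential.\<close>

definition bump :: "'a::euclidean_space \<Rightarrow> real" where "bump x = max 0 (1 - norm x)"

lemma bump_bounds: "0 \<le> bump x" "bump x \<le> 1" by (auto simp: bump_def)

lemma bump_outside: "x \<notin> ball 0 1 \<Longrightarrow> bump x = 0" by (auto simp: bump_def)

lemma bump_half: "x \<in> ball 0 (1/2) \<Longrightarrow> 1 / 2 \<le> bump x" by (auto simp: bump_def)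

lemma bump_Lipschitz: "\<bar>bump x - bump y\<bar> \<le> norm (x - y)"
proof -
  have "\<bar>norm x - norm y\<bar> \<le> norm (x - y)" by (rule norm_triangle_ineq3)
  then show ?thesis unfolding bump_def by linarith
qed

lemma bump_borel_measurable: "bump \<in> borel_measurable borel"
  unfolding bump_def by (intro borel_measurable_continuous_onI continuous_intros)

lemma bump_measurable: "bump \<in> borel_measurable lebesgue"
  using bump_borel_measurable by (intro measurable_completion) simp

lemma bump_sq_integrable: "integrable lebesgue (\<lambda>x :: 'a::euclidean_space. (bump x)\<^sup>2)"
proof (rule Bochner_Integration.integrable_bound[of _ "indicator (ball 0 1)"])
  show "integrable lebesgue (indicator (ball 0 1) :: 'a \<Rightarrow> real)"
    by (intro integrable_real_indicator) (auto simp: emeasure_ball)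
  show "(\<lambda>x::'a. (bump x)\<^sup>2) \<in> borel_measurable lebesgue" using bump_measurable by measurable
  show "AE x::'a in lebesgue. norm ((bump x)\<^sup>2) \<le> norm (indicator (ball 0 1) x :: real)"
  proof (rule AE_I2)
    fix x :: 'a
    show "norm ((bump x)\<^sup>2) \<le> norm (indicator (ball 0 1) x :: real)"
      using bump_outside[of x] bump_bounds[of x] by (cases "x \<in> ball 0 1") (simp_all add: power_le_one)
  qed
qed

text \<open>The cases \<open>r = -1\<close> and \<open>r = 1\<close> serve the integration of
  \<open>k (x - y)\<close> in \<open>y\<close> and in \<open>x\<close>.\<close>

lemma nn_integral_lborel_shift:
  fixes k :: "'a::euclidean_space \<Rightarrow> ennreal"
  assumes [measurable]: "k \<in> borel_measurable borel" and r: "\<bar>r\<bar> = 1"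
  shows "(\<integral>\<^sup>+ y. k (x + r *\<^sub>R y) \<partial>lborel) = (\<integral>\<^sup>+ y. k y \<partial>lborel)"
proof -
  have "(\<integral>\<^sup>+ y. k y \<partial>lborel) = (\<integral>\<^sup>+ y. k y \<partial>density (distr lborel borel (\<lambda>y. x + r *\<^sub>R y)) (\<lambda>_. \<bar>r\<bar> ^ DIM('a)))"
    using r by (subst lborel_affine[of r x]) auto
  also have "\<dots> = (\<integral>\<^sup>+ y. k (x + r *\<^sub>R y) \<partial>lborel)"
    using r by (simp add: nn_integral_density nn_integral_distr)
  finally show ?thesis by simp
qed

context kernel begin

text \<open>The squared increment is at most \<open>min (|x - y|^2) 1\<close> and vanishes unless
  one of the points lies in the unit ball. Each of the two possibilities contributes at most the
  volume of that ball times the integral in (K3).\<close>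

lemma bump_inX:
  assumes K3: "integrable lebesgue (\<lambda>x. min ((norm x)\<^sup>2) 1 * K x)"
  shows "inX K bump"
proof -
  let ?k = "\<lambda>x. min ((norm x)\<^sup>2) 1 * K x"
  let ?B = "ball 0 1 :: 'a set"
  obtain k where k[measurable]: "k \<in> borel_measurable borel" and kk: "AE x in lebesgue. ?k x = k x"
    using AE_lebesgue_eq_borel[OF borel_measurable_integrable[OF K3]] .
  have "(\<integral>\<^sup>+ x. ennreal (k x) \<partial>lebesgue) = (\<integral>\<^sup>+ x. ennreal (?k x) \<partial>lebesgue)"
    by (rule nn_integral_cong_AE) (use kk in \<open>eventually_elim, simp\<close>)
  also have "\<dots> < \<infinity>"
    using integrableD(2)[OF K3] less_imp_le[OF K_pos] by (simp add: abs_mult less_top)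
  finally have fin: "(\<integral>\<^sup>+ x. ennreal (k x) \<partial>lborel) < \<infinity>" by (simp only: nn_integral_completion)
  define I where "I = (\<integral>\<^sup>+ x. ennreal (k x) \<partial>lborel)"
  have B: "emeasure lborel ?B < \<infinity>" by (simp add: emeasure_ball)
  have [measurable]: "?B \<in> sets borel" by simp
  have m1: "(\<lambda>z. indicator ?B (fst z) * ennreal (k (fst z - snd z))) \<in> borel_measurable (lborel \<Otimes>\<^sub>M lborel)"
    and m2: "(\<lambda>z. indicator ?B (snd z) * ennreal (k (fst z - snd z))) \<in> borel_measurable (lborel \<Otimes>\<^sub>M lborel)"
    by measurable
  have 1: "(\<integral>\<^sup>+ z. indicator ?B (fst z) * ennreal (k (fst z - snd z)) \<partial>(lborel :: ('a \<times> 'a) measure)) < \<infinity>"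
  proof -
    have "(\<integral>\<^sup>+ z. indicator ?B (fst z) * ennreal (k (fst z - snd z)) \<partial>(lborel :: ('a \<times> 'a) measure)) =
        (\<integral>\<^sup>+ x. \<integral>\<^sup>+ y. indicator ?B x * ennreal (k (x - y)) \<partial>lborel \<partial>lborel)"
      unfolding lborel_prod[symmetric] by (subst lborel.nn_integral_fst[symmetric, OF m1]) simp
    also have "\<dots> = (\<integral>\<^sup>+ x. indicator ?B x * I \<partial>lborel)"
    proof (intro nn_integral_cong)
      fix x :: 'a
      have "(\<integral>\<^sup>+ y. ennreal (k (x - y)) \<partial>lborel) = I"
        unfolding I_def using nn_integral_lborel_shift[of "\<lambda>y. ennreal (k y)" "-1" x] by simp
      then show "(\<integral>\<^sup>+ y. indicator ?B x * ennreal (k (x - y)) \<partial>lborel) = indicator ?B x * I"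
        by (simp add: nn_integral_cmult)
    qed
    also have "\<dots> = emeasure lborel ?B * I" by (subst nn_integral_multc) auto
    finally show ?thesis using B fin by (simp add: I_def ennreal_mult_less_top)
  qed
  have 2: "(\<integral>\<^sup>+ z. indicator ?B (snd z) * ennreal (k (fst z - snd z)) \<partial>(lborel :: ('a \<times> 'a) measure)) < \<infinity>"
  proof -
    have "(\<integral>\<^sup>+ z. indicator ?B (snd z) * ennreal (k (fst z - snd z)) \<partial>(lborel :: ('a \<times> 'a) measure)) =
        (\<integral>\<^sup>+ y. \<integral>\<^sup>+ x. indicator ?B y * ennreal (k (x - y)) \<partial>lborel \<partial>lborel)"
      unfolding lborel_prod[symmetric] by (subst lborel_pair.nn_integral_snd[symmetric]) (use m2 in \<open>auto simp: case_prod_beta\<close>)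
    also have "\<dots> = (\<integral>\<^sup>+ y. indicator ?B y * I \<partial>lborel)"
    proof (intro nn_integral_cong)
      fix y :: 'a
      have "(\<integral>\<^sup>+ x. ennreal (k (x - y)) \<partial>lborel) = I"
        unfolding I_def using nn_integral_lborel_shift[of "\<lambda>y. ennreal (k y)" 1 "- y"] by simp
      then show "(\<integral>\<^sup>+ x. indicator ?B y * ennreal (k (x - y)) \<partial>lborel) = indicator ?B y * I"
        by (simp add: nn_integral_cmult)
    qed
    also have "\<dots> = emeasure lborel ?B * I" by (subst nn_integral_multc) auto
    finally show ?thesis using B fin by (simp add: I_def ennreal_mult_less_top)
  qed
  have "(\<integral>\<^sup>+ z. ennreal (kform_integrand K bump bump z) \<partial>lebesgue) \<le>
      (\<integral>\<^sup>+ z. indicator ?B (fst z) * ennreal (k (fst z - snd z)) + indicator ?B (snd z) * ennreal (k (fst z - snd z)) \<partial>lebesgue)"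
  proof (rule nn_integral_mono_AE)
    have "AE z in lebesgue. ?k (fst z - snd z) = k (fst z - snd z)" by (rule AE_lebesgue_diff[OF kk])
    then show "AE z in lebesgue. ennreal (kform_integrand K bump bump z) \<le>
        indicator ?B (fst z) * ennreal (k (fst z - snd z)) + indicator ?B (snd z) * ennreal (k (fst z - snd z))"
    proof eventually_elim
      case (elim z)
      show ?case
      proof (cases "fst z \<in> ?B \<or> snd z \<in> ?B")
        case True
        have "\<bar>bump (fst z) - bump (snd z)\<bar> \<le> norm (fst z - snd z)" by (rule bump_Lipschitz)
        then have "(bump (fst z) - bump (snd z))\<^sup>2 \<le> (norm (fst z - snd z))\<^sup>2"
          using power_mono[of "\<bar>bump (fst z) - bump (snd z)\<bar>" _ 2] by simp
        moreover have "\<bar>bump (fst z) - bump (snd z)\<bar> \<le> 1"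
          using bump_bounds[of "fst z"] bump_bounds[of "snd z"] by linarith
        then have "(bump (fst z) - bump (snd z))\<^sup>2 \<le> 1"
          using power_mono[of "\<bar>bump (fst z) - bump (snd z)\<bar>" 1 2] by simp
        ultimately have "(bump (fst z) - bump (snd z))\<^sup>2 * K (fst z - snd z) \<le> ?k (fst z - snd z)"
          using K_pos[of "fst z - snd z"] by (intro mult_right_mono) auto
        then have le: "ennreal (kform_integrand K bump bump z) \<le> ennreal (k (fst z - snd z))"
          using elim by (intro ennreal_leI) (simp add: kform_integrand_def power2_eq_square)
        show ?thesis
        proof (cases "fst z \<in> ?B")
          case True then show ?thesis using le by (auto intro: add_increasing2 order_trans[OF le])
        next
          case False
          then have "snd z \<in> ?B" using \<open>fst z \<in> ?B \<or> snd z \<in> ?B\<close> by blast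
          then show ?thesis using le False by auto
        qed
      next
        case False
        then have "kform_integrand K bump bump z = 0" by (simp add: kform_integrand_def bump_outside)
        then show ?thesis by simp
      qed
    qed
  qed
  also have "\<dots> = (\<integral>\<^sup>+ z. indicator ?B (fst z) * ennreal (k (fst z - snd z)) + indicator ?B (snd z) * ennreal (k (fst z - snd z)) \<partial>(lborel :: ('a \<times> 'a) measure))"
    by (rule nn_integral_completion)
  also have "\<dots> = (\<integral>\<^sup>+ z. indicator ?B (fst z) * ennreal (k (fst z - snd z)) \<partial>(lborel :: ('a \<times> 'a) measure)) +
      (\<integral>\<^sup>+ z. indicator ?B (snd z) * ennreal (k (fst z - snd z)) \<partial>(lborel :: ('a \<times> 'a) measure))"
    unfolding lborel_prod[symmetric] by (intro nn_integral_add m1 m2)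
  also have "\<dots> < \<infinity>" using 1 2 by (simp add: less_top)
  finally show ?thesis using bump_measurable bump_sq_integrable by (simp add: inX_def)
qed

end

section \<open>Energy along a ray\<close>

text \<open>A crude bound for \<open>A / 2 * t\<^sup>2 - B * t powr theta\<close>: past the point
  where \<open>B * t powr (theta - 2) = A / 2\<close> it is nonpositive, before that the first term
  alone is estimated. The 2 enters because the second term is available only for
  \<open>t \<ge> 2\<close>.\<close>

definition ray_bound :: "real \<Rightarrow> real \<Rightarrow> real \<Rightarrow> real" where
  "ray_bound A B theta = A / 2 * (max 2 ((A / (2 * B)) powr (1 / (theta - 2))))\<^sup>2"

lemma ray_bound:
  assumes A: "A > 0" and B: "B > 0" and theta: "theta > 2" and t: "t \<ge> 0"
    and y: "y \<le> A / 2 * t\<^sup>2" "t \<ge> 2 \<Longrightarrow> y \<le> A / 2 * t\<^sup>2 - B * t powr theta"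
  shows "y \<le> ray_bound A B theta"
proof -
  define t0 where "t0 = (A / (2 * B)) powr (1 / (theta - 2))"
  have t0: "t0 > 0" using A B by (simp add: t0_def)
  show ?thesis
  proof (cases "t \<le> max 2 t0")
    case True
    have "A / 2 * t\<^sup>2 \<le> A / 2 * (max 2 t0)\<^sup>2" using True t A by (intro mult_left_mono power_mono) auto
    then show ?thesis using y by (simp add: ray_bound_def t0_def)
  next
    case False
    have "A / 2 = B * t0 powr (theta - 2)" using A B theta by (simp add: t0_def powr_powr)
    also have "\<dots> \<le> B * t powr (theta - 2)" using False B t0 theta by (intro mult_left_mono powr_mono2) auto
    finally have "A / 2 * t\<^sup>2 \<le> B * t powr (theta - 2) * t\<^sup>2" by (intro mult_right_mono) auto
    also have "\<dots> = B * t powr theta" using powr_eq_times_square[OF t, of theta] by simp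
    finally have "A / 2 * t\<^sup>2 \<le> B * t powr theta" .
    moreover have "y \<le> A / 2 * t\<^sup>2 - B * t powr theta" using False by (intro y) simp
    ultimately have "y \<le> 0" by linarith
    also have "0 \<le> ray_bound A B theta" using A by (simp add: ray_bound_def)
    finally show ?thesis .
  qed
qed

section \<open>Fatou's lemma, contractions and the negative part\<close>

lemma Fatou_bound:
  fixes g :: "nat \<Rightarrow> 'b \<Rightarrow> real"
  assumes [measurable]: "\<And>k. g k \<in> borel_measurable M" and lim: "AE x in M. (\<lambda>k. g k x) \<longlonglongrightarrow> h x"
    and bd: "\<And>k. (\<integral>\<^sup>+ x. ennreal (g k x) \<partial>M) \<le> B"
  shows "(\<integral>\<^sup>+ x. ennreal (h x) \<partial>M) \<le> B"
proof -
  have "(\<integral>\<^sup>+ x. ennreal (h x) \<partial>M) = (\<integral>\<^sup>+ x. liminf (\<lambda>k. ennreal (g k x)) \<partial>M)"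
  proof (rule nn_integral_cong_AE)
    show "AE x in M. ennreal (h x) = liminf (\<lambda>k. ennreal (g k x))"
      using lim
    proof eventually_elim
      case (elim x)
      then have "(\<lambda>k. ennreal (g k x)) \<longlonglongrightarrow> ennreal (h x)" by (rule tendsto_ennrealI)
      then show ?case by (intro lim_imp_Liminf[symmetric]) auto
    qed
  qed
  also have "\<dots> \<le> liminf (\<lambda>k. \<integral>\<^sup>+ x. ennreal (g k x) \<partial>M)" by (rule nn_integral_liminf) auto
  also have "\<dots> \<le> liminf (\<lambda>k. B)" by (intro Liminf_mono always_eventually allI bd)
  also have "\<dots> = B" by (simp add: Liminf_const)
  finally show ?thesis .
qed

context kernel_potential begin

text \<open>All three integrands decrease pointwise. Needed to test with the negative part.\<close>

lemma inE_contraction: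
  assumes v: "inE K V v" and g[measurable]: "g \<in> borel_measurable lebesgue"
    and le: "\<And>x. \<bar>g x\<bar> \<le> \<bar>v x\<bar>" "\<And>x y. \<bar>g x - g y\<bar> \<le> \<bar>v x - v y\<bar>"
  shows "inE K V g"
proof -
  have sq: "(g x)\<^sup>2 \<le> (v x)\<^sup>2" "(g x - g y)\<^sup>2 \<le> (v x - v y)\<^sup>2" for x y
    using le(1)[of x] le(2)[of x y] by (simp_all add: abs_le_square_iff)
  have "integrable lebesgue (\<lambda>x. (g x)\<^sup>2)"
    by (rule Bochner_Integration.integrable_bound[OF inE_sq_integrable[OF v]]) (use sq in auto)
  moreover have "integrable lebesgue (kform_integrand K g g)"
  proof (rule Bochner_Integration.integrable_bound[OF inX_integrable[OF inE_inX[OF v]] kform_integrand_measurable[OF g g]])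
    show "AE z in lebesgue. norm (kform_integrand K g g z) \<le> norm (kform_integrand K v v z)"
    proof (rule AE_I2)
      fix z
      have "(g (fst z) - g (snd z))\<^sup>2 * K (fst z - snd z) \<le> (v (fst z) - v (snd z))\<^sup>2 * K (fst z - snd z)"
        using K_pos[of "fst z - snd z"] by (intro mult_right_mono sq) auto
      then have "kform_integrand K g g z \<le> kform_integrand K v v z" by (simp add: kform_integrand_def power2_eq_square)
      then show "norm (kform_integrand K g g z) \<le> norm (kform_integrand K v v z)"
        using kform_integrand_nonneg[of g z] kform_integrand_nonneg[of v z] by simp
    qed
  qed
  moreover have "integrable lebesgue (\<lambda>x. V x * (g x)\<^sup>2)"
  proof (rule Bochner_Integration.integrable_bound[OF inE_V_integrable[OF v]])
    show "AE x in lebesgue. norm (V x * (g x)\<^sup>2) \<le> norm (V x * (v x)\<^sup>2)"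
    proof (rule AE_I2)
      fix x show "norm (V x * (g x)\<^sup>2) \<le> norm (V x * (v x)\<^sup>2)"
        using V_pos[of x] sq(1)[of x] by (simp add: abs_mult)
    qed
  qed measurable
  ultimately show ?thesis using g by (simp add: inE_iff inX_iff)
qed

text \<open>Write \<open>v\<close> as its positive part minus \<open>n\<close>. The product of the
  increments of the two parts is never positive, because at each point one of them vanishes; what
  remains is minus the square of the increment of \<open>n\<close>.\<close>

lemma negative_part_form:
  assumes v: "inE K V v"
  defines "n \<equiv> (\<lambda>x. max 0 (- v x))"
  shows "inE K V n" "form v n \<le> - form n n"
proof -
  note [measurable] = inE_measurable[OF v]
  show n: "inE K V n"
  proof (rule inE_contraction[OF v])
    show "n \<in> borel_measurable lebesgue" unfolding n_def by measurable
  qed (auto simp: n_def max_def)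
  have pt: "(a - b) * (max 0 (-a) - max 0 (-b)) \<le> - (max 0 (-a) - max 0 (-b))\<^sup>2" for a b :: real
  proof (cases "a \<ge> 0"; cases "b \<ge> 0")
    assume "\<not> a \<ge> 0" "b \<ge> 0"
    then have "0 \<le> (- a) * b" by (intro mult_nonneg_nonneg) auto
    then show ?thesis using \<open>\<not> a \<ge> 0\<close> \<open>b \<ge> 0\<close> by (simp add: max_def power2_eq_square algebra_simps)
  next
    assume "a \<ge> 0" "\<not> b \<ge> 0"
    then have "0 \<le> a * (- b)" by (intro mult_nonneg_nonneg) auto
    then show ?thesis using \<open>a \<ge> 0\<close> \<open>\<not> b \<ge> 0\<close> by (simp add: max_def power2_eq_square algebra_simps)
  qed (auto simp: max_def power2_eq_square algebra_simps)
  have "kform K v n \<le> (\<integral>z. - kform_integrand K n n z \<partial>lebesgue)"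
    unfolding kform_def
  proof (rule integral_mono)
    show "integrable lebesgue (kform_integrand K v n)" by (rule kform_integrable[OF inE_inX[OF v] inE_inX[OF n]])
    show "integrable lebesgue (\<lambda>z. - kform_integrand K n n z)" using inX_integrable[OF inE_inX[OF n]] by simp
    fix z
    have "(v (fst z) - v (snd z)) * (n (fst z) - n (snd z)) * K (fst z - snd z) \<le> - (n (fst z) - n (snd z))\<^sup>2 * K (fst z - snd z)"
      unfolding n_def by (intro mult_right_mono pt less_imp_le K_pos)
    then show "kform_integrand K v n z \<le> - kform_integrand K n n z"
      by (simp add: kform_integrand_def power2_eq_square)
  qed
  moreover have "(\<integral>x. V x * v x * n x \<partial>lebesgue) = (\<integral>x. - (V x * n x * n x) \<partial>lebesgue)"
    by (intro Bochner_Integration.integral_cong) (auto simp: n_def max_def)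
  ultimately show "form v n \<le> - form n n" by (simp add: form_def kform_def)
qed

lemma AE_zero_if_N_zero:
  assumes u: "inE K V u" and "N u = 0"
  shows "AE x in lebesgue. u x = 0"
proof -
  have "(\<integral>x. (u x)\<^sup>2 \<partial>lebesgue) \<le> 0" using L2_le_N[OF u] assms by simp
  moreover have "0 \<le> (\<integral>x. (u x)\<^sup>2 \<partial>lebesgue)" by simp
  ultimately have "(\<integral>x. (u x)\<^sup>2 \<partial>lebesgue) = 0" by linarith
  then have "AE x in lebesgue. (u x)\<^sup>2 = 0"
    using integral_nonneg_eq_0_iff_AE[OF inE_sq_integrable[OF u]] by simp
  then show ?thesis by simp
qed

lemma bump_inE:
  assumes X: "inX K bump" and Vinf: "\<And>x. x \<in> ball 0 1 \<Longrightarrow> V x \<le> Vinf"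
  shows "inE K V bump" "form bump bump \<le> kform K bump bump + Vinf * (\<integral>x. (bump (x::'a))\<^sup>2 \<partial>lebesgue)"
proof -
  have pw: "V x * (bump x)\<^sup>2 \<le> Vinf * (bump x)\<^sup>2" for x
    using Vinf[of x] bump_outside[of x] by (cases "x \<in> ball 0 1") (auto intro: mult_right_mono)
  note [measurable] = bump_measurable
  have int: "integrable lebesgue (\<lambda>x. V x * (bump x)\<^sup>2)"
  proof (rule Bochner_Integration.integrable_bound[of _ "\<lambda>x. Vinf * (bump x)\<^sup>2"])
    show "AE x in lebesgue. norm (V x * (bump x)\<^sup>2) \<le> norm (Vinf * (bump x)\<^sup>2)"
    proof (rule AE_I2)
      fix x show "norm (V x * (bump x)\<^sup>2) \<le> norm (Vinf * (bump x)\<^sup>2)"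
        using pw[of x] V_pos[of x] by (simp add: abs_mult) (smt (verit) mult_right_mono zero_le_power2)
    qed
    show "integrable lebesgue (\<lambda>x::'a. Vinf * (bump x)\<^sup>2)"
      by (intro integrable_mult_right bump_sq_integrable)
  qed measurable
  then show "inE K V bump" using X by (simp add: inE_iff)
  have "(\<integral>x. V x * bump x * bump x \<partial>lebesgue) = (\<integral>x. V x * (bump x)\<^sup>2 \<partial>lebesgue)" by (simp add: power2_eq_square mult.assoc)
  also have "\<dots> \<le> (\<integral>x. Vinf * (bump (x::'a))\<^sup>2 \<partial>lebesgue)"
    using int pw by (intro integral_mono integrable_mult_right bump_sq_integrable)
  finally show "form bump bump \<le> kform K bump bump + Vinf * (\<integral>x. (bump (x::'a))\<^sup>2 \<partial>lebesgue)" by (simp add: form_def)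
qed

end

section \<open>Limits of Palais-Smale sequences\<close>

lemma mult_le_weighted_squares:
  fixes x y \<epsilon> :: real
  assumes "\<epsilon> > 0"
  shows "\<bar>x * y\<bar> \<le> y\<^sup>2 / \<epsilon> + \<epsilon> * x\<^sup>2"
proof -
  have "\<bar>(sqrt \<epsilon> * x) * (y / sqrt \<epsilon>)\<bar> \<le> (sqrt \<epsilon> * x)\<^sup>2 + (y / sqrt \<epsilon>)\<^sup>2" by (rule abs_mult_le_squares)
  then show ?thesis using assms by (simp add: power_mult_distrib power_divide)
qed

text \<open>If \<open>b \<le> \<epsilon> * a\<close>, the second term suffices; otherwise
  \<open>a < b / \<epsilon>\<close> and the first one does.\<close>

lemma Young_powr_eps:
  fixes a b r \<epsilon> :: real
  assumes "a \<ge> 0" "b \<ge> 0" "r > 1" and \<epsilon>: "\<epsilon> > 0"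
  shows "a powr (r - 1) * b \<le> \<epsilon> powr (1 - r) * b powr r + \<epsilon> * a powr r"
proof (cases "b \<le> \<epsilon> * a")
  case True
  have "a powr (r - 1) * b \<le> a powr (r - 1) * (\<epsilon> * a)" using True by (intro mult_left_mono) auto
  also have "\<dots> = \<epsilon> * a powr r" using powr_mult_base[of a "r - 1"] assms by (simp add: mult_ac)
  finally show ?thesis by (rule order_trans) (simp add: assms)
next
  case False
  have "a powr (r - 1) * b \<le> (b / \<epsilon>) powr (r - 1) * b"
    using False assms by (intro mult_right_mono powr_mono2) (auto simp: field_simps)
  also have "\<dots> = \<epsilon> powr (1 - r) * (b powr (r - 1) * b)"
  proof -
    have "\<epsilon> powr (1 - r) = inverse (\<epsilon> powr (r - 1))" using powr_minus[of \<epsilon> "r - 1"] by simp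
    moreover have "(b / \<epsilon>) powr (r - 1) = b powr (r - 1) / \<epsilon> powr (r - 1)" using assms by (intro powr_divide)
    ultimately show ?thesis by (simp add: divide_inverse mult_ac)
  qed
  also have "b powr (r - 1) * b = b powr r" using powr_mult_base[of b "r - 1"] assms by (simp add: mult_ac)
  finally show ?thesis by (rule order_trans) (use \<epsilon> in simp)
qed

lemma powr_interpolate:
  fixes t p q \<epsilon> :: real
  assumes "t \<ge> 0" "0 < p" "p < q" and \<epsilon>: "\<epsilon> > 0"
  shows "t powr p \<le> (\<epsilon> powr (1 / (p - q))) powr p + \<epsilon> * t powr q"
proof (cases "t \<le> \<epsilon> powr (1 / (p - q))")
  case True
  then have "t powr p \<le> (\<epsilon> powr (1 / (p - q))) powr p" using assms by (intro powr_mono2) auto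
  then show ?thesis using \<epsilon> by (simp add: add_increasing2)
next
  case False
  define T where "T = \<epsilon> powr (1 / (p - q))"
  have T: "T > 0" "T < t" using False \<epsilon> by (auto simp: T_def)
  have "t powr p = t powr (p - q) * t powr q" by (simp add: powr_add[symmetric])
  also have "\<dots> \<le> T powr (p - q) * t powr q" using T assms by (intro mult_right_mono powr_mono2') auto
  also have "T powr (p - q) = \<epsilon>" using assms by (simp add: T_def powr_powr)
  finally show ?thesis by (simp add: add_increasing)
qed

context problem begin

text \<open>Membership in \<open>E\<close> is Fatou's lemma. In each of the three terms of the
  derivative \<open>dominated_up_to_small\<close> is applied with a density of bounded integral
  built from \<open>w k\<close> and \<open>v\<close>, and with a weighted density of
  \<open>\<phi>\<close> as majorant. So bounded norms and a.e. convergence suffice, without weak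
  convergence in \<open>E\<close>.\<close>

lemma weak_limit:
  fixes w :: "nat \<Rightarrow> 'a \<Rightarrow> real"
  assumes w: "\<And>k. inE K V (w k)" and Nw: "\<And>k. N (w k) \<le> B"
    and v_meas[measurable]: "v \<in> borel_measurable lebesgue" and lim: "AE x in lebesgue. (\<lambda>k. w k x) \<longlonglongrightarrow> v x"
  shows "inE K V v" "inE K V \<phi> \<Longrightarrow> (\<lambda>k. D (w k) \<phi>) \<longlonglongrightarrow> D v \<phi>"
proof -
  note wm[measurable] = inE_measurable[OF w]
  have B: "B \<ge> 0" using Nw[of 0] N_nonneg[of "w 0"] by linarith
  have NB: "(N (w k))\<^sup>2 \<le> B\<^sup>2" for k using Nw[of k] N_nonneg[of "w k"] by (intro power_mono) auto
  have limz: "AE z in lebesgue. (\<lambda>k. w k (fst z) - w k (snd z)) \<longlonglongrightarrow> v (fst z) - v (snd z)"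
    using AE_lebesgue_fst[OF lim] AE_lebesgue_snd[OF lim] by eventually_elim (rule tendsto_diff)
  have limk: "AE z in lebesgue. (\<lambda>k. kform_integrand K (w k) g z) \<longlonglongrightarrow> kform_integrand K v g z" for g
    using limz by eventually_elim (auto simp: kform_integrand_def intro!: tendsto_intros)
  have limkk: "AE z in lebesgue. (\<lambda>k. kform_integrand K (w k) (w k) z) \<longlonglongrightarrow> kform_integrand K v v z"
    using limz by eventually_elim (auto simp: kform_integrand_def intro!: tendsto_intros)
  show v: "inE K V v"
  proof -
    have "(\<integral>\<^sup>+ x. ennreal ((v x)\<^sup>2) \<partial>lebesgue) \<le> ennreal (B\<^sup>2 / c)"
    proof (rule Fatou_bound)
      show "AE x in lebesgue. (\<lambda>k. (w k x)\<^sup>2) \<longlonglongrightarrow> (v x)\<^sup>2" using lim by eventually_elim (intro tendsto_intros)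
      fix k
      have "(\<integral>\<^sup>+ x. ennreal ((w k x)\<^sup>2) \<partial>lebesgue) = ennreal (\<integral>x. (w k x)\<^sup>2 \<partial>lebesgue)"
        using inE_sq_integrable[OF w] by (intro nn_integral_eq_integral) auto
      also have "\<dots> \<le> ennreal (B\<^sup>2 / c)" using L2_le[OF w Nw] by (intro ennreal_leI)
      finally show "(\<integral>\<^sup>+ x. ennreal ((w k x)\<^sup>2) \<partial>lebesgue) \<le> ennreal (B\<^sup>2 / c)" .
    qed measurable
    then have 1: "integrable lebesgue (\<lambda>x. (v x)\<^sup>2)"
      by (intro integrableI_nonneg) (auto intro: le_less_trans)
    have 2: "(\<integral>\<^sup>+ z. ennreal (kform_integrand K v v z) \<partial>lebesgue) \<le> ennreal (B\<^sup>2)"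
    proof (rule Fatou_bound[OF _ limkk])
      fix k
      show "kform_integrand K (w k) (w k) \<in> borel_measurable lebesgue" by (rule kform_integrand_measurable[OF wm wm])
      have "(\<integral>\<^sup>+ z. ennreal (kform_integrand K (w k) (w k) z) \<partial>lebesgue) = ennreal (kform K (w k) (w k))"
        by (rule inX_nn_integral[OF inE_inX[OF w]])
      also have "\<dots> \<le> ennreal (B\<^sup>2)" using kform_le_N[of "w k"] NB[of k] by (intro ennreal_leI) linarith
      finally show "(\<integral>\<^sup>+ z. ennreal (kform_integrand K (w k) (w k) z) \<partial>lebesgue) \<le> ennreal (B\<^sup>2)" .
    qed
    have 3: "(\<integral>\<^sup>+ x. ennreal (V x * (v x)\<^sup>2) \<partial>lebesgue) \<le> ennreal (B\<^sup>2)"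
    proof (rule Fatou_bound)
      show "AE x in lebesgue. (\<lambda>k. V x * (w k x)\<^sup>2) \<longlonglongrightarrow> V x * (v x)\<^sup>2" using lim by eventually_elim (intro tendsto_intros)
      fix k
      have "(\<integral>\<^sup>+ x. ennreal (V x * (w k x)\<^sup>2) \<partial>lebesgue) = ennreal (\<integral>x. V x * (w k x)\<^sup>2 \<partial>lebesgue)"
        using inE_V_integrable[OF w] less_imp_le[OF V_pos] by (intro nn_integral_eq_integral) auto
      also have "(\<integral>x. V x * (w k x)\<^sup>2 \<partial>lebesgue) \<le> B\<^sup>2"
        using NB[of k] kform_nonneg[of "w k"] unfolding N_sq form_def by (simp add: power2_eq_square mult.assoc)
      then have "ennreal (\<integral>x. V x * (w k x)\<^sup>2 \<partial>lebesgue) \<le> ennreal (B\<^sup>2)" by (rule ennreal_leI)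
      finally show "(\<integral>\<^sup>+ x. ennreal (V x * (w k x)\<^sup>2) \<partial>lebesgue) \<le> ennreal (B\<^sup>2)" .
    qed measurable
    show ?thesis unfolding inE_def inX_def using v_meas 1 2 3 by (auto intro: le_less_trans)
  qed
  assume \<phi>: "inE K V \<phi>"
  note [measurable] = inE_measurable[OF \<phi>]
  have dE: "inE K V (\<lambda>x. 1 * w k x + (-1) * v x)" for k by (rule inE_lin[OF w v])
  let ?d = "\<lambda>k x. 1 * w k x + (-1) * v x"
  have kd: "kform K (?d k) (?d k) \<le> 2 * B\<^sup>2 + 2 * kform K v v" for k
    using inX_lin(2)[OF inE_inX[OF w] inE_inX[OF v], of 1 k "-1"] kform_le_N[of "w k"] NB[of k] by simp
  have 1: "(\<lambda>k. kform K (w k) \<phi>) \<longlonglongrightarrow> kform K v \<phi>"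
  proof -
    have "(\<lambda>k. \<integral>z. \<bar>kform_integrand K (?d k) \<phi> z\<bar> \<partial>lebesgue) \<longlonglongrightarrow> 0"
    proof (rule dominated_up_to_small(2)[where b = "\<lambda>k. kform_integrand K (?d k) (?d k)" and C = "2 * B\<^sup>2 + 2 * kform K v v"])
      show "(\<lambda>z. \<bar>kform_integrand K (?d k) \<phi> z\<bar>) \<in> borel_measurable lebesgue" for k
        using kform_integrand_measurable[OF inE_measurable[OF dE] inE_measurable[OF \<phi>]] by (rule borel_measurable_abs)
      have eq: "kform_integrand K (?d k) \<phi> z = kform_integrand K (w k) \<phi> z - kform_integrand K v \<phi> z" for k z
        by (simp add: kform_integrand_def algebra_simps)
      show "AE z in lebesgue. (\<lambda>k. \<bar>kform_integrand K (?d k) \<phi> z\<bar>) \<longlonglongrightarrow> 0"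
        using limk[of \<phi>] unfolding eq by eventually_elim (intro tendsto_rabs_zero, simp add: LIM_zero)
      show "integrable lebesgue (kform_integrand K (?d k) (?d k))" for k by (rule inX_integrable[OF inE_inX[OF dE]])
      show "(\<integral>z. kform_integrand K (?d k) (?d k) z \<partial>lebesgue) \<le> 2 * B\<^sup>2 + 2 * kform K v v" for k
        using kd[of k] by (simp add: kform_def)
      fix \<epsilon> :: real assume \<epsilon>: "\<epsilon> > 0"
      show "\<exists>W. integrable lebesgue W \<and> (\<forall>x. 0 \<le> W x) \<and> (\<forall>k z. \<bar>kform_integrand K (?d k) \<phi> z\<bar> \<le> W z + \<epsilon> * kform_integrand K (?d k) (?d k) z)"
      proof (intro exI[of _ "\<lambda>z. kform_integrand K \<phi> \<phi> z / \<epsilon>"] conjI allI)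
        show "integrable lebesgue (\<lambda>z. kform_integrand K \<phi> \<phi> z / \<epsilon>)" using inX_integrable[OF inE_inX[OF \<phi>]] by simp
        show "0 \<le> kform_integrand K \<phi> \<phi> z / \<epsilon>" for z using kform_integrand_nonneg[of \<phi> z] \<epsilon> by simp
        fix k z
        let ?x = "?d k (fst z) - ?d k (snd z)" and ?y = "\<phi> (fst z) - \<phi> (snd z)"
        have "\<bar>kform_integrand K (?d k) \<phi> z\<bar> = \<bar>?x * ?y\<bar> * K (fst z - snd z)"
          unfolding kform_integrand_def using K_pos[of "fst z - snd z"] by (simp add: abs_mult)
        also have "\<dots> \<le> (?y\<^sup>2 / \<epsilon> + \<epsilon> * ?x\<^sup>2) * K (fst z - snd z)"
          by (intro mult_right_mono mult_le_weighted_squares \<epsilon> less_imp_le K_pos)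
        also have "\<dots> = kform_integrand K \<phi> \<phi> z / \<epsilon> + \<epsilon> * kform_integrand K (?d k) (?d k) z"
          unfolding kform_integrand_def power2_eq_square distrib_right by simp
        finally show "\<bar>kform_integrand K (?d k) \<phi> z\<bar> \<le> kform_integrand K \<phi> \<phi> z / \<epsilon> + \<epsilon> * kform_integrand K (?d k) (?d k) z" .
      qed
    qed (auto intro: kform_integrand_nonneg)
    moreover have "\<bar>kform K (w k) \<phi> - kform K v \<phi>\<bar> \<le> (\<integral>z. \<bar>kform_integrand K (?d k) \<phi> z\<bar> \<partial>lebesgue)" for k
    proof -
      have "kform_integrand K (?d k) \<phi> z = kform_integrand K (w k) \<phi> z - kform_integrand K v \<phi> z" for z
        by (simp add: kform_integrand_def algebra_simps)
      then have "kform K (w k) \<phi> - kform K v \<phi> = (\<integral>z. kform_integrand K (?d k) \<phi> z \<partial>lebesgue)"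
        unfolding kform_def using kform_integrable[OF inE_inX[OF w] inE_inX[OF \<phi>]] kform_integrable[OF inE_inX[OF v] inE_inX[OF \<phi>]]
        by simp
      then show ?thesis using integral_abs_bound by simp
    qed
    ultimately have "(\<lambda>k. kform K (w k) \<phi> - kform K v \<phi>) \<longlonglongrightarrow> 0"
      by (intro Lim_null_comparison[OF _ \<open>_ \<longlonglongrightarrow> 0\<close>]) (auto intro!: always_eventually)
    then show ?thesis by (simp add: LIM_zero_iff)
  qed
  have 2: "(\<lambda>k. \<integral>x. V x * w k x * \<phi> x \<partial>lebesgue) \<longlonglongrightarrow> (\<integral>x. V x * v x * \<phi> x \<partial>lebesgue)"
  proof -
    have "(\<lambda>k. \<integral>x. \<bar>V x * (w k x - v x) * \<phi> x\<bar> \<partial>lebesgue) \<longlonglongrightarrow> 0"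
    proof (rule dominated_up_to_small(2)[where b = "\<lambda>k x. 2 * (V x * (w k x)\<^sup>2) + 2 * (V x * (v x)\<^sup>2)" and C = "2 * B\<^sup>2 + 2 * (N v)\<^sup>2"])
      show "(\<lambda>x. \<bar>V x * (w k x - v x) * \<phi> x\<bar>) \<in> borel_measurable lebesgue" for k by measurable
      show "AE x in lebesgue. (\<lambda>k. \<bar>V x * (w k x - v x) * \<phi> x\<bar>) \<longlonglongrightarrow> 0"
        using lim
      proof eventually_elim
        case (elim x)
        then have "(\<lambda>k. w k x - v x) \<longlonglongrightarrow> 0" by (rule LIM_zero)
        then show ?case by (intro tendsto_rabs_zero tendsto_mult_left_zero tendsto_mult_right_zero)
      qed
      show "integrable lebesgue (\<lambda>x. 2 * (V x * (w k x)\<^sup>2) + 2 * (V x * (v x)\<^sup>2))" for k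
        using inE_V_integrable[OF w] inE_V_integrable[OF v] by simp
      have Vle: "(\<integral>x. V x * (g x)\<^sup>2 \<partial>lebesgue) \<le> (N g)\<^sup>2" for g
        using kform_nonneg[of g] unfolding N_sq form_def by (simp add: power2_eq_square mult.assoc)
      show "(\<integral>x. 2 * (V x * (w k x)\<^sup>2) + 2 * (V x * (v x)\<^sup>2) \<partial>lebesgue) \<le> 2 * B\<^sup>2 + 2 * (N v)\<^sup>2" for k
        using inE_V_integrable[OF w[of k]] inE_V_integrable[OF v] Vle[of "w k"] Vle[of v] NB[of k] by simp
      show "0 \<le> 2 * (V x * (w k x)\<^sup>2) + 2 * (V x * (v x)\<^sup>2)" for k x using V_pos[of x] by simp
      fix \<epsilon> :: real assume \<epsilon>: "\<epsilon> > 0"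
      show "\<exists>W. integrable lebesgue W \<and> (\<forall>x. 0 \<le> W x) \<and> (\<forall>k x. \<bar>V x * (w k x - v x) * \<phi> x\<bar> \<le> W x + \<epsilon> * (2 * (V x * (w k x)\<^sup>2) + 2 * (V x * (v x)\<^sup>2)))"
      proof (intro exI[of _ "\<lambda>x. V x * (\<phi> x)\<^sup>2 / \<epsilon>"] conjI allI)
        show "integrable lebesgue (\<lambda>x. V x * (\<phi> x)\<^sup>2 / \<epsilon>)" using inE_V_integrable[OF \<phi>] by simp
        show "0 \<le> V x * (\<phi> x)\<^sup>2 / \<epsilon>" for x using V_pos[of x] \<epsilon> by simp
        fix k x
        have "\<bar>V x * (w k x - v x) * \<phi> x\<bar> = V x * \<bar>(w k x - v x) * \<phi> x\<bar>" using V_pos[of x] by (simp add: abs_mult)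
        also have "\<dots> \<le> V x * ((\<phi> x)\<^sup>2 / \<epsilon> + \<epsilon> * (w k x - v x)\<^sup>2)"
          by (intro mult_left_mono mult_le_weighted_squares \<epsilon> less_imp_le V_pos)
        also have "\<dots> \<le> V x * ((\<phi> x)\<^sup>2 / \<epsilon> + \<epsilon> * (2 * (w k x)\<^sup>2 + 2 * (v x)\<^sup>2))"
          using square_add_le[of "w k x" "- v x"] \<epsilon> V_pos[of x] by (intro mult_left_mono add_left_mono) auto
        also have "\<dots> = V x * (\<phi> x)\<^sup>2 / \<epsilon> + \<epsilon> * (2 * (V x * (w k x)\<^sup>2) + 2 * (V x * (v x)\<^sup>2))"
          by (simp add: algebra_simps)
        finally show "\<bar>V x * (w k x - v x) * \<phi> x\<bar> \<le> V x * (\<phi> x)\<^sup>2 / \<epsilon> + \<epsilon> * (2 * (V x * (w k x)\<^sup>2) + 2 * (V x * (v x)\<^sup>2))" .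
      qed
    qed auto
    moreover have "\<bar>(\<integral>x. V x * w k x * \<phi> x \<partial>lebesgue) - (\<integral>x. V x * v x * \<phi> x \<partial>lebesgue)\<bar> \<le> (\<integral>x. \<bar>V x * (w k x - v x) * \<phi> x\<bar> \<partial>lebesgue)" for k
    proof -
      have "(\<integral>x. V x * w k x * \<phi> x \<partial>lebesgue) - (\<integral>x. V x * v x * \<phi> x \<partial>lebesgue) = (\<integral>x. V x * (w k x - v x) * \<phi> x \<partial>lebesgue)"
        using Vuv_integrable[OF w \<phi>] Vuv_integrable[OF v \<phi>] by (simp add: right_diff_distrib left_diff_distrib)
      then show ?thesis using integral_abs_bound by simp
    qed
    ultimately have "(\<lambda>k. (\<integral>x. V x * w k x * \<phi> x \<partial>lebesgue) - (\<integral>x. V x * v x * \<phi> x \<partial>lebesgue)) \<longlonglongrightarrow> 0"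
      by (intro Lim_null_comparison[OF _ \<open>_ \<longlonglongrightarrow> 0\<close>]) (auto intro!: always_eventually)
    then show ?thesis by (simp add: LIM_zero_iff)
  qed
  have 3: "(\<lambda>k. \<integral>x. f (w k x) * \<phi> x \<partial>lebesgue) \<longlonglongrightarrow> (\<integral>x. f (v x) * \<phi> x \<partial>lebesgue)"
  proof -
    define C where "C = B\<^sup>2 / c + Cp p * B powr qs + (\<integral>x. \<bar>v x\<bar> powr p \<partial>lebesgue)"
    have p2: "2 \<le> p" using p by simp
    have "(\<lambda>k. \<integral>x. \<bar>(f (w k x) - f (v x)) * \<phi> x\<bar> \<partial>lebesgue) \<longlonglongrightarrow> 0"
    proof (rule dominated_up_to_small(2)[where b = "\<lambda>k x. \<bar>w k x\<bar> powr p + \<bar>v x\<bar> powr p" and C = C])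
      show "(\<lambda>x. \<bar>(f (w k x) - f (v x)) * \<phi> x\<bar>) \<in> borel_measurable lebesgue" for k by measurable
      show "AE x in lebesgue. (\<lambda>k. \<bar>(f (w k x) - f (v x)) * \<phi> x\<bar>) \<longlonglongrightarrow> 0"
        using lim
      proof eventually_elim
        case (elim x)
        have "(\<lambda>k. f (w k x)) \<longlonglongrightarrow> f (v x)"
          using f_cont elim by (intro continuous_on_tendsto_compose[OF f_cont]) auto
        then have "(\<lambda>k. f (w k x) - f (v x)) \<longlonglongrightarrow> 0" by (rule LIM_zero)
        then show ?case by (intro tendsto_rabs_zero tendsto_mult_left_zero)
      qed
      show "integrable lebesgue (\<lambda>x. \<bar>w k x\<bar> powr p + \<bar>v x\<bar> powr p)" for k
        using Lp_int[OF w p2 p_qs] Lp_int[OF v p2 p_qs] by simp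
      show "(\<integral>x. \<bar>w k x\<bar> powr p + \<bar>v x\<bar> powr p \<partial>lebesgue) \<le> C" for k
      proof -
        have "(\<integral>x. \<bar>w k x\<bar> powr p \<partial>lebesgue) \<le> (N (w k))\<^sup>2 / c + Cp p * N (w k) powr qs"
          using Lp_le_N[OF w p2 p_qs, of 1] by simp
        also have "\<dots> \<le> B\<^sup>2 / c + Cp p * B powr qs"
          using NB[of k] Nw[of k] N_nonneg[of "w k"] c_pos Cp_pos[OF p_qs] tau
          by (intro add_mono divide_right_mono mult_left_mono powr_mono2) auto
        finally show ?thesis using Lp_int[OF w[of k] p2 p_qs] Lp_int[OF v p2 p_qs] by (simp add: C_def)
      qed
      fix \<epsilon>' :: real assume \<epsilon>': "\<epsilon>' > 0"
      define \<epsilon> where "\<epsilon> = \<epsilon>' / c0"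
      have \<epsilon>: "\<epsilon> > 0" using \<epsilon>' c0 by (simp add: \<epsilon>_def)
      show "\<exists>W. integrable lebesgue W \<and> (\<forall>x. 0 \<le> W x) \<and> (\<forall>k x. \<bar>(f (w k x) - f (v x)) * \<phi> x\<bar> \<le> W x + \<epsilon>' * (\<bar>w k x\<bar> powr p + \<bar>v x\<bar> powr p))"
      proof (intro exI[of _ "\<lambda>x. 2 * c0 * \<epsilon> powr (1 - p) * \<bar>\<phi> x\<bar> powr p"] conjI allI)
        show "integrable lebesgue (\<lambda>x. 2 * c0 * \<epsilon> powr (1 - p) * \<bar>\<phi> x\<bar> powr p)" using Lp_int[OF \<phi> p2 p_qs] by simp
        show "0 \<le> 2 * c0 * \<epsilon> powr (1 - p) * \<bar>\<phi> x\<bar> powr p" for x using c0 by simp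
        fix k x
        have one: "\<bar>f t\<bar> * \<bar>\<phi> x\<bar> \<le> c0 * (\<epsilon> powr (1 - p) * \<bar>\<phi> x\<bar> powr p + \<epsilon> * \<bar>t\<bar> powr p)" for t
        proof -
          have "\<bar>f t\<bar> * \<bar>\<phi> x\<bar> \<le> c0 * \<bar>t\<bar> powr (p - 1) * \<bar>\<phi> x\<bar>" by (intro mult_right_mono growth) simp
          also have "\<dots> = c0 * (\<bar>t\<bar> powr (p - 1) * \<bar>\<phi> x\<bar>)" by simp
          also have "\<dots> \<le> c0 * (\<epsilon> powr (1 - p) * \<bar>\<phi> x\<bar> powr p + \<epsilon> * \<bar>t\<bar> powr p)"
            using c0 p \<epsilon> by (intro mult_left_mono Young_powr_eps) auto
          finally show ?thesis .
        qed
        have "\<bar>(f (w k x) - f (v x)) * \<phi> x\<bar> \<le> (\<bar>f (w k x)\<bar> + \<bar>f (v x)\<bar>) * \<bar>\<phi> x\<bar>"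
          unfolding abs_mult by (intro mult_right_mono) auto
        also have "\<dots> = \<bar>f (w k x)\<bar> * \<bar>\<phi> x\<bar> + \<bar>f (v x)\<bar> * \<bar>\<phi> x\<bar>" by (rule distrib_right)
        also have "\<dots> \<le> c0 * (\<epsilon> powr (1 - p) * \<bar>\<phi> x\<bar> powr p + \<epsilon> * \<bar>w k x\<bar> powr p) + c0 * (\<epsilon> powr (1 - p) * \<bar>\<phi> x\<bar> powr p + \<epsilon> * \<bar>v x\<bar> powr p)"
          by (intro add_mono one)
        also have "\<dots> = 2 * c0 * \<epsilon> powr (1 - p) * \<bar>\<phi> x\<bar> powr p + (c0 * \<epsilon>) * (\<bar>w k x\<bar> powr p + \<bar>v x\<bar> powr p)"
          by (simp add: algebra_simps)
        also have "c0 * \<epsilon> = \<epsilon>'" using c0 by (simp add: \<epsilon>_def)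
        finally show "\<bar>(f (w k x) - f (v x)) * \<phi> x\<bar> \<le> 2 * c0 * \<epsilon> powr (1 - p) * \<bar>\<phi> x\<bar> powr p + \<epsilon>' * (\<bar>w k x\<bar> powr p + \<bar>v x\<bar> powr p)" .
      qed
    qed auto
    moreover have "\<bar>(\<integral>x. f (w k x) * \<phi> x \<partial>lebesgue) - (\<integral>x. f (v x) * \<phi> x \<partial>lebesgue)\<bar> \<le> (\<integral>x. \<bar>(f (w k x) - f (v x)) * \<phi> x\<bar> \<partial>lebesgue)" for k
    proof -
      have "(\<integral>x. f (w k x) * \<phi> x \<partial>lebesgue) - (\<integral>x. f (v x) * \<phi> x \<partial>lebesgue) = (\<integral>x. (f (w k x) - f (v x)) * \<phi> x \<partial>lebesgue)"
        using fu_pairing(1)[OF w \<phi> order_refl] fu_pairing(1)[OF v \<phi> order_refl] by (simp add: left_diff_distrib)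
      then show ?thesis using integral_abs_bound by simp
    qed
    ultimately have "(\<lambda>k. (\<integral>x. f (w k x) * \<phi> x \<partial>lebesgue) - (\<integral>x. f (v x) * \<phi> x \<partial>lebesgue)) \<longlonglongrightarrow> 0"
      by (intro Lim_null_comparison[OF _ \<open>_ \<longlonglongrightarrow> 0\<close>]) (auto intro!: always_eventually)
    then show ?thesis by (simp add: LIM_zero_iff)
  qed
  show "(\<lambda>k. D (w k) \<phi>) \<longlonglongrightarrow> D v \<phi>"
    unfolding D_def form_def by (intro tendsto_diff tendsto_add 1 2 3)
qed

end

section \<open>Existence of a solution\<close>

lemma measure_half_ball_pos: "0 < measure lebesgue (ball 0 (1/2) :: 'a::euclidean_space set)"
  by simp

lemma bump_sq_integral_pos: "0 < (\<integral>x. (bump (x :: 'a::euclidean_space))\<^sup>2 \<partial>lebesgue)"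
proof -
  let ?B = "ball 0 (1/2) :: 'a set"
  have i: "integrable lebesgue (\<lambda>x. indicator ?B x * (1/4 :: real))"
    by (intro integrable_mult_left integrable_real_indicator) (auto simp: emeasure_ball)
  have "0 < measure lebesgue ?B * (1/4)" using measure_half_ball_pos by simp
  also have "\<dots> = (\<integral>x. indicator ?B x * (1/4) \<partial>lebesgue)" by simp
  also have "\<dots> \<le> (\<integral>x. (bump (x :: 'a))\<^sup>2 \<partial>lebesgue)"
  proof (rule integral_mono[OF i bump_sq_integrable])
    fix x :: 'a
    show "indicator ?B x * (1/4) \<le> (bump x)\<^sup>2"
    proof (cases "x \<in> ?B")
      case True
      have "(1/2)\<^sup>2 \<le> (bump x)\<^sup>2" using bump_half[OF True] by (intro power_mono) auto
      then show ?thesis using True by (simp add: power2_eq_square)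
    qed simp
  qed
  finally show ?thesis .
qed

context problem begin

text \<open>On the ball of radius 1/2 the bump is at least 1/2, so for \<open>t \<ge> 2\<close> its
  multiple is at least 1 there and \<open>prim_superquadratic\<close> applies.\<close>

lemma J_ray:
  assumes X: "inX K bump" and Vinf: "Vinf > 0" "\<And>x. x \<in> ball 0 1 \<Longrightarrow> V x \<le> Vinf" and t: "t \<ge> 0"
  shows "J (t *\<^sub>R bump) \<le> ray_bound (kform K bump bump + Vinf * (\<integral>x. (bump (x :: 'a))\<^sup>2 \<partial>lebesgue))
    (measure lebesgue (ball 0 (1/2) :: 'a set) * prim f 1 * (1/2) powr theta) theta"
proof (rule ray_bound[OF _ _ theta t])
  let ?A = "kform K bump bump + Vinf * (\<integral>x. (bump (x :: 'a))\<^sup>2 \<partial>lebesgue)"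
  let ?B = "ball 0 (1/2) :: 'a set"
  define \<mu> where "\<mu> = measure lebesgue ?B"
  show "?A > 0" using kform_nonneg[of bump] Vinf bump_sq_integral_pos[where ?'a = 'a] by (intro add_nonneg_pos) auto
  show "measure lebesgue ?B * prim f 1 * (1/2) powr theta > 0"
    using measure_half_ball_pos[where ?'a = 'a] prim_1_pos by (intro mult_pos_pos) auto
  note bE = bump_inE[OF X Vinf(2)]
  have tE: "inE K V (t *\<^sub>R bump)" using inE_lin[OF bE(1) bE(1), of t 0] by (simp add: scaleR_fun_def)
  have "form (t *\<^sub>R bump) (t *\<^sub>R bump) = t\<^sup>2 * form bump bump"
    using form_quadratic[OF bE(1) bE(1), of t 0] by (simp add: scaleR_fun_def)
  also have "\<dots> \<le> t\<^sup>2 * ?A" using bE(2) by (intro mult_left_mono) auto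
  finally have q: "form (t *\<^sub>R bump) (t *\<^sub>R bump) / 2 \<le> ?A / 2 * t\<^sup>2" by (simp add: mult.commute)
  have "0 \<le> (\<integral>x. prim f ((t *\<^sub>R bump) (x::'a)) \<partial>lebesgue)" using prim_nonneg by (intro integral_nonneg_AE AE_I2)
  then show "J (t *\<^sub>R bump) \<le> ?A / 2 * t\<^sup>2" using q unfolding J_def by linarith
  assume t2: "t \<ge> 2"
  have i: "integrable lebesgue (\<lambda>x. indicator ?B x * (prim f 1 * (t / 2) powr theta))"
    by (intro integrable_mult_left integrable_real_indicator) (auto simp: emeasure_ball)
  have "\<mu> * (prim f 1 * (t / 2) powr theta) = (\<integral>x. indicator ?B x * (prim f 1 * (t / 2) powr theta) \<partial>lebesgue)"
    by (simp add: \<mu>_def)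
  also have "\<dots> \<le> (\<integral>x. prim f ((t *\<^sub>R bump) (x::'a)) \<partial>lebesgue)"
  proof (rule integral_mono[OF i prim_integrable[OF tE]])
    fix x :: 'a
    show "indicator ?B x * (prim f 1 * (t / 2) powr theta) \<le> prim f ((t *\<^sub>R bump) x)"
    proof (cases "x \<in> ?B")
      case True
      have "t * (1/2) \<le> t * bump x" using bump_half[OF True] t by (rule mult_left_mono)
      then have le: "t / 2 \<le> t * bump x" by simp
      have "prim f 1 * (t / 2) powr theta \<le> prim f 1 * (t * bump x) powr theta"
        using le t theta prim_1_pos by (intro mult_left_mono powr_mono2) auto
      also have "\<dots> \<le> prim f (t * bump x)" using le t2 by (intro prim_superquadratic) linarith
      finally show ?thesis using True by (simp add: scaleR_fun_def)
    qed (simp add: prim_nonneg)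
  qed
  finally have "\<mu> * (prim f 1 * (t / 2) powr theta) \<le> (\<integral>x. prim f ((t *\<^sub>R bump) (x::'a)) \<partial>lebesgue)" .
  moreover have "(t / 2) powr theta = t powr theta * (1/2) powr theta"
    using powr_mult[of t "1/2" theta] by simp
  ultimately have "\<mu> * prim f 1 * (1/2) powr theta * t powr theta \<le> (\<integral>x. prim f ((t *\<^sub>R bump) (x::'a)) \<partial>lebesgue)"
    by (simp only: mult_ac)
  then show "J (t *\<^sub>R bump) \<le> ?A / 2 * t\<^sup>2 - measure lebesgue ?B * prim f 1 * (1/2) powr theta * t powr theta"
    using q unfolding J_def \<mu>_def by linarith
qed

text \<open>The two coefficients 1/4 are bought separately: the one of the energy term by a large
  \<open>l\<close> that depends on \<open>M\<close> but not on \<open>V\<close>, the one of the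
  quadratic term by a large \<open>Lam\<close> once \<open>l\<close> is fixed.\<close>

lemma exterior_bound:
  assumes u: "inE K V u" and Nu: "N u \<le> M" and l: "l > 0" and lM: "c0 * (Cp p * l powr (p - qs)) * M powr (qs - 2) \<le> 1/4"
    and Lam: "Lam > 0" "c0 * l powr (p - 2) / Lam \<le> 1/4" and ext: "\<And>x. R \<le> norm x \<Longrightarrow> Lam \<le> V x"
  shows "c0 * (\<integral>x. indicator (- ball 0 R) x * \<bar>u x\<bar> powr p \<partial>lebesgue) \<le> (N u)\<^sup>2 / 2"
proof -
  have Nq: "N u powr qs = N u powr (qs - 2) * (N u)\<^sup>2"
    by (rule powr_eq_times_square[OF N_nonneg])
  have "(\<integral>x. indicator (- ball 0 R) x * \<bar>u x\<bar> powr p \<partial>lebesgue) \<le> l powr (p - 2) / Lam * (N u)\<^sup>2 + Cp p * l powr (p - qs) * N u powr qs"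
    using p ext by (intro Lp_region_le u p_qs l Lam) auto
  then have "c0 * (\<integral>x. indicator (- ball 0 R) x * \<bar>u x\<bar> powr p \<partial>lebesgue) \<le>
      c0 * (l powr (p - 2) / Lam * (N u)\<^sup>2 + Cp p * l powr (p - qs) * N u powr qs)"
    using c0 by (intro mult_left_mono) auto
  also have "\<dots> = c0 * l powr (p - 2) / Lam * (N u)\<^sup>2 + c0 * (Cp p * l powr (p - qs)) * N u powr (qs - 2) * (N u)\<^sup>2"
    unfolding Nq by (simp add: algebra_simps)
  also have "\<dots> \<le> 1/4 * (N u)\<^sup>2 + 1/4 * (N u)\<^sup>2"
  proof (intro add_mono mult_right_mono Lam)
    have "c0 * (Cp p * l powr (p - qs)) * N u powr (qs - 2) \<le> c0 * (Cp p * l powr (p - qs)) * M powr (qs - 2)"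
      using c0 Cp_pos[OF p_qs] Nu N_nonneg[of u] tau by (intro mult_left_mono powr_mono2) auto
    then show "c0 * (Cp p * l powr (p - qs)) * N u powr (qs - 2) \<le> 1/4" using lM by linarith
  qed auto
  finally show ?thesis by simp
qed

text \<open>Bounded integrals of the power \<open>q > p\<close> prevent concentration: the power
  \<open>p\<close> is at most a constant plus \<open>\<epsilon>\<close> times the power
  \<open>q\<close>, and constants are integrable over a ball. Escape to infinity is not excluded,
  whence the restriction to a ball.\<close>

lemma vanishing_on_ball:
  fixes w :: "nat \<Rightarrow> 'a \<Rightarrow> real"
  assumes w: "\<And>k. inE K V (w k)" and Nw: "\<And>k. N (w k) \<le> B" and lim: "AE x in lebesgue. (\<lambda>k. w k x) \<longlonglongrightarrow> 0"
  shows "(\<lambda>k. \<integral>x. indicator (ball 0 R) x * \<bar>w k x\<bar> powr p \<partial>lebesgue) \<longlonglongrightarrow> 0"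
proof (rule dominated_up_to_small(2)[where b = "\<lambda>k x. \<bar>w k x\<bar> powr q" and C = "Aq B"])
  note [measurable] = inE_measurable[OF w]
  have [measurable]: "ball 0 R \<in> sets (lebesgue :: 'a measure)" by simp
  show "(\<lambda>x. indicator (ball 0 R) x * \<bar>w k x\<bar> powr p) \<in> borel_measurable lebesgue" for k by measurable
  show "AE x in lebesgue. (\<lambda>k. indicator (ball 0 R) x * \<bar>w k x\<bar> powr p) \<longlonglongrightarrow> 0"
    using lim
  proof eventually_elim
    case (elim x)
    have "(\<lambda>k. \<bar>w k x\<bar> powr p) \<longlonglongrightarrow> 0"
      using p by (intro tendsto_zero_powrI[OF tendsto_rabs_zero[OF elim] tendsto_const]) auto
    then show ?case by (rule tendsto_mult_right_zero)
  qed
  show "integrable lebesgue (\<lambda>x. \<bar>w k x\<bar> powr q)" for k using q by (intro Lp_int w) auto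
  show "(\<integral>x. \<bar>w k x\<bar> powr q \<partial>lebesgue) \<le> Aq B" for k by (rule Lq_le[OF w Nw])
  fix \<epsilon> :: real assume \<epsilon>: "\<epsilon> > 0"
  define T where "T = (\<epsilon> powr (1 / (p - q))) powr p"
  show "\<exists>W. integrable lebesgue W \<and> (\<forall>x. 0 \<le> W x) \<and> (\<forall>k x. indicator (ball 0 R) x * \<bar>w k x\<bar> powr p \<le> W x + \<epsilon> * \<bar>w k x\<bar> powr q)"
  proof (intro exI[of _ "\<lambda>x::'a. indicator (ball 0 R) x * T"] conjI allI)
    have "emeasure lebesgue (ball 0 R :: 'a set) < \<infinity>" using emeasure_bounded_finite[of "ball 0 R :: 'a set"] by simp
    then show "integrable lebesgue (\<lambda>x::'a. indicator (ball 0 R) x * T)"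
      by (intro integrable_mult_left integrable_real_indicator) auto
    fix k and x :: 'a
    show "0 \<le> indicator (ball 0 R) x * T" by (simp add: T_def)
    have "\<bar>w k x\<bar> powr p \<le> T + \<epsilon> * \<bar>w k x\<bar> powr q" unfolding T_def using p q \<epsilon> by (intro powr_interpolate) auto
    then show "indicator (ball 0 R) x * \<bar>w k x\<bar> powr p \<le> indicator (ball 0 R) x * T + \<epsilon> * \<bar>w k x\<bar> powr q"
      using \<epsilon> by (auto simp: indicator_def)
  qed
qed auto

lemma critical_point_nonneg:
  assumes v: "inE K V v" and crit: "\<And>\<phi>. inE K V \<phi> \<Longrightarrow> D v \<phi> = 0"
  shows "AE x in lebesgue. v x \<ge> 0"
proof -
  define n where "n = (\<lambda>x. max 0 (- v x))"
  have n: "inE K V n" and fn: "form v n \<le> - form n n" using negative_part_form[OF v] by (auto simp: n_def)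
  \<comment> \<open>\<open>f (v x)\<close> vanishes where \<open>v x \<le> 0\<close>, and
    \<open>n x\<close> everywhere else.\<close>
  have "(\<lambda>x. f (v x) * n x) = (\<lambda>x. 0)" using f_nonpos by (auto simp: n_def max_def)
  then have "D v n = form v n" by (simp add: D_def)
  then have "form n n \<le> 0" using crit[OF n] fn by simp
  then have "N n = 0" using form_nonneg[of n] by (simp add: N_def)
  from AE_zero_if_N_zero[OF n this] show ?thesis
    by eventually_elim (auto simp: n_def max_def split: if_splits)
qed

text \<open>The conditions on \<open>M\<close>, \<open>l\<close> and the size of \<open>Lam\<close>
  mention neither \<open>R\<close> nor the lower bound \<open>c\<close> of \<open>V\<close>, so all
  these numbers can be fixed before \<open>V\<close> is given.\<close>

lemma solution_exists:
  assumes X: "inX K bump" and Vinf: "Vinf > 0" "\<And>x. x \<in> ball 0 1 \<Longrightarrow> V x \<le> Vinf"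
    and C0: "C0 = ray_bound (kform K bump bump + Vinf * (\<integral>x. (bump (x :: 'a))\<^sup>2 \<partial>lebesgue))
      (measure lebesgue (ball 0 (1/2) :: 'a set) * prim f 1 * (1/2) powr theta) theta"
    and M: "M \<ge> 1" "\<And>y. M \<le> y \<Longrightarrow> theta * (C0 + 1) - (theta / 2 - 1) * y\<^sup>2 \<le> - y"
    and l: "l > 0" "c0 * (Cp p * l powr (p - qs)) * (M + 1) powr (qs - 2) \<le> 1/4"
    and Lam: "Lam > 0" "c0 * l powr (p - 2) / Lam \<le> 1/4" and ext: "\<And>x. R \<le> norm x \<Longrightarrow> Lam \<le> V x"
  shows "\<exists>v. inE K V v \<and> (AE x in lebesgue. v x \<ge> 0) \<and> \<not> (AE x in lebesgue. v x = 0) \<and>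
    (\<forall>\<phi>. inE K V \<phi> \<longrightarrow> D v \<phi> = 0)"
proof -
  obtain \<rho> where \<rho>: "0 < \<rho>" "\<rho> \<le> 1"
    and small: "\<And>u. inE K V u \<Longrightarrow> N u \<le> \<rho> \<Longrightarrow> c0 * (\<integral>x. \<bar>u x\<bar> powr p \<partial>lebesgue) \<le> (N u)\<^sup>2 / 4"
    by (rule small_ball) blast
  have bE: "inE K V bump" by (rule bump_inE(1)[OF X Vinf(2)])
  have Nb: "N bump > 0"
  proof -
    have "N bump \<noteq> 0"
      using L2_le_N[OF bE] bump_sq_integral_pos[where ?'a = 'a] by auto
    then show ?thesis using N_nonneg[of bump] by simp
  qed
  \<comment> \<open>The annulus is that between \<open>\<rho> / 2\<close> and \<open>\<rho>\<close>:
    there the energy is at least \<open>(N u)\<^sup>2 / 4\<close>, hence at least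
    \<open>\<rho>\<^sup>2 / 16\<close>.\<close>
  have "\<exists>b\<ge>\<rho>\<^sup>2 / 16. \<forall>\<epsilon>>0. \<exists>u\<in>E. N u \<le> M + 1 \<and> \<bar>J u - b\<bar> \<le> \<epsilon> \<and> (\<forall>h\<in>E. \<bar>D u h\<bar> \<le> \<epsilon> * N h)"
  proof (rule mountain_pass[where \<sigma> = "\<rho> / 2" and \<rho> = \<rho> and \<kappa> = 1 and e = bump and L = C0])
    show "subspace E" by (rule E_subspace)
    show "N (x + y) \<le> N x + N y" if "x \<in> E" "y \<in> E" for x y using that by (intro N_add E_D)
    show "N (r *\<^sub>R x) = \<bar>r\<bar> * N x" if "x \<in> E" for r x using that by (intro N_scale E_D)
    show "D u (x + y) = D u x + D u y" if "u \<in> E" "x \<in> E" "y \<in> E" for u x y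
      using D_lin[OF that[THEN E_D], of 1 1] by (simp add: plus_fun_def)
    show "D u (r *\<^sub>R x) = r * D u x" if "u \<in> E" "x \<in> E" for u r x
      using D_lin[OF E_D[OF that(1)] E_D[OF that(2)] E_D[OF that(2)], of r 0] by (simp add: scaleR_fun_def)
    show "\<exists>C. \<forall>u\<in>E. N u \<le> B \<longrightarrow> (\<forall>h\<in>E. \<bar>D u h\<bar> \<le> C * N h)" for B
      using D_bounded[OF E_D E_D] by blast
    show "\<rho>\<^sup>2 / 16 \<le> J u" if u: "u \<in> E" "\<rho> / 2 \<le> N u" "N u \<le> \<rho>" for u
    proof -
      have "\<bar>\<integral>x. prim f (u x) \<partial>lebesgue\<bar> \<le> (N u)\<^sup>2 / 4"
        using prim_integral_le[OF E_D[OF u(1)]] small[OF E_D[OF u(1)] u(3)] by linarith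
      then have "(N u)\<^sup>2 / 4 \<le> J u" unfolding J_def N_sq by linarith
      moreover have "(\<rho> / 2)\<^sup>2 \<le> (N u)\<^sup>2" using u \<rho> by (intro power_mono) auto
      ultimately show ?thesis by (simp add: power_divide)
    qed
    show "J (t *\<^sub>R bump) \<le> C0" if "0 \<le> t" for t unfolding C0 by (rule J_ray[OF X Vinf that])
    show "D u u \<le> - 1 * N u" if u: "u \<in> E" "M \<le> N u" "J u \<le> C0 + 1" for u
    proof -
      have "theta * J u \<le> theta * (C0 + 1)" using u theta by (intro mult_left_mono) auto
      then show ?thesis using AR_functional[OF E_D[OF u(1)]] M(2)[OF u(2)] by linarith
    qed
  qed (use N_nonneg J_diff D_unif \<rho> M bE Nb in \<open>auto simp: E_def J_def form_def kform_def kform_integrand_def prim_nonpos\<close>)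
  then obtain b where b: "b \<ge> \<rho>\<^sup>2 / 16"
    and PS: "\<And>\<epsilon>. \<epsilon> > 0 \<Longrightarrow> \<exists>u. inE K V u \<and> N u \<le> M + 1 \<and> \<bar>J u - b\<bar> \<le> \<epsilon> \<and> (\<forall>h. inE K V h \<longrightarrow> \<bar>D u h\<bar> \<le> \<epsilon> * N h)"
    by (auto simp: E_def)
  have b0: "b > 0" using b \<rho> by (smt (verit) divide_pos_pos zero_less_power)
  have "\<forall>k::nat. \<exists>u. inE K V u \<and> N u \<le> M + 1 \<and> \<bar>J u - b\<bar> \<le> inverse (Suc k) \<and> (\<forall>h. inE K V h \<longrightarrow> \<bar>D u h\<bar> \<le> inverse (Suc k) * N h)"
    using PS by (intro allI) simp
  then obtain u where u: "\<And>k::nat. inE K V (u k)" "\<And>k. N (u k) \<le> M + 1" "\<And>k. \<bar>J (u k) - b\<bar> \<le> inverse (Suc k)"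
    "\<And>k h. inE K V h \<Longrightarrow> \<bar>D (u k) h\<bar> \<le> inverse (Suc k) * N h"
    by metis
  have kb: "kform K (u k) (u k) \<le> (M + 1)\<^sup>2" for k
    using kform_le_N[of "u k"] power_mono[OF u(2)[of k] N_nonneg, of 2] by linarith
  obtain r v where r: "strict_mono r" and vm: "v \<in> borel_measurable lebesgue"
    and lim: "AE x in lebesgue. (\<lambda>k. u (r k) x) \<longlonglongrightarrow> v x"
    by (rule ae_convergent_subsequence[OF inE_inX[OF u(1)] L2_le[OF u(1,2)] kb])
  define w where "w k = u (r k)" for k
  have w: "inE K V (w k)" "N (w k) \<le> M + 1" for k by (simp_all add: w_def u)
  have inv0: "(\<lambda>k. inverse (real (Suc (r k)))) \<longlonglongrightarrow> 0"
    using LIMSEQ_subseq_LIMSEQ[OF LIMSEQ_inverse_real_of_nat r] by (simp add: o_def)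
  have wlim: "AE x in lebesgue. (\<lambda>k. w k x) \<longlonglongrightarrow> v x" using lim by (simp add: w_def)
  note wl = weak_limit[OF w vm wlim]
  have crit: "D v \<phi> = 0" if \<phi>: "inE K V \<phi>" for \<phi>
  proof -
    have "(\<lambda>k. inverse (real (Suc (r k))) * N \<phi>) \<longlonglongrightarrow> 0" by (rule tendsto_mult_left_zero[OF inv0])
    then have "(\<lambda>k. D (w k) \<phi>) \<longlonglongrightarrow> 0"
      by (rule Lim_null_comparison[rotated]) (use u(4)[OF \<phi>] in \<open>auto simp: w_def intro!: always_eventually\<close>)
    then show ?thesis using wl(2)[OF \<phi>] LIMSEQ_unique by blast
  qed
  have "\<not> (AE x in lebesgue. v x = 0)"
  proof
    assume "AE x in lebesgue. v x = 0"
    then have "AE x in lebesgue. (\<lambda>k. w k x) \<longlonglongrightarrow> 0" using wlim by eventually_elim simp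
    define a where "a k = (\<integral>x. indicator (ball 0 R) x * \<bar>w k x\<bar> powr p \<partial>lebesgue)" for k
    have a0: "a \<longlonglongrightarrow> 0" unfolding a_def by (rule vanishing_on_ball[OF w]) fact
    \<comment> \<open>\<open>D (w k) (w k)\<close> is the squared norm minus the integral of
      \<open>f (w k x) * w k x\<close>. The exterior part of that integral takes away at most half
      of the squared norm, and the rest tends to 0.\<close>
    have bound: "(N (w k))\<^sup>2 \<le> 2 * (inverse (real (Suc (r k))) * (M + 1) + c0 * a k)" for k
    proof -
      have p2: "2 \<le> p" using p by simp
      have li: "integrable lebesgue (\<lambda>x. \<bar>w k x\<bar> powr p)" by (rule Lp_int[OF w(1) p2 p_qs])
      have "(\<integral>x. f (w k x) * w k x \<partial>lebesgue) \<le> (\<integral>x. c0 * \<bar>w k x\<bar> powr p \<partial>lebesgue)"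
      proof (rule integral_mono[OF fu_pairing(1)[OF w(1) w(1) order_refl]])
        show "integrable lebesgue (\<lambda>x. c0 * \<bar>w k x\<bar> powr p)" using li by simp
        fix x
        have "f (w k x) * w k x \<le> \<bar>f (w k x)\<bar> * \<bar>w k x\<bar>" by (simp add: abs_mult[symmetric])
        also have "\<dots> \<le> c0 * \<bar>w k x\<bar> powr (p - 1) * \<bar>w k x\<bar>" by (intro mult_right_mono growth) simp
        also have "\<dots> = c0 * \<bar>w k x\<bar> powr p" using powr_mult_base[of "\<bar>w k x\<bar>" "p - 1"] by (simp add: mult_ac)
        finally show "f (w k x) * w k x \<le> c0 * \<bar>w k x\<bar> powr p" .
      qed
      also have "\<dots> = c0 * (\<integral>x. indicator (ball 0 R) x * \<bar>w k x\<bar> powr p + indicator (- ball 0 R) x * \<bar>w k x\<bar> powr p \<partial>lebesgue)"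
      proof -
        have "\<bar>w k x\<bar> powr p = indicator (ball 0 R) x * \<bar>w k x\<bar> powr p + indicator (- ball 0 R) x * \<bar>w k x\<bar> powr p" for x
          by (simp add: indicator_def)
        then show ?thesis by simp
      qed
      also have "(\<integral>x. indicator (ball 0 R) x * \<bar>w k x\<bar> powr p + indicator (- ball 0 R) x * \<bar>w k x\<bar> powr p \<partial>lebesgue)
          = a k + (\<integral>x. indicator (- ball 0 R) x * \<bar>w k x\<bar> powr p \<partial>lebesgue)"
        unfolding a_def by (intro Bochner_Integration.integral_add integrable_indicator_times li) auto
      finally have "(\<integral>x. f (w k x) * w k x \<partial>lebesgue) \<le> c0 * a k + c0 * (\<integral>x. indicator (- ball 0 R) x * \<bar>w k x\<bar> powr p \<partial>lebesgue)"
        by (simp add: distrib_left)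
      also have "c0 * (\<integral>x. indicator (- ball 0 R) x * \<bar>w k x\<bar> powr p \<partial>lebesgue) \<le> (N (w k))\<^sup>2 / 2"
        by (rule exterior_bound[OF w l Lam ext])
      finally have fb: "(\<integral>x. f (w k x) * w k x \<partial>lebesgue) \<le> c0 * a k + (N (w k))\<^sup>2 / 2" by simp
      have "D (w k) (w k) \<le> inverse (real (Suc (r k))) * N (w k)" using u(4)[OF w(1), of "r k"] by (simp add: w_def abs_le_iff)
      also have "\<dots> \<le> inverse (real (Suc (r k))) * (M + 1)" using w(2) by (intro mult_left_mono) auto
      finally have Db: "D (w k) (w k) \<le> inverse (real (Suc (r k))) * (M + 1)" .
      have "y \<le> 2 * (a' + b')" if "y - i \<le> a'" "i \<le> b' + y / 2" for y i a' b' :: real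
        using that by argo
      from this[OF Db[unfolded D_def] fb[unfolded N_sq]] show ?thesis unfolding N_sq .
    qed
    have rhs0: "(\<lambda>k. 2 * (inverse (real (Suc (r k))) * (M + 1) + c0 * a k)) \<longlonglongrightarrow> 0"
    proof -
      have "(\<lambda>k. inverse (real (Suc (r k))) * (M + 1) + c0 * a k) \<longlonglongrightarrow> 0 + 0"
        by (intro tendsto_add tendsto_mult_left_zero[OF inv0] tendsto_mult_right_zero[OF a0])
      then show ?thesis by (intro tendsto_mult_right_zero) simp
    qed
    have N0: "(\<lambda>k. (N (w k))\<^sup>2) \<longlonglongrightarrow> 0"
      by (rule tendsto_sandwich[OF _ _ tendsto_const rhs0]) (use bound in \<open>auto intro!: always_eventually\<close>)
    have "eventually (\<lambda>k. (N (w k))\<^sup>2 < \<rho>\<^sup>2) sequentially" using order_tendstoD(2)[OF N0, of "\<rho>\<^sup>2"] \<rho> by simp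
    then have "eventually (\<lambda>k. \<bar>J (w k)\<bar> \<le> (N (w k))\<^sup>2) sequentially"
    proof eventually_elim
      case (elim k)
      then have "N (w k) \<le> \<rho>" using \<rho> power2_less_imp_less[OF elim] by simp
      then have "\<bar>\<integral>x. prim f (w k x) \<partial>lebesgue\<bar> \<le> (N (w k))\<^sup>2 / 4"
        using prim_integral_le[OF w(1)] small[OF w(1)] by (rule_tac order_trans)
      then show ?case unfolding J_def N_sq using form_nonneg[of "w k"] by linarith
    qed
    then have "(\<lambda>k. J (w k)) \<longlonglongrightarrow> 0" by (intro Lim_null_comparison[OF _ N0]) simp
    moreover have "(\<lambda>k. J (w k)) \<longlonglongrightarrow> b"
    proof -
      have "(\<lambda>k. J (w k) - b) \<longlonglongrightarrow> 0"
        by (rule Lim_null_comparison[OF _ inv0]) (use u(3) in \<open>auto simp: w_def intro!: always_eventually\<close>)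
      then show ?thesis by (simp add: LIM_zero_iff)
    qed
    ultimately have "b = 0" using LIMSEQ_unique by blast
    then show False using b0 by simp
  qed
  then show ?thesis using wl(1) crit critical_point_nonneg[OF wl(1) crit] by blast
qed

end

theorem theorem5p2:
  fixes K :: "'a::euclidean_space \<Rightarrow> real"
    and f :: "real \<Rightarrow> real"
    and s p c0 theta Vinf :: real
  assumes s: "0 < s" "s < 1" "real DIM('a) > 2 * s"
    and K_meas: "K \<in> borel_measurable lebesgue"
    and K_pos: "\<forall>x. K x > 0"
    and K1: "\<forall>x. K x = K (- x)"
    and K2: "\<exists>lam>0. AE x in lebesgue. lam \<le> K x * norm x powr (real DIM('a) + 2 * s)"
    and K3: "integrable lebesgue (\<lambda>x. min ((norm x)\<^sup>2) 1 * K x)"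
    and Vinf_pos: "Vinf > 0"
    and f_cont: "continuous_on UNIV f"
    and f1: "c0 > 0" "2 < p" "p < 2 * real DIM('a) / (real DIM('a) - 2 * s)"
            "\<forall>t. \<bar>f t\<bar> \<le> c0 * \<bar>t\<bar> powr (p - 1)"
    and f2: "theta > 2" "\<forall>t>0. theta * prim f t \<le> t * f t"
    and f3: "\<forall>t>0. f t > 0" "\<forall>t<0. f t = 0"
  shows "\<exists>LamStar>0. \<forall>(V :: 'a \<Rightarrow> real) R Lam.
           continuous_on UNIV V \<and> (\<exists>c>0. \<forall>x. c \<le> V x) \<and>
           (\<forall>x\<in>ball 0 1. V x \<le> Vinf) \<and>
           R > 0 \<and> Lam > LamStar \<and> (\<forall>x. norm x \<ge> R \<longrightarrow> V x \<ge> Lam) \<longrightarrow>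
           (\<exists>u. inE K V u \<and> (AE x in lebesgue. u x \<ge> 0) \<and> \<not> (AE x in lebesgue. u x = 0) \<and>
              (\<forall>phi. inE K V phi \<longrightarrow>
                 integrable lebesgue (kform_integrand K u phi) \<and>
                 integrable lebesgue (\<lambda>x. V x * u x * phi x) \<and>
                 integrable lebesgue (\<lambda>x. f (u x) * phi x) \<and>
                 kform K u phi + (\<integral>x. V x * u x * phi x \<partial>lebesgue) =
                   (\<integral>x. f (u x) * phi x \<partial>lebesgue)))"
proof -
  obtain lam where lam: "lam > 0" "AE x in lebesgue. lam \<le> K x * norm x powr (real DIM('a) + 2 * s)"
    using K2 by blast
  interpret kernel K s lam
    by unfold_locales (use s K_meas K_pos lam in auto)
  interpret nonlinearity f c0 p theta
    by unfold_locales (use f_cont f1 f2 f3 in auto)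
  have X: "inX K bump" by (rule bump_inX[OF K3])
  have pqs: "p < qs" using f1(3) by (simp add: qs_def dim_def)
  \<comment> \<open>All constants up to \<open>L\<close> are built before \<open>V\<close>,
    \<open>R\<close> and \<open>Lam\<close> are introduced, so \<open>L\<close> can depend on none
    of them.\<close>
  define C0 where "C0 = ray_bound (kform K bump bump + Vinf * (\<integral>x. (bump (x :: 'a))\<^sup>2 \<partial>lebesgue))
      (measure lebesgue (ball 0 (1/2) :: 'a set) * prim f 1 * (1/2) powr theta) theta"
  have C0: "C0 \<ge> 0"
    unfolding C0_def ray_bound_def using kform_nonneg[of bump] Vinf_pos
    by (intro mult_nonneg_nonneg divide_nonneg_nonneg add_nonneg_nonneg) auto
  define a where "a = theta / 2 - 1"
  have a: "a > 0" using f2(1) by (simp add: a_def)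
  \<comment> \<open>For \<open>y \<ge> M\<close> one has
    \<open>a * y\<^sup>2 \<ge> (theta * (C0 + 1) + 1) * y\<close>; since \<open>y \<ge> 1\<close>,
    the right side is at least \<open>theta * (C0 + 1) + y\<close>.\<close>
  define M where "M = max 1 ((theta * (C0 + 1) + 1) / a)"
  have M1: "M \<ge> 1" by (simp add: M_def)
  have M2: "theta * (C0 + 1) - (theta / 2 - 1) * y\<^sup>2 \<le> - y" if y: "M \<le> y" for y
  proof -
    have "(theta * (C0 + 1) + 1) / a \<le> y" "1 \<le> y" using y by (auto simp: M_def)
    then have "theta * (C0 + 1) + 1 \<le> a * y" using a by (simp add: field_simps)
    then have "(theta * (C0 + 1) + 1) * y \<le> a * y * y" using \<open>1 \<le> y\<close> by (intro mult_right_mono) auto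
    moreover have "theta * (C0 + 1) * 1 \<le> theta * (C0 + 1) * y"
      using \<open>1 \<le> y\<close> C0 f2(1) by (intro mult_left_mono) auto
    ultimately show ?thesis unfolding a_def[symmetric] by (simp add: power2_eq_square algebra_simps)
  qed
  \<comment> \<open>The Palais-Smale sequence lives in the ball of radius \<open>M + 1\<close>, not
    \<open>M\<close>. As \<open>p - qs\<close> is negative, \<open>l\<close> is the height at which
    \<open>A * l powr (p - qs)\<close> has come down to 1/4.\<close>
  define A where "A = c0 * Cp p * (M + 1) powr (qs - 2)"
  have A: "A > 0" using f1(1) Cp_pos[OF pqs] M1 by (simp add: A_def)
  define l where "l = (1 / (4 * A)) powr (1 / (p - qs))"
  have l: "l > 0" using A by (simp add: l_def)
  have "l powr (p - qs) = 1 / (4 * A)" using A pqs by (simp add: l_def powr_powr)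
  then have "A * l powr (p - qs) = 1 / 4" using A by simp
  then have lM: "c0 * (Cp p * l powr (p - qs)) * (M + 1) powr (qs - 2) \<le> 1/4" by (simp add: A_def mult_ac)
  \<comment> \<open>The value of \<open>Lam\<close> at which the quadratic coefficient in
    \<open>exterior_bound\<close> equals 1/4.\<close>
  define L where "L = 4 * c0 * l powr (p - 2)"
  have L: "L > 0" using f1(1) l by (simp add: L_def)
  show ?thesis
  proof (intro exI[of _ L] conjI L allI impI)
    fix V :: "'a \<Rightarrow> real" and R Lam
    assume "continuous_on UNIV V \<and> (\<exists>c>0. \<forall>x. c \<le> V x) \<and> (\<forall>x\<in>ball 0 1. V x \<le> Vinf) \<and>
           R > 0 \<and> Lam > L \<and> (\<forall>x. norm x \<ge> R \<longrightarrow> V x \<ge> Lam)"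
    then obtain c where V: "continuous_on UNIV V" "c > 0" "\<And>x. c \<le> V x" "\<And>x. x \<in> ball 0 1 \<Longrightarrow> V x \<le> Vinf"
      and Lam: "Lam > L" and ext: "\<And>x. R \<le> norm x \<Longrightarrow> Lam \<le> V x" by blast
    interpret problem K s lam V c f c0 p theta
      by unfold_locales (use V f1 in auto)
    have Lam0: "Lam > 0" using Lam L by linarith
    have "c0 * l powr (p - 2) / Lam \<le> 1/4" using Lam Lam0 by (simp add: L_def field_simps)
    then obtain v where v: "inE K V v" "AE x in lebesgue. v x \<ge> 0" "\<not> (AE x in lebesgue. v x = 0)"
      and crit: "\<And>\<phi>. inE K V \<phi> \<Longrightarrow> D v \<phi> = 0"
      using solution_exists[OF X Vinf_pos V(4) C0_def M1 M2 l lM Lam0 _ ext] by blast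
    show "\<exists>u. inE K V u \<and> (AE x in lebesgue. u x \<ge> 0) \<and> \<not> (AE x in lebesgue. u x = 0) \<and>
              (\<forall>phi. inE K V phi \<longrightarrow>
                 integrable lebesgue (kform_integrand K u phi) \<and>
                 integrable lebesgue (\<lambda>x. V x * u x * phi x) \<and>
                 integrable lebesgue (\<lambda>x. f (u x) * phi x) \<and>
                 kform K u phi + (\<integral>x. V x * u x * phi x \<partial>lebesgue) =
                   (\<integral>x. f (u x) * phi x \<partial>lebesgue))"
    proof (intro exI[of _ v] conjI allI impI v)
      fix phi assume phi: "inE K V phi"
      show "integrable lebesgue (kform_integrand K v phi)" by (rule kform_integrable[OF inE_inX[OF v(1)] inE_inX[OF phi]])
      show "integrable lebesgue (\<lambda>x. V x * v x * phi x)" by (rule Vuv_integrable[OF v(1) phi])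
      show "integrable lebesgue (\<lambda>x. f (v x) * phi x)" by (rule fu_pairing(1)[OF v(1) phi order_refl])
      show "kform K v phi + (\<integral>x. V x * v x * phi x \<partial>lebesgue) = (\<integral>x. f (v x) * phi x \<partial>lebesgue)"
        using crit[OF phi] by (simp add: D_def form_def)
    qed
  qed
qed

end
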